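(* For real $\nu<0$ with $\nu>-1/10$ let $y_1(t),\dots,y_{15}(t)$, $0\le t\le 1$, be the solution of the Cauchy problem $$ \begin{aligned} \dot y_1&=-2u_p^2,\quad \dot y_2=4\big(y_1+2y_4u_p-2(2t-1)u_p^2\big),\\ \dot y_3&=2(7t-3)y_1+4y_2-4y_4^2+8(5t-3)y_4u_p+8y_5u_p-2(47t^2-46t+9)u_p^2,\\ \dot y_4&=-2u_p,\quad \dot y_5=4\big(y_4+(1-3t)u_p\big),\quad \dot y_6=-4\nu\big((t+1)u_p+y_4\big),\\ \dot y_7&=-2u_q^2,\quad \dot y_8=4\big(y_7+2y_{10}u_q-2(2t-1)u_q^2\big),\\ \dot y_9&=2(7t-3)y_7+4y_8-4y_{10}^2+8(5t-3)y_{10}u_q+8y_{11}u_q-2(47t^2-46t+9)u_q^2,\\ \dot y_{10}&=-2u_q,\quad \dot y_{11}=4\big(y_{10}+(1-3t)u_q\big),\quad \dot y_{12}=-4\nu\big((t+1)u_q+y_{10}\big)-4,\\ \dot y_{13}&=-2u_pu_q,\quad \dot y_{14}=4(y_{13}+y_4u_q+y_{10}u_p)-8(2t-1)u_pu_q,\\ \dot y_{15}&=2(7t-3)y_{13}+4y_{14}-4y_4y_{10}+4(5t-3)(y_4u_q+y_{10}u_p)+4y_5u_q+4y_{11}u_p-2(47t^2-46t+9)u_pu_q, \end{aligned} $$ with initial values $y_6(0)=1$ and $y_k(0)=0$ for all $k\neq 6$, where $$ u_p=\frac{2\nu(3-5t)y_4+2\nu y_5-y_6}{16\nu t^2-8\nu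 t+2\nu+1},\qquad u_q=\frac{2\nu(3-5t)y_{10}+2\nu y_{11}-y_{12}+2(1-3t)}{16\nu t^2-8\nu t+2\nu+1}. $$ Then the Bombieri number $\sigma_{42}$ equals $-\nu^*$, where $\nu^*$ is the maximum of all negative roots $\nu$ of the two equations $$ y_1(1)+\nu y_3(1)=0 $$ and $$ \big(y_1(1)+\nu y_3(1)\big)\big(y_7(1)+\nu y_9(1)\big)-\big(y_{13}(1)+\nu y_{15}(1)\big)^2=0 . $$
   Context: $S$ is the class of all holomorphic univalent functions $f(z)=z+\sum_{n\ge2}a_nz^n$ in the unit disk $U=\{z:|z|<1\}$, and $K(z)=z/(1-z)^2=\sum_{n\ge1}nz^n\in S$ is the Koebe function. For integers $m,n\ge2$ the Bombieri number is $$\sigma_{mn}=\liminf_{f\to K,\ f\in S}\frac{n-\operatorname{Re}a_n}{m-\operatorname{Re}a_m},$$ where $f\to K$ locally uniformly in $U$ (and the quotient is taken where the denominator is nonzero). In particular $\sigma_{42}$ is the case $m=4$, $n=2$. The letters $u_p,u_q$ are merely names for the displayed expressions in $t,\nu,y_k$; the dot denotes $d/dt$. *)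

theory Defs
  imports "HOL-Complex_Analysis.Complex_Analysis"
begin

definition univalent_class :: "(complex \<Rightarrow> complex) set" where
  "univalent_class =
     {f. f holomorphic_on ball 0 1 \<and> inj_on f (ball 0 1) \<and> f 0 = 0 \<and> deriv f 0 = 1}"

definition koebe :: "complex \<Rightarrow> complex" where
  "koebe z = z / (1 - z)\<^sup>2"

definition taylor_coeff :: "(complex \<Rightarrow> complex) \<Rightarrow> nat \<Rightarrow> complex" where
  "taylor_coeff f n = fps_nth (fps_expansion f 0) n"

(* Neighbourhoods of g for locally uniform convergence in the unit disk,
   i.e. uniform convergence on each compact subset. *)
definition locally_uniformly_at :: "(complex \<Rightarrow> complex) \<Rightarrow> (complex \<Rightarrow> complex) filter" where
  "locally_uniformly_at g = (INF C\<in>{C. compact C \<and> C \<subseteq> ball 0 1}. uniformly_on C g)"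

(* Functions at which the denominator vanishes are removed from the filter,
   since x / 0 = 0 in HOL; this removes the Koebe function itself. *)
definition bombieri_number :: "nat \<Rightarrow> nat \<Rightarrow> ereal" where
  "bombieri_number m n =
     Liminf (inf (locally_uniformly_at koebe)
                 (principal {f \<in> univalent_class. real m - Re (taylor_coeff f m) \<noteq> 0}))
            (\<lambda>f. ereal ((real n - Re (taylor_coeff f n)) / (real m - Re (taylor_coeff f m))))"

definition u_p :: "real \<Rightarrow> (nat \<Rightarrow> real \<Rightarrow> real) \<Rightarrow> real \<Rightarrow> real" where
  "u_p \<nu> y t =
     (2 * \<nu> * (3 - 5 * t) * y 4 t + 2 * \<nu> * y 5 t - y 6 t)
       / (16 * \<nu> * t\<^sup>2 - 8 * \<nu> * t + 2 * \<nu> + 1)"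

definition u_q :: "real \<Rightarrow> (nat \<Rightarrow> real \<Rightarrow> real) \<Rightarrow> real \<Rightarrow> real" where
  "u_q \<nu> y t =
     (2 * \<nu> * (3 - 5 * t) * y 10 t + 2 * \<nu> * y 11 t - y 12 t + 2 * (1 - 3 * t))
       / (16 * \<nu> * t\<^sup>2 - 8 * \<nu> * t + 2 * \<nu> + 1)"

(* The right-hand side of the k-th equation is the entry k - 1 of this list. *)
definition cauchy_rhs :: "real \<Rightarrow> (nat \<Rightarrow> real \<Rightarrow> real) \<Rightarrow> real \<Rightarrow> real list" where
  "cauchy_rhs \<nu> y t =
    [- 2 * (u_p \<nu> y t)\<^sup>2,
     4 * (y 1 t + 2 * y 4 t * u_p \<nu> y t - 2 * (2 * t - 1) * (u_p \<nu> y t)\<^sup>2),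
     2 * (7 * t - 3) * y 1 t + 4 * y 2 t - 4 * (y 4 t)\<^sup>2
       + 8 * (5 * t - 3) * y 4 t * u_p \<nu> y t + 8 * y 5 t * u_p \<nu> y t
       - 2 * (47 * t\<^sup>2 - 46 * t + 9) * (u_p \<nu> y t)\<^sup>2,
     - 2 * u_p \<nu> y t,
     4 * (y 4 t + (1 - 3 * t) * u_p \<nu> y t),
     - 4 * \<nu> * ((t + 1) * u_p \<nu> y t + y 4 t),
     - 2 * (u_q \<nu> y t)\<^sup>2,
     4 * (y 7 t + 2 * y 10 t * u_q \<nu> y t - 2 * (2 * t - 1) * (u_q \<nu> y t)\<^sup>2),
     2 * (7 * t - 3) * y 7 t + 4 * y 8 t - 4 * (y 10 t)\<^sup>2
       + 8 * (5 * t - 3) * y 10 t * u_q \<nu> y t + 8 * y 11 t * u_q \<nu> y t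
       - 2 * (47 * t\<^sup>2 - 46 * t + 9) * (u_q \<nu> y t)\<^sup>2,
     - 2 * u_q \<nu> y t,
     4 * (y 10 t + (1 - 3 * t) * u_q \<nu> y t),
     - 4 * \<nu> * ((t + 1) * u_q \<nu> y t + y 10 t) - 4,
     - 2 * u_p \<nu> y t * u_q \<nu> y t,
     4 * (y 13 t + y 4 t * u_q \<nu> y t + y 10 t * u_p \<nu> y t)
       - 8 * (2 * t - 1) * u_p \<nu> y t * u_q \<nu> y t,
     2 * (7 * t - 3) * y 13 t + 4 * y 14 t - 4 * y 4 t * y 10 t
       + 4 * (5 * t - 3) * (y 4 t * u_q \<nu> y t + y 10 t * u_p \<nu> y t)
       + 4 * y 5 t * u_q \<nu> y t + 4 * y 11 t * u_p \<nu> y t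
       - 2 * (47 * t\<^sup>2 - 46 * t + 9) * u_p \<nu> y t * u_q \<nu> y t]"

definition cauchy_solution :: "real \<Rightarrow> (nat \<Rightarrow> real \<Rightarrow> real) \<Rightarrow> bool" where
  "cauchy_solution \<nu> y \<longleftrightarrow>
     (\<forall>k\<in>{1..15}. y k 0 = (if k = 6 then 1 else 0) \<and>
        (\<forall>t\<in>{0..1}. (y k has_real_derivative cauchy_rhs \<nu> y t ! (k - 1)) (at t within {0..1})))"

end

theory Submission
  imports Defs "HOL-Real_Asymp.Real_Asymp"
begin

text \<open>
  Every function in \<open>S\<close> is, up to arbitrarily small errors in \<open>a\<^sub>2\<close>, \<open>a\<^sub>3\<close>, \<open>a\<^sub>4\<close>, generated by
  Loewner's equation with a piecewise constant driving function \<open>p = e\<^sup>i\<^sup>v\<close>: a bounded univalent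
  function with inner radius below 1 omits a point close to the unit circle, Koebe's square-root
  transform at that point enlarges the inner radius, and to first order one such transform is one
  Loewner step. With \<open>v = \<epsilon> s\<close> the deficits \<open>2 - Re a\<^sub>2\<close> and \<open>4 - Re a\<^sub>4\<close> are \<open>\<epsilon>\<^sup>2\<close> times quadratic forms
  \<open>Q\<^sub>2(s)\<close> and \<open>Q\<^sub>4(s)\<close>. For large \<open>v\<close> the expansion is kept uniform by working with \<open>x = sin v cos v\<close>;
  then \<open>4 - Re a\<^sub>4\<close> equals \<open>Q\<^sub>4(x)\<close> plus a term with a favourable sign (the needle variations) up to
  \<open>O((2 - Re a\<^sub>2)\<^sup>3\<^sup>/\<^sup>2)\<close>. Hence \<open>\<sigma>\<^sub>4\<^sub>2\<close> is the minimum of \<open>Q\<^sub>2/Q\<^sub>4\<close>, that is, \<open>-\<nu>*\<close> for the smallest \<open>\<nu>\<close>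
  with \<open>Q\<^sub>2 + \<nu> Q\<^sub>4 \<ge> 0\<close>. For \<open>\<nu> > -1/10\<close> this form is a positive weight plus a compact operator, so at
  \<open>\<nu>*\<close> it has a kernel; differentiating the kernel equation twice gives a linear equation of second
  order, whose solutions are \<open>\<alpha> u\<^sub>p + \<beta> u\<^sub>q\<close>, and on these functions the form is \<open>-1/2\<close> times the
  quadratic form in \<open>(\<alpha>, \<beta>)\<close> with entries \<open>y\<^sub>1 + \<nu> y\<^sub>3\<close>, \<open>y\<^sub>1\<^sub>3 + \<nu> y\<^sub>1\<^sub>5\<close>, \<open>y\<^sub>7 + \<nu> y\<^sub>9\<close> at \<open>t = 1\<close>.
  It is degenerate at \<open>\<nu>*\<close> and negative definite for \<open>\<nu>* < \<nu> < 0\<close>.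
\<close>

text \<open>The bound \<open>\<nu> > -1/10\<close> comes from \<open>wt t \<le> 10\<close>: it keeps
  the weight \<open>1 + \<nu> * wt t\<close> positive, on which the compactness argument, the
  uniqueness for the Volterra equation and the sign of the needle term all rest. Crude bounds place
  the extremal parameter between -1/18 and -1/60, well inside. A lower bound for the quotient also
  requires a positive denominator near \<open>koebe\<close>; hence the coercivity of
  \<open>qform4\<close> and the bound of the needle term from below. Square-root steps avoid all
  boundary behaviour of f. A step of length x whose inner radii have ratio 1 - l differs from a
  Loewner step by O(x*l); the lengths add up to at most 1, so the total error is O(l). Conversely,
  genuine univalent functions are required as competitors; for step controls they are explicit
  compositions of Pick maps, so trial functions are sampled. Bounded piecewise continuous functions
  are not complete in mean square. The kernel element is therefore built by hand: primitives of a
  minimizing sequence converge uniformly, and dividing by the weight gives a continuous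
  limit.\<close>

section \<open>Piecewise continuous functions on the unit interval\<close>

text \<open>One-sided limits at the exceptional points are not required.\<close>
definition pc :: "(real \<Rightarrow> 'a::euclidean_space) \<Rightarrow> bool" where
  "pc f \<longleftrightarrow> bounded (f ` {0..1}) \<and> (\<exists>F. finite F \<and> continuous_on ({0..1} - F) f)"

lemma pcE:
  assumes "pc f"
  obtains F B where "finite F" "continuous_on ({0..1} - F) f" "B > 0" "\<And>t. 0 \<le> t \<Longrightarrow> t \<le> 1 \<Longrightarrow> norm (f t) \<le> B"
proof -
  obtain F where "finite F" "continuous_on ({0..1} - F) f" using assms by (auto simp: pc_def)
  moreover obtain B where "B > 0" "\<forall>x\<in>f ` {0..1}. norm x \<le> B"
    using assms unfolding pc_def bounded_pos by blast
  ultimately show ?thesis using that by auto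
qed

lemma pcI:
  assumes "finite F" "continuous_on ({0..1} - F) f" "\<And>t. 0 \<le> t \<Longrightarrow> t \<le> 1 \<Longrightarrow> norm (f t) \<le> B"
  shows "pc f"
  using assms unfolding pc_def bounded_iff by (metis atLeastAtMost_iff imageE)

lemma pc_continuous: "continuous_on {0..1} f \<Longrightarrow> pc f"
  unfolding pc_def
  by (metis Diff_empty compact_Icc compact_continuous_image compact_imp_bounded finite.emptyI)

lemma pc_const: "pc (\<lambda>t. c)"
  by (rule pc_continuous) simp

lemma pc_add:
  assumes "pc f" "pc g"
  shows "pc (\<lambda>t. f t + g t)"
proof -
  obtain F B where F: "finite F" "continuous_on ({0..1} - F) f" "\<And>t. 0 \<le> t \<Longrightarrow> t \<le> 1 \<Longrightarrow> norm (f t) \<le> B"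
    using pcE[OF assms(1)] by metis
  obtain G C where G: "finite G" "continuous_on ({0..1} - G) g" "\<And>t. 0 \<le> t \<Longrightarrow> t \<le> 1 \<Longrightarrow> norm (g t) \<le> C"
    using pcE[OF assms(2)] by metis
  show ?thesis
  proof (rule pcI)
    show "finite (F \<union> G)" using F G by simp
    show "continuous_on ({0..1} - (F \<union> G)) (\<lambda>t. f t + g t)"
      by (intro continuous_intros continuous_on_subset[OF F(2)] continuous_on_subset[OF G(2)]) auto
    show "norm (f t + g t) \<le> B + C" if "0 \<le> t" "t \<le> 1" for t
      using F(3)[OF that] G(3)[OF that] norm_triangle_ineq[of "f t" "g t"] by linarith
  qed
qed

lemma pc_bounded_bilinear:
  assumes "bounded_bilinear h" "pc f" "pc g"
  shows "pc (\<lambda>t. h (f t) (g t))"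
proof -
  interpret bounded_bilinear h by fact
  obtain F B where F: "finite F" "continuous_on ({0..1} - F) f" "B > 0" "\<And>t. 0 \<le> t \<Longrightarrow> t \<le> 1 \<Longrightarrow> norm (f t) \<le> B"
    using pcE[OF assms(2)] by metis
  obtain G C where G: "finite G" "continuous_on ({0..1} - G) g" "C > 0" "\<And>t. 0 \<le> t \<Longrightarrow> t \<le> 1 \<Longrightarrow> norm (g t) \<le> C"
    using pcE[OF assms(3)] by metis
  obtain K where K: "K > 0" "\<And>a b. norm (h a b) \<le> norm a * norm b * K" using pos_bounded by blast
  show ?thesis
  proof (rule pcI)
    show "finite (F \<union> G)" using F G by simp
    show "continuous_on ({0..1} - (F \<union> G)) (\<lambda>t. h (f t) (g t))"
      by (intro continuous_on continuous_on_subset[OF F(2)] continuous_on_subset[OF G(2)]) auto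
    show "norm (h (f t) (g t)) \<le> B * C * K" if "0 \<le> t" "t \<le> 1" for t
    proof -
      have "norm (h (f t) (g t)) \<le> norm (f t) * norm (g t) * K" by (rule K)
      also have "\<dots> \<le> B * C * K"
        using F G K that by (intro mult_mono) auto
      finally show ?thesis .
    qed
  qed
qed

lemmas pc_mult = pc_bounded_bilinear[OF bounded_bilinear_mult]

text \<open>The values of \<open>f\<close> lie in a closed ball, and the continuous \<open>g\<close>
  is bounded on this compact set.\<close>

lemma pc_compose:
  fixes g :: "'a::euclidean_space \<Rightarrow> 'b::euclidean_space"
  assumes "pc f" "continuous_on UNIV g"
  shows "pc (\<lambda>t. g (f t))"
proof -
  obtain F B where F: "finite F" "continuous_on ({0..1} - F) f" "B > 0" "\<And>t. 0 \<le> t \<Longrightarrow> t \<le> 1 \<Longrightarrow> norm (f t) \<le> B"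
    using pcE[OF assms(1)] by metis
  have "compact (g ` cball 0 B)"
    by (intro compact_continuous_image continuous_on_subset[OF assms(2)]) auto
  then obtain C where C: "\<forall>x\<in>g ` cball 0 B. norm x \<le> C"
    using compact_imp_bounded bounded_iff by metis
  show ?thesis
  proof (rule pcI[OF F(1)])
    show "continuous_on ({0..1} - F) (\<lambda>t. g (f t))"
      using continuous_on_compose2[OF assms(2) F(2)] by simp
    show "norm (g (f t)) \<le> C" if "0 \<le> t" "t \<le> 1" for t
      using C F(4)[OF that] by auto
  qed
qed

lemma pc_minus: "pc f \<Longrightarrow> pc (\<lambda>t. - f t)"
  by (rule pc_compose[where g = uminus]) (auto intro!: continuous_intros)

lemma pc_diff: "pc f \<Longrightarrow> pc g \<Longrightarrow> pc (\<lambda>t. f t - g t)"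
  using pc_add[of f "\<lambda>t. - g t"] pc_minus[of g] by simp

lemma pc_power:
  fixes f :: "real \<Rightarrow> 'a::{euclidean_space,real_normed_algebra_1}"
  shows "pc f \<Longrightarrow> pc (\<lambda>t. f t ^ n)"
  by (rule pc_compose[where g = "\<lambda>x. x ^ n"]) (auto intro!: continuous_intros)

lemma pc_sin: "pc f \<Longrightarrow> pc (\<lambda>t. sin (f t :: real))"
  by (rule pc_compose[where g = sin]) (auto intro!: continuous_intros)

lemma pc_cos: "pc f \<Longrightarrow> pc (\<lambda>t. cos (f t :: real))"
  by (rule pc_compose[where g = cos]) (auto intro!: continuous_intros)

lemma pc_cis: "pc f \<Longrightarrow> pc (\<lambda>t. cis (f t))"
  by (rule pc_compose[where g = cis]) (auto intro!: continuous_intros)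

lemma pc_of_real: "pc f \<Longrightarrow> pc (\<lambda>t. complex_of_real (f t))"
  by (rule pc_compose[where g = complex_of_real]) (auto intro!: continuous_intros)

lemma pc_abs: "pc f \<Longrightarrow> pc (\<lambda>t. \<bar>f t :: real\<bar>)"
  by (rule pc_compose[where g = abs]) (auto intro!: continuous_intros)

lemma pc_ident: "pc (\<lambda>t::real. t)"
  by (rule pc_continuous) (auto intro!: continuous_intros)

text \<open>Once \<open>c\<close> itself is removed, both sides of the cut are relatively open, so
  continuity may be checked on each separately. This is what appends a further arc to a
  control.\<close>

lemma pc_if:
  assumes "pc f" "pc g"
  shows "pc (\<lambda>t. if t < c then f t else g t)"
proof -
  obtain F B where F: "finite F" "continuous_on ({0..1} - F) f" "B > 0" "\<And>t. 0 \<le> t \<Longrightarrow> t \<le> 1 \<Longrightarrow> norm (f t) \<le> B"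
    using pcE[OF assms(1)] by metis
  obtain G C where G: "finite G" "continuous_on ({0..1} - G) g" "C > 0" "\<And>t. 0 \<le> t \<Longrightarrow> t \<le> 1 \<Longrightarrow> norm (g t) \<le> C"
    using pcE[OF assms(2)] by metis
  show ?thesis
  proof (rule pcI)
    let ?H = "insert c (F \<union> G)"
    show "finite ?H" using F G by simp
    have op1: "openin (top_of_set ({0..1} - ?H)) (({0..1} - ?H) \<inter> {..<c})"
      by (intro openin_open_Int) auto
    have op2: "openin (top_of_set ({0..1} - ?H)) (({0..1} - ?H) \<inter> {c<..})"
      by (intro openin_open_Int) auto
    have "continuous_on ((({0..1} - ?H) \<inter> {..<c}) \<union> (({0..1} - ?H) \<inter> {c<..})) (\<lambda>t. if t < c then f t else g t)"
    proof (rule continuous_on_cases_local_open)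
      show "continuous_on (({0..1} - ?H) \<inter> {..<c}) f" by (rule continuous_on_subset[OF F(2)]) auto
      show "continuous_on (({0..1} - ?H) \<inter> {c<..}) g" by (rule continuous_on_subset[OF G(2)]) auto
      have eq: "(({0..1} - ?H) \<inter> {..<c}) \<union> (({0..1} - ?H) \<inter> {c<..}) = {0..1} - ?H" by auto
      show "openin (top_of_set ((({0..1} - ?H) \<inter> {..<c}) \<union> (({0..1} - ?H) \<inter> {c<..}))) (({0..1} - ?H) \<inter> {..<c})"
        unfolding eq by (rule op1)
      show "openin (top_of_set ((({0..1} - ?H) \<inter> {..<c}) \<union> (({0..1} - ?H) \<inter> {c<..}))) (({0..1} - ?H) \<inter> {c<..})"
        unfolding eq by (rule op2)
    qed auto
    then show "continuous_on ({0..1} - ?H) (\<lambda>t. if t < c then f t else g t)"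
      by (rule continuous_on_subset) auto
    show "norm (if t < c then f t else g t) \<le> B + C" if "0 \<le> t" "t \<le> 1" for t
      using F(3,4) G(3,4) that by (smt (verit))
  qed
qed

lemma pc_absolutely_integrable:
  assumes "pc f"
  shows "f absolutely_integrable_on {0..1}"
proof -
  obtain F B where F: "finite F" "continuous_on ({0..1} - F) f" "B > 0" "\<And>t. 0 \<le> t \<Longrightarrow> t \<le> 1 \<Longrightarrow> norm (f t) \<le> B"
    using pcE[OF assms] by metis
  have sets: "{0..1} - F \<in> sets lebesgue" using F(1) by (intro sets.Diff) (auto intro!: negligible_imp_sets)
  have "f \<in> borel_measurable (lebesgue_on ({0..1} - F))"
    by (rule continuous_imp_measurable_on_sets_lebesgue[OF F(2) sets])
  moreover have "(\<lambda>t. B) integrable_on ({0..1} - F)"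
  proof (rule integrable_spike_set)
    show "(\<lambda>t. B) integrable_on {0..1::real}" by (rule integrable_const_ivl)
    show "negligible {x \<in> {0..1} - ({0..1} - F). B \<noteq> 0}"
      by (rule negligible_subset[OF negligible_finite[OF F(1)]]) auto
    show "negligible {x \<in> {0..1} - F - {0..1}. B \<noteq> 0}"
      by (rule negligible_subset[OF negligible_empty]) auto
  qed
  ultimately have *: "f absolutely_integrable_on ({0..1} - F)"
    using F(4) sets by (intro measurable_bounded_by_integrable_imp_absolutely_integrable) auto
  show ?thesis
  proof (rule absolutely_integrable_spike_set_eq[THEN iffD1, OF _ _ *])
    show "negligible {x \<in> {0..1} - F - {0..1}. f x \<noteq> 0}"
      by (rule negligible_subset[OF negligible_empty]) auto
    show "negligible {x \<in> {0..1} - ({0..1} - F). f x \<noteq> 0}"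
      by (rule negligible_subset[OF negligible_finite[OF F(1)]]) auto
  qed
qed

lemma pc_integrable:
  assumes "pc f" "0 \<le> a" "b \<le> 1"
  shows "f integrable_on {a..b}"
proof -
  have "f integrable_on {0..1}"
    using pc_absolutely_integrable[OF assms(1)] set_lebesgue_integral_eq_integral(1) by blast
  then show ?thesis by (rule integrable_on_subinterval) (use assms in auto)
qed

definition prim :: "(real \<Rightarrow> 'a::euclidean_space) \<Rightarrow> real \<Rightarrow> 'a" where
  "prim f t = integral {0..t} f"

lemma prim_0 [simp]: "prim f 0 = 0"
  by (simp add: prim_def)

lemma continuous_on_prim: "pc f \<Longrightarrow> continuous_on {0..1} (prim f)"
  unfolding prim_def [abs_def]
  by (rule indefinite_integral_continuous_1[OF pc_integrable]) auto

lemma pc_prim: "pc f \<Longrightarrow> pc (prim f)"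
  by (rule pc_continuous) (rule continuous_on_prim)

text \<open>The fundamental theorem applies at every point of continuity; the finitely many other
  points are harmless in \<open>pc_ftc\<close>.\<close>

lemma prim_has_vector_derivative:
  assumes "pc f"
  obtains F where "finite F" "\<And>t. t \<in> {0<..<1} - F \<Longrightarrow> (prim f has_vector_derivative f t) (at t)"
    "\<And>t. t \<in> {0<..<1} - F \<Longrightarrow> isCont f t"
proof -
  obtain F where F: "finite F" "continuous_on ({0..1} - F) f"
    using pcE[OF assms] by metis
  have op: "open ({0<..<1} - F)" using F(1) by (simp add: finite_imp_closed open_Diff)
  have c: "continuous_on ({0<..<1} - F) f" by (rule continuous_on_subset[OF F(2)]) auto
  have "(prim f has_vector_derivative f t) (at t) \<and> isCont f t" if t: "t \<in> {0<..<1} - F" for t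
  proof -
    have cf: "isCont f t" using c op t continuous_on_eq_continuous_at by blast
    have "((\<lambda>u. integral {0..u} f) has_vector_derivative f t) (at t within ({0..1} - F))"
    proof (rule integral_has_vector_derivative_continuous_at)
      show "f integrable_on {0..1}" using pc_integrable[OF assms, of 0 1] by simp
      show "t \<in> {0..1} - F" using t by auto
      show "continuous (at t within {0..1} - F) f"
        using cf continuous_at_imp_continuous_at_within by blast
    qed (rule F(1))
    then have "((\<lambda>u. integral {0..u} f) has_vector_derivative f t) (at t within ({0<..<1} - F))"
      by (rule has_vector_derivative_within_subset) auto
    then have "((\<lambda>u. integral {0..u} f) has_vector_derivative f t) (at t)"
      unfolding at_within_open[OF t op] .
    with cf show ?thesis by (simp add: prim_def [abs_def])
  qed
  then show ?thesis using that F(1) by blast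
qed

lemma pc_ftc:
  fixes f :: "real \<Rightarrow> 'a::euclidean_space"
  assumes "finite F" "0 \<le> a" "a \<le> b" "b \<le> 1" "continuous_on {0..1} f"
    "\<And>t. t \<in> {0<..<1} - F \<Longrightarrow> (f has_vector_derivative f' t) (at t)"
  shows "(f' has_integral f b - f a) {a..b}"
  using assms
  by (intro fundamental_theorem_of_calculus_interior_strong[of F]) (auto intro: continuous_on_subset)

lemmas pc_intros = pc_add pc_diff pc_minus pc_mult pc_power pc_const pc_ident pc_prim pc_sin pc_cos pc_cis
  pc_of_real pc_if pc_abs

abbreviation J :: "(real \<Rightarrow> 'a::euclidean_space) \<Rightarrow> 'a" where
  "J f \<equiv> integral {0..1} f"

lemma prim_1: "prim f 1 = J f"
  by (simp add: prim_def)

lemma J_add: "pc f \<Longrightarrow> pc g \<Longrightarrow> J (\<lambda>t. f t + g t) = J f + J g"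
  by (intro integral_add pc_integrable) auto

lemma J_diff: "pc f \<Longrightarrow> pc g \<Longrightarrow> J (\<lambda>t. f t - g t) = J f - J g"
  by (intro integral_diff pc_integrable) auto

lemma prim_add: "pc f \<Longrightarrow> pc g \<Longrightarrow> t \<le> 1 \<Longrightarrow> prim (\<lambda>t. f t + g t) t = prim f t + prim g t"
  unfolding prim_def by (intro integral_add pc_integrable) auto

lemma prim_diff: "pc f \<Longrightarrow> pc g \<Longrightarrow> t \<le> 1 \<Longrightarrow> prim (\<lambda>t. f t - g t) t = prim f t - prim g t"
  unfolding prim_def by (intro integral_diff pc_integrable) auto

lemma prim_cmult: "prim (\<lambda>t. c * f t) t = c * prim f t" for c :: real
  unfolding prim_def by simp

lemma J_mono: "pc f \<Longrightarrow> pc g \<Longrightarrow> (\<And>t. 0 \<le> t \<Longrightarrow> t \<le> 1 \<Longrightarrow> f t \<le> g t) \<Longrightarrow> J f \<le> J g" for f :: "real \<Rightarrow> real"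
  by (intro integral_le pc_integrable) auto

lemma J_cong: "(\<And>t. 0 \<le> t \<Longrightarrow> t \<le> 1 \<Longrightarrow> f t = g t) \<Longrightarrow> J f = J g"
  by (intro integral_cong) auto

lemma J_nonneg: "pc f \<Longrightarrow> (\<And>t. 0 \<le> t \<Longrightarrow> t \<le> 1 \<Longrightarrow> 0 \<le> f t) \<Longrightarrow> 0 \<le> J f" for f :: "real \<Rightarrow> real"
  by (intro integral_nonneg pc_integrable) auto

lemma J_norm_bound:
  "pc f \<Longrightarrow> pc g \<Longrightarrow> (\<And>t. 0 \<le> t \<Longrightarrow> t \<le> 1 \<Longrightarrow> norm (f t) \<le> g t) \<Longrightarrow> norm (J f) \<le> J g"
  by (intro integral_norm_bound_integral pc_integrable) auto

lemma prim_norm_bound: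
  assumes "pc f" "pc g" "\<And>t. 0 \<le> t \<Longrightarrow> t \<le> 1 \<Longrightarrow> norm (f t) \<le> g t" "0 \<le> t" "t \<le> 1"
  shows "norm (prim f t) \<le> J g"
proof -
  have "norm (prim f t) \<le> integral {0..t} g"
    unfolding prim_def using assms by (intro integral_norm_bound_integral pc_integrable) auto
  also have "\<dots> \<le> J g"
  proof (rule integral_subset_le)
    show "\<forall>x\<in>{0..1}. 0 \<le> g x"
      using order_trans[OF norm_ge_zero assms(3)] by auto
  qed (use assms in \<open>auto intro: pc_integrable\<close>)
  finally show ?thesis .
qed

lemma prim_increment:
  assumes "pc f" "0 \<le> a" "a \<le> b" "b \<le> 1"
  shows "prim f b - prim f a = integral {a..b} f"
proof -
  have "integral {0..a} f + integral {a..b} f = integral {0..b} f"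
    by (rule Henstock_Kurzweil_Integration.integral_combine) (use assms in \<open>auto intro: pc_integrable\<close>)
  then show ?thesis by (simp add: prim_def algebra_simps)
qed

lemma J_by_parts:
  fixes f g :: "real \<Rightarrow> 'a::{euclidean_space,real_normed_algebra}"
  assumes "pc f" "pc g"
  shows "J (\<lambda>t. f t * prim g t) + J (\<lambda>t. prim f t * g t) = J f * J g"
proof -
  obtain F where F: "finite F" "\<And>t. t \<in> {0<..<1} - F \<Longrightarrow> (prim f has_vector_derivative f t) (at t)"
    using prim_has_vector_derivative[OF assms(1)] by metis
  obtain G where G: "finite G" "\<And>t. t \<in> {0<..<1} - G \<Longrightarrow> (prim g has_vector_derivative g t) (at t)"
    using prim_has_vector_derivative[OF assms(2)] by metis
  have "((\<lambda>t. f t * prim g t + prim f t * g t) has_integral prim f 1 * prim g 1 - prim f 0 * prim g 0) {0..1}"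
  proof (rule pc_ftc[of "F \<union> G"])
    show "continuous_on {0..1} (\<lambda>t. prim f t * prim g t)"
      by (intro continuous_intros continuous_on_prim assms)
    show "((\<lambda>t. prim f t * prim g t) has_vector_derivative f t * prim g t + prim f t * g t) (at t)"
      if "t \<in> {0<..<1} - (F \<union> G)" for t
      using has_vector_derivative_mult[OF F(2) G(2), of t] that by (simp add: add.commute)
  qed (use F G in auto)
  then have "J (\<lambda>t. f t * prim g t + prim f t * g t) = J f * J g"
    by (simp add: integral_unique prim_1)
  then show ?thesis
    by (subst (asm) J_add) (intro pc_mult pc_prim assms)+
qed

section \<open>Discriminants and Cauchy-Schwarz inequalities\<close>

lemma quadratic_nonneg_discriminant:
  fixes a b c :: real
  assumes "\<And>x. 0 \<le> a + 2 * x * b + x\<^sup>2 * c"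
  shows "b\<^sup>2 \<le> a * c"
proof (cases "c = 0")
  case True
  have "b = 0"
  proof (rule ccontr)
    assume "b \<noteq> 0"
    \<comment> \<open>If \<open>c = 0\<close> and \<open>b \<noteq> 0\<close>, this point gives the
      affine expression the value -1.\<close>
    then have "2 * (- (a + 1) / (2 * b)) * b = - (a + 1)" by (simp add: field_simps)
    with assms[of "- (a + 1) / (2 * b)"] True show False by simp
  qed
  then show ?thesis using True by simp
next
  case False
  have "0 \<le> c"
  proof (rule ccontr)
    assume "\<not> 0 \<le> c"
    then have c: "c < 0" by simp
    \<comment> \<open>A point beyond 1 where \<open>x * c\<close> alone outweighs
      \<open>\<bar>a\<bar> + 2 * \<bar>b\<bar> + 1\<close>, so that the quadratic is negative
      there.\<close>
    define x where "x = (\<bar>a\<bar> + 2 * \<bar>b\<bar> + 1) / (- c) + 1"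
    have x1: "x \<ge> 1" using c by (simp add: x_def divide_nonneg_neg field_simps)
    have "x * c = - (\<bar>a\<bar> + 2 * \<bar>b\<bar> + 1) + c" using c by (simp add: x_def field_simps)
    then have "x\<^sup>2 * c = x * (- (\<bar>a\<bar> + 2 * \<bar>b\<bar> + 1) + c)" by (simp add: power2_eq_square mult.assoc)
    then have "a + 2 * x * b + x\<^sup>2 * c = a + x * (2 * b - \<bar>a\<bar> - 2 * \<bar>b\<bar> - 1 + c)"
      by (simp add: algebra_simps)
    also have "\<dots> \<le> a + 1 * (2 * b - \<bar>a\<bar> - 2 * \<bar>b\<bar> - 1 + c)"
      using c x1 by (intro add_left_mono mult_right_mono_neg) auto
    also have "\<dots> < 0" using c by auto
    finally show False using assms[of x] by simp
  qed
  with False have c: "c > 0" by simp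
  have "0 \<le> a + 2 * (- b / c) * b + (- b / c)\<^sup>2 * c" by (rule assms)
  also have "\<dots> = a - b\<^sup>2 / c" using c by (simp add: field_simps power2_eq_square)
  finally show ?thesis using c by (simp add: field_simps)
qed

lemma J_Cauchy_Schwarz:
  fixes f g :: "real \<Rightarrow> real"
  assumes "pc f" "pc g"
  shows "(J (\<lambda>t. f t * g t))\<^sup>2 \<le> J (\<lambda>t. (f t)\<^sup>2) * J (\<lambda>t. (g t)\<^sup>2)"
proof (rule quadratic_nonneg_discriminant)
  fix x :: real
  have "0 \<le> J (\<lambda>t. (f t + x * g t)\<^sup>2)"
    by (intro J_nonneg pc_intros assms) simp
  also have "\<dots> = J (\<lambda>t. (f t)\<^sup>2 + (2 * x * (f t * g t) + x\<^sup>2 * (g t)\<^sup>2))"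
    by (rule J_cong) (simp add: power2_eq_square algebra_simps)
  also have "\<dots> = J (\<lambda>t. (f t)\<^sup>2) + (J (\<lambda>t. 2 * x * (f t * g t)) + J (\<lambda>t. x\<^sup>2 * (g t)\<^sup>2))"
    by (simp only: J_add pc_intros assms)
  finally show "0 \<le> J (\<lambda>t. (f t)\<^sup>2) + 2 * x * J (\<lambda>t. f t * g t) + x\<^sup>2 * J (\<lambda>t. (g t)\<^sup>2)"
    by simp
qed

text \<open>Cauchy-Schwarz against the constant 1 on a subinterval. It makes primitives Hoelder
  continuous with exponent 1/2, which is the later source of equicontinuity.\<close>

lemma integral_square_le:
  fixes f :: "real \<Rightarrow> real"
  assumes "pc f" "0 \<le> a" "a \<le> b" "b \<le> 1"
  shows "(integral {a..b} f)\<^sup>2 \<le> (b - a) * J (\<lambda>t. (f t)\<^sup>2)"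
proof -
  have int: "f integrable_on {a..b}" "(\<lambda>t. (f t)\<^sup>2) integrable_on {a..b}"
    by (intro pc_integrable pc_intros assms)+
  have "(integral {a..b} f)\<^sup>2 \<le> (b - a) * integral {a..b} (\<lambda>t. (f t)\<^sup>2)"
  proof (rule quadratic_nonneg_discriminant)
    fix x :: real
    have "((\<lambda>t. 1 + (2 * x * f t + x\<^sup>2 * (f t)\<^sup>2)) has_integral (b - a) + (2 * x * integral {a..b} f + x\<^sup>2 * integral {a..b} (\<lambda>t. (f t)\<^sup>2))) {a..b}"
    proof (intro has_integral_add has_integral_mult_right integrable_integral int)
      show "((\<lambda>t. 1) has_integral b - a) {a..b}"
        using has_integral_const_real[of "1::real" a b] assms(3) by simp
    qed
    moreover have "0 \<le> 1 + (2 * x * f t + x\<^sup>2 * (f t)\<^sup>2)" for t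
    proof -
      have "1 + (2 * x * f t + x\<^sup>2 * (f t)\<^sup>2) = (1 + x * f t)\<^sup>2"
        by (simp add: power2_eq_square algebra_simps)
      then show ?thesis by simp
    qed
    ultimately have "0 \<le> (b - a) + (2 * x * integral {a..b} f + x\<^sup>2 * integral {a..b} (\<lambda>t. (f t)\<^sup>2))"
      by (rule has_integral_nonneg)
    then show "0 \<le> b - a + 2 * x * integral {a..b} f + x\<^sup>2 * integral {a..b} (\<lambda>t. (f t)\<^sup>2)"
      by simp
  qed
  also have "\<dots> \<le> (b - a) * J (\<lambda>t. (f t)\<^sup>2)"
    using assms by (intro mult_left_mono integral_subset_le pc_integrable pc_intros) auto
  finally show ?thesis .
qed

lemma J_zero_imp_zero:
  fixes f :: "real \<Rightarrow> real"
  assumes "continuous_on {0..1} f" "J (\<lambda>t. (f t)\<^sup>2) = 0" "t \<in> {0..1}"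
  shows "f t = 0"
proof -
  have "continuous_on {0..1} (\<lambda>t. (f t)\<^sup>2)" by (intro continuous_intros assms)
  then have "\<And>t. t \<in> {0..1} \<Longrightarrow> (f t)\<^sup>2 = 0"
    using integral_eq_0_iff[of 0 1 "\<lambda>t. (f t)\<^sup>2"] assms(2) by simp
  then show ?thesis using assms(3) by simp
qed

section \<open>The second variation at the Koebe function\<close>

text \<open>\<open>qform2\<close> and \<open>qform4\<close> are the forms \<open>Q\<^sub>2\<close> and \<open>Q\<^sub>4\<close>, and \<open>bform \<nu>\<close> polarizes \<open>Q\<^sub>2 + \<nu> Q\<^sub>4\<close>; its
  weight \<open>1 + \<nu> wt t\<close> is the common denominator of \<open>u\<^sub>p\<close> and \<open>u\<^sub>q\<close>.\<close>

definition wt :: "real \<Rightarrow> real" where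
  "wt t = 16 * t\<^sup>2 - 8 * t + 2"

definition qcross :: "(real \<Rightarrow> real) \<Rightarrow> (real \<Rightarrow> real) \<Rightarrow> real" where
  "qcross s h = 24 * J s * J h - 8 * (J s * J (prim h) + J h * J (prim s)) - 4 * J (\<lambda>t. prim s t * prim h t)"

definition qform2 :: "(real \<Rightarrow> real) \<Rightarrow> real" where
  "qform2 s = J (\<lambda>t. (s t)\<^sup>2)"

definition qform4 :: "(real \<Rightarrow> real) \<Rightarrow> real" where
  "qform4 s = J (\<lambda>t. wt t * (s t)\<^sup>2) + qcross s s"

definition bform :: "real \<Rightarrow> (real \<Rightarrow> real) \<Rightarrow> (real \<Rightarrow> real) \<Rightarrow> real" where
  "bform \<nu> s h = J (\<lambda>t. (1 + \<nu> * wt t) * s t * h t) + \<nu> * qcross s h"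

lemma continuous_wt: "continuous_on A wt"
  unfolding wt_def by (intro continuous_intros)

lemma pc_wt: "pc wt"
  by (rule pc_continuous) (rule continuous_wt)

lemma wt_eq: "wt t = (4 * t - 1)\<^sup>2 + 1"
  by (simp add: wt_def power2_eq_square algebra_simps)

lemma wt_ge_1: "1 \<le> wt t"
  by (simp add: wt_eq)

text \<open>The value 10 is attained at \<open>t = 1\<close>. For negative \<open>\<nu>\<close> the
  weight \<open>1 + \<nu> * wt t\<close> is thus at least \<open>1 + 10 * \<nu>\<close>, which is
  the origin of the bound -1/10.\<close>

lemma wt_le_10:
  assumes "0 \<le> t" "t \<le> 1"
  shows "wt t \<le> 10"
proof -
  have "(4 * t - 1)\<^sup>2 \<le> 3\<^sup>2" by (rule abs_le_square_iff[THEN iffD1]) (use assms in auto)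
  then show ?thesis by (simp add: wt_eq)
qed

lemma bform_eq_qform:
  assumes "pc s"
  shows "bform \<nu> s s = qform2 s + \<nu> * qform4 s"
proof -
  have "J (\<lambda>t. (1 + \<nu> * wt t) * s t * s t) = J (\<lambda>t. (s t)\<^sup>2 + \<nu> * (wt t * (s t)\<^sup>2))"
    by (rule J_cong) (simp add: power2_eq_square algebra_simps)
  also have "\<dots> = J (\<lambda>t. (s t)\<^sup>2) + J (\<lambda>t. \<nu> * (wt t * (s t)\<^sup>2))"
    by (intro J_add pc_intros pc_wt assms)
  finally show ?thesis by (simp add: bform_def qform2_def qform4_def algebra_simps)
qed

lemma qcross_sym: "qcross s h = qcross h s"
  by (simp add: qcross_def mult.commute add.commute mult.left_commute)

lemma bform_sym: "bform \<nu> s h = bform \<nu> h s"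
  by (simp add: bform_def qcross_sym[of s h] mult.commute mult.left_commute)

lemma prim_linear:
  fixes s h :: "real \<Rightarrow> real"
  assumes "pc s" "pc h" "t \<le> 1"
  shows "prim (\<lambda>t. s t + c * h t) t = prim s t + c * prim h t"
proof -
  have "pc (\<lambda>t. c * h t)" by (intro pc_intros assms)
  from prim_add[OF assms(1) this assms(3)] show ?thesis by (simp add: prim_cmult)
qed

lemma J_prim_linear:
  fixes s h :: "real \<Rightarrow> real"
  assumes "pc s" "pc h"
  shows "J (prim (\<lambda>t. s t + c * h t)) = J (prim s) + c * J (prim h)"
proof -
  have "J (prim (\<lambda>t. s t + c * h t)) = J (\<lambda>t. prim s t + c * prim h t)"
    by (rule J_cong) (simp add: prim_linear assms)
  also have "\<dots> = J (prim s) + J (\<lambda>t. c * prim h t)"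
    by (intro J_add pc_intros assms)
  finally show ?thesis by simp
qed

lemma qcross_linear:
  assumes "pc s" "pc h" "pc k"
  shows "qcross (\<lambda>t. s t + c * h t) k = qcross s k + c * qcross h k"
proof -
  have 1: "J (\<lambda>t. s t + c * h t) = J s + c * J h"
    using J_add[of s "\<lambda>t. c * h t"] by (simp add: pc_intros assms)
  have "J (\<lambda>t. prim (\<lambda>t. s t + c * h t) t * prim k t) = J (\<lambda>t. prim s t * prim k t + c * (prim h t * prim k t))"
    by (rule J_cong) (simp add: prim_linear assms algebra_simps)
  also have "\<dots> = J (\<lambda>t. prim s t * prim k t) + J (\<lambda>t. c * (prim h t * prim k t))"
    by (intro J_add pc_intros assms)
  finally show ?thesis
    by (simp add: qcross_def 1 J_prim_linear assms algebra_simps)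
qed

lemma bform_linear:
  assumes "pc s" "pc h" "pc k"
  shows "bform \<nu> (\<lambda>t. s t + c * h t) k = bform \<nu> s k + c * bform \<nu> h k"
proof -
  have "J (\<lambda>t. (1 + \<nu> * wt t) * (s t + c * h t) * k t) =
        J (\<lambda>t. (1 + \<nu> * wt t) * s t * k t + c * ((1 + \<nu> * wt t) * h t * k t))"
    by (rule J_cong) (simp add: algebra_simps)
  also have "\<dots> = J (\<lambda>t. (1 + \<nu> * wt t) * s t * k t) + J (\<lambda>t. c * ((1 + \<nu> * wt t) * h t * k t))"
    by (intro J_add pc_intros pc_wt assms)
  also have "J (\<lambda>t. c * ((1 + \<nu> * wt t) * h t * k t)) = c * J (\<lambda>t. (1 + \<nu> * wt t) * h t * k t)"
    by simp
  finally show ?thesis unfolding bform_def qcross_linear[OF assms] by (simp only: algebra_simps)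
qed

lemma bform_expand:
  assumes "pc s" "pc h"
  shows "bform \<nu> (\<lambda>t. s t + c * h t) (\<lambda>t. s t + c * h t) = bform \<nu> s s + 2 * c * bform \<nu> s h + c\<^sup>2 * bform \<nu> h h"
proof -
  have p: "pc (\<lambda>t. s t + c * h t)" by (intro pc_intros assms)
  have "bform \<nu> (\<lambda>t. s t + c * h t) (\<lambda>t. s t + c * h t) = bform \<nu> s (\<lambda>t. s t + c * h t) + c * bform \<nu> h (\<lambda>t. s t + c * h t)"
    by (rule bform_linear) (use assms p in auto)
  also have "bform \<nu> s (\<lambda>t. s t + c * h t) = bform \<nu> s s + c * bform \<nu> h s"
    by (subst bform_sym) (rule bform_linear; use assms in auto)
  also have "bform \<nu> h (\<lambda>t. s t + c * h t) = bform \<nu> s h + c * bform \<nu> h h"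
    by (subst bform_sym) (rule bform_linear; use assms in auto)
  finally show ?thesis by (simp add: bform_sym[of \<nu> h s] power2_eq_square algebra_simps)
qed

lemma bform_Cauchy_Schwarz:
  assumes "\<And>s. pc s \<Longrightarrow> 0 \<le> bform \<nu> s s" "pc s" "pc h"
  shows "(bform \<nu> s h)\<^sup>2 \<le> bform \<nu> s s * bform \<nu> h h"
proof (rule quadratic_nonneg_discriminant)
  fix x
  show "0 \<le> bform \<nu> s s + 2 * x * bform \<nu> s h + x\<^sup>2 * bform \<nu> h h"
    using assms(1)[of "\<lambda>t. s t + x * h t"] bform_expand[OF assms(2,3)] by (simp add: pc_intros assms)
qed

lemma qform2_nonneg: "pc s \<Longrightarrow> 0 \<le> qform2 s"
  unfolding qform2_def by (intro J_nonneg pc_intros) auto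

lemma prim_square_le:
  assumes "pc s" "0 \<le> t" "t \<le> 1"
  shows "(prim s t)\<^sup>2 \<le> qform2 s"
proof -
  have "(prim s t)\<^sup>2 \<le> (t - 0) * qform2 s"
    unfolding prim_def qform2_def by (rule integral_square_le) (use assms in auto)
  also have "\<dots> \<le> 1 * qform2 s"
    using assms by (intro mult_right_mono qform2_nonneg) auto
  finally show ?thesis by simp
qed

lemma J_le_const: "pc f \<Longrightarrow> (\<And>t. 0 \<le> t \<Longrightarrow> t \<le> 1 \<Longrightarrow> f t \<le> c) \<Longrightarrow> J f \<le> (c::real)"
  using J_mono[of f "\<lambda>t. c"] by (simp add: pc_intros)

text \<open>Each of \<open>J s\<close>, \<open>J (prim s)\<close> and \<open>prim s t\<close> is at
  most the mean square norm of \<open>s\<close>, and 24 + 8 + 8 + 4 = 44.\<close>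

lemma qcross_bound:
  assumes "pc s" "pc h"
  shows "\<bar>qcross s h\<bar> \<le> 44 * sqrt (qform2 s) * sqrt (qform2 h)"
proof -
  have *: "\<bar>prim s t\<bar> \<le> sqrt (qform2 s)" if "pc s" "0 \<le> t" "t \<le> 1" for s t
    using prim_square_le[OF that] by (simp add: real_le_rsqrt)
  have J1: "\<bar>J s\<bar> \<le> sqrt (qform2 s)" if "pc s" for s
    using *[OF that, of 1] by (simp add: prim_1)
  have Jc: "\<bar>J f\<bar> \<le> c" if "pc f" "\<And>t. 0 \<le> t \<Longrightarrow> t \<le> 1 \<Longrightarrow> \<bar>f t\<bar> \<le> c" for f and c :: real
    using J_norm_bound[of f "\<lambda>t. c"] that by (simp add: pc_intros)
  have J2: "\<bar>J (prim s)\<bar> \<le> sqrt (qform2 s)" if "pc s" for s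
    by (rule Jc) (use that * in \<open>auto intro: pc_prim\<close>)
  define a b where "a = sqrt (qform2 s)" and "b = sqrt (qform2 h)"
  have ab: "0 \<le> a" "0 \<le> b" using assms by (auto simp: a_def b_def qform2_nonneg)
  have 1: "\<bar>J s * J h\<bar> \<le> a * b" "\<bar>J s * J (prim h)\<bar> \<le> a * b" "\<bar>J h * J (prim s)\<bar> \<le> a * b"
    using J1[OF assms(1)] J1[OF assms(2)] J2[OF assms(1)] J2[OF assms(2)] ab
    unfolding abs_mult a_def[symmetric] b_def[symmetric]
    by (auto intro!: mult_mono simp: mult.commute[of "\<bar>J h\<bar>"])
  have 2: "\<bar>J (\<lambda>t. prim s t * prim h t)\<bar> \<le> a * b"
  proof (rule Jc)
    show "\<bar>prim s t * prim h t\<bar> \<le> a * b" if "0 \<le> t" "t \<le> 1" for t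
      using *[OF assms(1) that] *[OF assms(2) that] ab
      unfolding abs_mult a_def[symmetric] b_def[symmetric] by (intro mult_mono) auto
  qed (intro pc_intros assms)
  have "\<bar>24 * x - 8 * (y + z) - 4 * u\<bar> \<le> 44 * c"
    if "\<bar>x\<bar> \<le> c" "\<bar>y\<bar> \<le> c" "\<bar>z\<bar> \<le> c" "\<bar>u\<bar> \<le> c" for x y z u c :: real
    using that by (smt (verit))
  from this[OF 1 2] show ?thesis unfolding qcross_def a_def[symmetric] b_def[symmetric] mult.assoc .
qed

text \<open>The constant is 10 from the weight plus 44 from \<open>qcross\<close>.\<close>

lemma qform4_bound:
  assumes "pc s"
  shows "\<bar>qform4 s\<bar> \<le> 54 * qform2 s"
proof -
  have "J (\<lambda>t. wt t * (s t)\<^sup>2) \<le> J (\<lambda>t. 10 * (s t)\<^sup>2)"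
    by (intro J_mono pc_intros pc_wt assms mult_right_mono wt_le_10) auto
  moreover have "0 \<le> J (\<lambda>t. wt t * (s t)\<^sup>2)"
    by (intro J_nonneg pc_intros pc_wt assms mult_nonneg_nonneg) (auto intro: order_trans[OF _ wt_ge_1])
  moreover have "\<bar>qcross s s\<bar> \<le> 44 * qform2 s"
    using qcross_bound[OF assms assms] qform2_nonneg[OF assms] by (simp add: mult.assoc)
  ultimately show ?thesis unfolding qform4_def qform2_def by simp
qed

text \<open>At \<open>S = prim s\<close> this function represents the functional
  \<open>qcross s\<close>: integrating it against \<open>h\<close> gives \<open>qcross s h\<close>.
  Taking the primitive as argument makes the operator Lipschitz in the supremum norm, and uniform
  convergence of primitives is what compactness provides.\<close>

definition elop :: "(real \<Rightarrow> real) \<Rightarrow> real \<Rightarrow> real" where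
  "elop S t = 24 * S 1 - 8 * (S 1 * (1 - t) + J S) - 4 * (J S - prim S t)"

lemma J_prim:
  fixes h :: "real \<Rightarrow> real"
  assumes "pc h"
  shows "J (prim h) = J (\<lambda>t. h t * (1 - t))"
proof -
  have "prim (\<lambda>t. 1::real) t = t" if "0 \<le> t" for t using that by (simp add: prim_def)
  then have "J (\<lambda>t. h t * prim (\<lambda>t. 1) t) = J (\<lambda>t. h t * t)" by (intro J_cong) auto
  then have *: "J (\<lambda>t. h t * t) + J (prim h) = J h"
    using J_by_parts[OF assms pc_const, of 1] by simp
  have "J (\<lambda>t. h t * (1 - t)) = J (\<lambda>t. h t - h t * t)" by (rule J_cong) (simp add: algebra_simps)
  also have "\<dots> = J h - J (\<lambda>t. h t * t)" by (intro J_diff pc_intros assms)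
  finally show ?thesis using * by simp
qed

text \<open>Integration by parts removes all primitives of \<open>h\<close>. The bracket is the
  gradient of the form at \<open>s\<close> up to the factor 2, so its vanishing is the kernel
  equation.\<close>

lemma bform_elop:
  assumes "pc s" "pc h"
  shows "bform \<nu> s h = J (\<lambda>t. h t * ((1 + \<nu> * wt t) * s t + \<nu> * elop (prim s) t))"
proof -
  let ?S = "prim s"
  have q: "qcross s h = J (\<lambda>t. h t * elop ?S t)"
  proof -
    have "J (\<lambda>t. h t * elop ?S t) = J (\<lambda>t. (24 * J s - 12 * J ?S) * h t + (- 8 * J s) * (h t * (1 - t)) + 4 * (h t * prim ?S t))"
      by (rule J_cong) (simp add: elop_def prim_1 algebra_simps)
    also have "\<dots> = J (\<lambda>t. (24 * J s - 12 * J ?S) * h t) + J (\<lambda>t. (- 8 * J s) * (h t * (1 - t))) + J (\<lambda>t. 4 * (h t * prim ?S t))"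
      by (simp only: J_add pc_intros assms)
    also have "\<dots> = (24 * J s - 12 * J ?S) * J h - 8 * J s * J (prim h) + 4 * J (\<lambda>t. h t * prim ?S t)"
      by (simp add: J_prim[OF assms(2)])
    also have "J (\<lambda>t. h t * prim ?S t) = J h * J ?S - J (\<lambda>t. ?S t * prim h t)"
      using J_by_parts[OF assms(2) pc_prim[OF assms(1)]] by (simp add: mult.commute)
    finally show ?thesis by (simp add: qcross_def algebra_simps)
  qed
  have pe: "pc (elop ?S)" unfolding elop_def by (intro pc_intros assms)
  have "J (\<lambda>t. h t * ((1 + \<nu> * wt t) * s t + \<nu> * elop ?S t)) = J (\<lambda>t. (1 + \<nu> * wt t) * s t * h t + \<nu> * (h t * elop ?S t))"
    by (rule J_cong) (simp add: algebra_simps)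
  also have "\<dots> = J (\<lambda>t. (1 + \<nu> * wt t) * s t * h t) + J (\<lambda>t. \<nu> * (h t * elop ?S t))"
    by (intro J_add pc_intros pc_wt assms pe)
  finally show ?thesis by (simp add: bform_def q)
qed

section \<open>Coercivity of \<open>qform4\<close>\<close>

text \<open>A cubic chosen numerically such that \<open>r' + 4 + r\<^sup>2 / (wt - 1/20) \<le> 0\<close> and
  \<open>9 r(1) - 4 r(0) + 40 \<ge> 0\<close>. Jacobi's method, i.e. adding \<open>(r \<phi>\<^sup>2)'\<close> and completing the square,
  then bounds \<open>Q\<^sub>4 - Q\<^sub>2/20\<close> from below.\<close>

definition riccati :: "real \<Rightarrow> real" where
  "riccati t = 27/10 - 44/5 * t + 13/2 * t^2 - 7/2 * t^3"

lemma riccati_inequality: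
  assumes "0 \<le> t" "t \<le> 1"
  shows "((- 44/5 + 13 * t - 21/2 * t^2) + 4) * (wt t - 1/20) + (riccati t)\<^sup>2 \<le> 0" (is "?L \<le> 0")
proof (cases "t \<le> 1/2")
  case True
  have "?L = (-207/100) * ((2*t)^0 * (1 - (2*t))^6) + (-861/200) * ((2*t)^1 * (1 - (2*t))^5) + (-10127/800) * ((2*t)^2 * (1 - (2*t))^4) + (-11659/400) * ((2*t)^3 * (1 - (2*t))^3) + (-43999/1600) * ((2*t)^4 * (1 - (2*t))^2) + (-16813/1600) * ((2*t)^5 * (1 - (2*t))^1) + (-9863/6400) * ((2*t)^6 * (1 - (2*t))^0)"
    \<comment> \<open>the Bernstein form on \<open>[0, 1/2]\<close>; below, on \<open>[1/2, 1]\<close>\<close>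
    unfolding wt_def riccati_def by algebra
  also have "\<dots> \<le> 0"
    by (intro add_nonpos_nonpos mult_nonpos_nonneg mult_nonneg_nonneg zero_le_power) (use assms True in auto)
  finally show ?thesis .
next
  case False
  have "?L = (-9863/6400) * ((2*t - 1)^0 * (1 - (2*t - 1))^6) + (-1597/200) * ((2*t - 1)^1 * (1 - (2*t - 1))^5) + (-11907/800) * ((2*t - 1)^2 * (1 - (2*t - 1))^4) + (-6839/400) * ((2*t - 1)^3 * (1 - (2*t - 1))^3) + (-21577/800) * ((2*t - 1)^4 * (1 - (2*t - 1))^2) + (-1589/50) * ((2*t - 1)^5 * (1 - (2*t - 1))^1) + (-531/40) * ((2*t - 1)^6 * (1 - (2*t - 1))^0)"
    unfolding wt_def riccati_def by algebra
  also have "\<dots> \<le> 0"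
    by (intro add_nonpos_nonpos mult_nonpos_nonneg mult_nonneg_nonneg zero_le_power) (use assms False in auto)
  finally show ?thesis .
qed

lemma qform4_coercive:
  assumes "pc s"
  shows "qform2 s \<le> 20 * qform4 s"
proof -
  define m where "m = J s"
  \<comment> \<open>The shift completes the cross terms to a square: \<open>qform4 s\<close> is the
    integral of \<open>wt * s^2 - 4 * \<phi>^2\<close> plus \<open>40 * m^2\<close>. The boundary
    values of \<open>\<phi>\<close> are \<open>2 * m\<close> and \<open>3 * m\<close>, whence the
    factors 4 and 9 below.\<close>
  define \<phi> where "\<phi> t = prim s t + 2 * m" for t
  have pc\<phi>: "pc \<phi>" unfolding \<phi>_def by (intro pc_intros assms)
  have pcr: "pc riccati" unfolding riccati_def by (intro pc_intros)
  define r' where "r' t = - 44/5 + 13 * t - 21/2 * t^2" for t :: real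
  have pcr': "pc r'" unfolding r'_def by (intro pc_intros)
  obtain F where F: "finite F" "\<And>t. t \<in> {0<..<1} - F \<Longrightarrow> (prim s has_vector_derivative s t) (at t)"
    using prim_has_vector_derivative[OF assms] by metis
  have dr: "(riccati has_vector_derivative r' t) (at t)" for t
    unfolding riccati_def r'_def has_real_derivative_iff_has_vector_derivative[symmetric]
    by (auto intro!: derivative_eq_intros simp: power2_eq_square)
  have d\<phi>: "(\<phi> has_vector_derivative s t) (at t)" if "t \<in> {0<..<1} - F" for t
    unfolding \<phi>_def using F(2)[OF that] by (auto intro!: derivative_eq_intros)
  have "((\<lambda>t. riccati t * (2 * \<phi> t * s t) + r' t * (\<phi> t)\<^sup>2) has_integral riccati 1 * (\<phi> 1)\<^sup>2 - riccati 0 * (\<phi> 0)\<^sup>2) {0..1}"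
  proof (rule pc_ftc[OF F(1)])
    show "continuous_on {0..1} (\<lambda>t. riccati t * (\<phi> t)\<^sup>2)"
      unfolding riccati_def \<phi>_def by (intro continuous_intros continuous_on_prim assms)
    show "((\<lambda>t. riccati t * (\<phi> t)\<^sup>2) has_vector_derivative riccati t * (2 * \<phi> t * s t) + r' t * (\<phi> t)\<^sup>2) (at t)"
      if "t \<in> {0<..<1} - F" for t
      using dr d\<phi>[OF that] unfolding has_real_derivative_iff_has_vector_derivative[symmetric]
      by (auto intro!: derivative_eq_intros simp: power2_eq_square)
  qed auto
  then have bd: "J (\<lambda>t. riccati t * (2 * \<phi> t * s t) + r' t * (\<phi> t)\<^sup>2) = riccati 1 * (9 * m\<^sup>2) - riccati 0 * (4 * m\<^sup>2)"
    by (simp add: integral_unique \<phi>_def prim_1 m_def power2_eq_square algebra_simps)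
  have pw: "riccati t * (2 * \<phi> t * s t) + r' t * (\<phi> t)\<^sup>2 \<le> (wt t - 1/20) * (s t)\<^sup>2 - 4 * (\<phi> t)\<^sup>2"
    if "0 \<le> t" "t \<le> 1" for t
  proof -
    define W where "W = wt t - 1/20"
    have W: "W > 0" using wt_ge_1[of t] by (simp add: W_def)
    have "(r' t + 4) * W + (riccati t)\<^sup>2 \<le> 0"
      unfolding W_def r'_def using riccati_inequality[OF that] .
    then have "((r' t + 4) * W + (riccati t)\<^sup>2) * (\<phi> t)\<^sup>2 \<le> 0"
      by (intro mult_nonpos_nonneg) auto
    moreover have "W * (W * (s t)\<^sup>2 - 4 * (\<phi> t)\<^sup>2 - (riccati t * (2 * \<phi> t * s t) + r' t * (\<phi> t)\<^sup>2))
       = (W * s t - riccati t * \<phi> t)\<^sup>2 - ((r' t + 4) * W + (riccati t)\<^sup>2) * (\<phi> t)\<^sup>2"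
      by (simp add: power2_eq_square algebra_simps)
    ultimately have "0 \<le> W * (W * (s t)\<^sup>2 - 4 * (\<phi> t)\<^sup>2 - (riccati t * (2 * \<phi> t * s t) + r' t * (\<phi> t)\<^sup>2))"
      using zero_le_power2[of "W * s t - riccati t * \<phi> t"] by linarith
    then show ?thesis using W by (simp add: zero_le_mult_iff W_def)
  qed
  have "riccati 1 * (9 * m\<^sup>2) - riccati 0 * (4 * m\<^sup>2) \<le> J (\<lambda>t. (wt t - 1/20) * (s t)\<^sup>2 - 4 * (\<phi> t)\<^sup>2)"
    unfolding bd[symmetric]
    by (intro J_mono pw pc_intros pcr pcr' pc\<phi> pc_wt assms)
  also have "\<dots> = J (\<lambda>t. wt t * (s t)\<^sup>2 + (- 1/20) * (s t)\<^sup>2 + ((- 4) * (prim s t * prim s t) + (- 16 * m) * prim s t + (- 16 * m\<^sup>2)))"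
    by (rule J_cong) (simp add: \<phi>_def power2_eq_square algebra_simps)
  also have "\<dots> = J (\<lambda>t. wt t * (s t)\<^sup>2) + J (\<lambda>t. (- 1/20) * (s t)\<^sup>2) + (J (\<lambda>t. (- 4) * (prim s t * prim s t)) + J (\<lambda>t. (- 16 * m) * prim s t) + J (\<lambda>t. - 16 * m\<^sup>2))"
    by (simp only: J_add pc_intros pc_wt assms)
  also have "\<dots> = J (\<lambda>t. wt t * (s t)\<^sup>2) - qform2 s / 20 - 4 * J (\<lambda>t. prim s t * prim s t) - 16 * m * J (prim s) - 16 * m\<^sup>2"
    by (simp add: qform2_def)
  also have "\<dots> = qform4 s - qform2 s / 20 - 40 * m\<^sup>2"
    by (simp add: qform4_def qcross_def m_def power2_eq_square algebra_simps)
  finally have "(9 * riccati 1 - 4 * riccati 0 + 40) * m\<^sup>2 \<le> qform4 s - qform2 s / 20"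
    by (simp add: algebra_simps)
  moreover have "0 \<le> (9 * riccati 1 - 4 * riccati 0 + 40) * m\<^sup>2"
    by (intro mult_nonneg_nonneg) (auto simp: riccati_def)
  ultimately show ?thesis by linarith
qed

text \<open>A trial function: nonnegativity of the form at the constant 1 reads
  \<open>1 + 18 * \<nu> \<ge> 0\<close> and bounds the extremal parameter from below.\<close>

lemma qform_const: "qform2 (\<lambda>t. 1) = 1" "qform4 (\<lambda>t. 1) = 18"
proof -
  have 0: "prim (\<lambda>t. 1::real) t = t" if "0 \<le> t" for t using that by (simp add: prim_def)
  have ftc: "(f' has_integral f 1 - f 0) {0..1}" if "\<And>t. (f has_real_derivative f' t) (at t)" for f f' :: "real \<Rightarrow> real"
    using that by (intro fundamental_theorem_of_calculus)
      (auto simp: has_real_derivative_iff_has_vector_derivative[symmetric] intro: has_field_derivative_at_within)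
  have 1: "(wt has_integral (16/3 - 4 + 2)) {0..1}"
  proof -
    have "((\<lambda>t. 16/3 * t^3 - 4 * t^2 + 2 * t) has_real_derivative wt t) (at t)" for t :: real
      unfolding wt_def by (auto intro!: derivative_eq_intros simp: power2_eq_square)
    from ftc[OF this] show ?thesis by simp
  qed
  have 2: "((\<lambda>t. t) has_integral 1/2) {0..1::real}"
  proof -
    have "((\<lambda>t. t^2/2) has_real_derivative t) (at t)" for t :: real
      by (auto intro!: derivative_eq_intros)
    from ftc[OF this] show ?thesis by simp
  qed
  have 3: "((\<lambda>t. t*t) has_integral 1/3) {0..1::real}"
  proof -
    have "((\<lambda>t. t^3/3) has_real_derivative t * t) (at t)" for t :: real
      by (auto intro!: derivative_eq_intros simp: power2_eq_square)
    from ftc[OF this] show ?thesis by simp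
  qed
  have a: "J (prim (\<lambda>t. 1::real)) = 1/2"
    using integral_unique[OF 2] J_cong[of "prim (\<lambda>t. 1::real)" "\<lambda>t. t"] 0 by simp
  have b: "J (\<lambda>t. prim (\<lambda>t. 1::real) t * prim (\<lambda>t. 1) t) = 1/3"
    using integral_unique[OF 3] J_cong[of "\<lambda>t. prim (\<lambda>t. 1::real) t * prim (\<lambda>t. 1) t" "\<lambda>t. t * t"] 0 by simp
  show "qform2 (\<lambda>t. 1) = 1" by (simp add: qform2_def)
  show "qform4 (\<lambda>t. 1) = 18" using integral_unique[OF 1] by (simp add: qform4_def qcross_def a b)
qed

section \<open>A kernel element at the extremal parameter\<close>

text \<open>Dominated convergence with a constant majorant, after the finite set \<open>F\<close>
  has been discarded as negligible.\<close>

lemma integral_tendsto_pc: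
  fixes f :: "nat \<Rightarrow> real \<Rightarrow> real"
  assumes f: "\<And>n. pc (f n)" and g: "pc g"
    and B: "\<And>n t. 0 \<le> t \<Longrightarrow> t \<le> 1 \<Longrightarrow> \<bar>f n t\<bar> \<le> B"
    and F: "finite F" "\<And>t. t \<in> {0..1} - F \<Longrightarrow> (\<lambda>n. f n t) \<longlonglongrightarrow> g t"
    and ab: "0 \<le> a" "b \<le> 1"
  shows "(\<lambda>n. integral {a..b} (f n)) \<longlonglongrightarrow> integral {a..b} g"
proof -
  have neg: "negligible {x \<in> {a..b} - ({a..b} - F). h x \<noteq> 0}" "negligible {x \<in> {a..b} - F - {a..b}. h x \<noteq> 0}"
    for h :: "real \<Rightarrow> real"
    by (rule negligible_subset[OF negligible_finite[OF F(1)]]; auto)+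
  have eq: "integral ({a..b} - F) h = integral {a..b} h" for h :: "real \<Rightarrow> real"
    by (rule integral_spike_set) (rule neg)+
  have "(\<lambda>n. integral ({a..b} - F) (f n)) \<longlonglongrightarrow> integral ({a..b} - F) g"
  proof (rule dominated_convergence(2))
    show "f n integrable_on ({a..b} - F)" for n
      by (rule integrable_spike_set[OF pc_integrable[OF f ab]]) (rule neg)+
    show "(\<lambda>t. B) integrable_on ({a..b} - F)"
      by (rule integrable_spike_set[OF integrable_const_ivl[of B a b]]) (rule neg)+
  qed (use B F ab in auto)
  then show ?thesis by (simp only: eq)
qed

text \<open>The step function that takes on each cell of length \<open>1 / N\<close> the value of
  \<open>w\<close> at the left end point. Trial functions must have this shape because explicit
  univalent functions are constructed for step controls only.\<close>

definition sample :: "(real \<Rightarrow> real) \<Rightarrow> nat \<Rightarrow> real \<Rightarrow> real" where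
  "sample w N t = w (of_int \<lfloor>real N * t\<rfloor> / real N)"

lemma sample_arg:
  assumes "0 \<le> t" "t \<le> 1" "N > 0"
  shows "0 \<le> of_int \<lfloor>real N * t\<rfloor> / real N" "of_int \<lfloor>real N * t\<rfloor> / real N \<le> t"
    "t - 1 / real N < of_int \<lfloor>real N * t\<rfloor> / real N"
proof -
  show "0 \<le> of_int \<lfloor>real N * t\<rfloor> / real N" using assms by simp
  show "of_int \<lfloor>real N * t\<rfloor> / real N \<le> t" using assms of_int_floor_le[of "real N * t"] by (simp add: field_simps)
  have "real N * t - 1 < of_int \<lfloor>real N * t\<rfloor>" by linarith
  then have "(real N * t - 1) / real N < of_int \<lfloor>real N * t\<rfloor> / real N"
    using assms by (intro divide_strict_right_mono) auto
  then show "t - 1 / real N < of_int \<lfloor>real N * t\<rfloor> / real N" using assms by (simp add: diff_divide_distrib)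
qed

lemma pc_sample:
  assumes "pc w" "N > 0"
  shows "pc (sample w N)"
proof -
  obtain B where B: "\<And>t. 0 \<le> t \<Longrightarrow> t \<le> 1 \<Longrightarrow> norm (w t) \<le> B" using pcE[OF assms(1)] by metis
  let ?F = "(\<lambda>k::nat. real k / real N) ` {..N}"
  show ?thesis
  proof (rule pcI)
    show "finite ?F" by simp
    show "norm (sample w N t) \<le> B" if "0 \<le> t" "t \<le> 1" for t
      unfolding sample_def using sample_arg[OF that assms(2)] that by (intro B) auto
    show "continuous_on ({0..1} - ?F) (sample w N)"
    proof (rule continuous_at_imp_continuous_on, intro ballI)
      fix t assume t: "t \<in> {0..1} - ?F"
      \<comment> \<open>Off the grid the floor is locally constant, and so is the sampled
        function.\<close>
      have ni: "real N * t \<notin> \<int>"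
      proof
        assume "real N * t \<in> \<int>"
        then obtain i where i: "real N * t = of_int i" by (auto elim: Ints_cases)
        have "0 \<le> real N * t" "real N * t \<le> real N" using t by (auto simp: mult_left_le)
        then have "0 \<le> i" "i \<le> int N" unfolding i by auto
        then have "t = real (nat i) / real N" "nat i \<le> N" using i assms(2) by (auto simp: field_simps)
        with t show False by auto
      qed
      define k where "k = \<lfloor>real N * t\<rfloor>"
      have k: "of_int k < real N * t" "real N * t < of_int k + 1"
        using ni of_int_floor_le[of "real N * t"] floor_correct[of "real N * t"] Ints_of_int
        unfolding k_def by (metis order_le_less, linarith)
      have "open {s. of_int k < real N * s \<and> real N * s < of_int k + 1}"
        by (intro open_Collect_conj open_Collect_less continuous_intros)
      then have "eventually (\<lambda>s. s \<in> {s. of_int k < real N * s \<and> real N * s < of_int k + 1}) (nhds t)"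
        by (rule eventually_nhds_in_open) (use k in simp)
      then have "eventually (\<lambda>s. \<lfloor>real N * s\<rfloor> = \<lfloor>real N * t\<rfloor>) (nhds t)"
        unfolding k_def[symmetric] by eventually_elim (auto intro: floor_unique)
      then have "eventually (\<lambda>s. sample w N s = sample w N t) (nhds t)"
        by eventually_elim (simp add: sample_def)
      then show "isCont (sample w N) t"
        by (subst isCont_cong[where g = "\<lambda>s. sample w N t"]) auto
    qed
  qed
qed

lemma sample_tendsto:
  assumes "isCont w t" "0 \<le> t" "t \<le> 1"
  shows "(\<lambda>n. sample w (Suc n) t) \<longlonglongrightarrow> w t"
proof -
  have "(\<lambda>n. t - 1 / real (Suc n)) \<longlonglongrightarrow> t - 0"
    by (intro tendsto_intros LIMSEQ_Suc[OF lim_1_over_n])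
  then have "(\<lambda>n. t - 1 / real (Suc n)) \<longlonglongrightarrow> t" by simp
  then have "(\<lambda>n. of_int \<lfloor>real (Suc n) * t\<rfloor> / real (Suc n)) \<longlonglongrightarrow> t"
  proof (rule tendsto_sandwich[rotated 2])
    show "(\<lambda>n. t) \<longlonglongrightarrow> t" by simp
    show "eventually (\<lambda>n. t - 1 / real (Suc n) \<le> of_int \<lfloor>real (Suc n) * t\<rfloor> / real (Suc n)) sequentially"
      using sample_arg(3)[OF assms(2,3), of "Suc _"] by (intro always_eventually allI less_imp_le) blast
    show "eventually (\<lambda>n. of_int \<lfloor>real (Suc n) * t\<rfloor> / real (Suc n) \<le> t) sequentially"
      using sample_arg(2)[OF assms(2,3), of "Suc _"] by (intro always_eventually allI) blast
  qed
  then show ?thesis unfolding sample_def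
    using assms(1) isCont_tendsto_compose by blast
qed

text \<open>Bounded pointwise convergence passes to the primitives and then to every term of the
  form, each time by dominated convergence.\<close>

lemma bform_tendsto:
  fixes f :: "nat \<Rightarrow> real \<Rightarrow> real"
  assumes pcs: "\<And>n. pc (f n)" and w: "pc w"
    and bd: "\<And>n t. 0 \<le> t \<Longrightarrow> t \<le> 1 \<Longrightarrow> \<bar>f n t\<bar> \<le> B" and B: "0 \<le> B"
    and F: "finite F" "\<And>t. t \<in> {0..1} - F \<Longrightarrow> (\<lambda>n. f n t) \<longlonglongrightarrow> w t"
  shows "(\<lambda>n. bform \<nu> (f n) (f n)) \<longlonglongrightarrow> bform \<nu> w w"
proof -
  have limp: "(\<lambda>n. prim (f n) t) \<longlonglongrightarrow> prim w t" if "t \<le> 1" for t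
    unfolding prim_def by (rule integral_tendsto_pc[OF pcs w bd F]) (use that in auto)
  have bdp: "\<bar>prim (f n) t\<bar> \<le> B" if "0 \<le> t" "t \<le> 1" for n t
    using prim_norm_bound[OF pcs pc_const, of n B t] bd that by simp
  have bdp2: "\<bar>prim (f n) t * prim (f n) t\<bar> \<le> B * B" if "0 \<le> t" "t \<le> 1" for n t
    unfolding abs_mult using bdp[OF that, of n] B by (intro mult_mono) auto
  have bd2: "\<bar>(1 + \<nu> * wt t) * f n t * f n t\<bar> \<le> (1 + \<bar>\<nu>\<bar> * 10) * B * B" if "0 \<le> t" "t \<le> 1" for n t
  proof -
    have "\<bar>1 + \<nu> * wt t\<bar> \<le> 1 + \<bar>\<nu>\<bar> * wt t"
      using wt_ge_1[of t] abs_triangle_ineq[of 1 "\<nu> * wt t"] by (simp add: abs_mult)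
    also have "\<dots> \<le> 1 + \<bar>\<nu>\<bar> * 10" using wt_le_10[OF that] by (intro add_left_mono mult_left_mono) auto
    finally show ?thesis unfolding abs_mult using bd[OF that, of n] B by (intro mult_mono) auto
  qed
  have 1: "(\<lambda>n. J (\<lambda>t. (1 + \<nu> * wt t) * f n t * f n t)) \<longlonglongrightarrow> J (\<lambda>t. (1 + \<nu> * wt t) * w t * w t)"
    by (rule integral_tendsto_pc[OF _ _ bd2 F(1)]) (auto intro!: pc_intros pc_wt pcs w tendsto_intros F(2))
  have 2: "(\<lambda>n. J (f n)) \<longlonglongrightarrow> J w"
    using limp[of 1] by (simp add: prim_1)
  have 3: "(\<lambda>n. J (prim (f n))) \<longlonglongrightarrow> J (prim w)"
    by (rule integral_tendsto_pc[OF _ _ bdp finite.emptyI]) (auto intro!: pc_prim pcs w limp)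
  have 4: "(\<lambda>n. J (\<lambda>t. prim (f n) t * prim (f n) t)) \<longlonglongrightarrow> J (\<lambda>t. prim w t * prim w t)"
    by (rule integral_tendsto_pc[OF _ _ bdp2 finite.emptyI]) (auto intro!: pc_intros pcs w limp tendsto_intros)
  show ?thesis unfolding bform_def qcross_def
    by (intro tendsto_intros 1 2 3 4)
qed

lemma bform_sample_tendsto:
  assumes "pc w"
  shows "(\<lambda>n. bform \<nu> (sample w (Suc n)) (sample w (Suc n))) \<longlonglongrightarrow> bform \<nu> w w"
proof -
  obtain B where B: "\<And>t. 0 \<le> t \<Longrightarrow> t \<le> 1 \<Longrightarrow> norm (w t) \<le> B" "B > 0" using pcE[OF assms(1)] by metis
  obtain F where F: "finite F" "\<And>t. t \<in> {0<..<1} - F \<Longrightarrow> isCont w t"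
    using prim_has_vector_derivative[OF assms] by metis
  show ?thesis
  proof (rule bform_tendsto)
    show "pc (sample w (Suc n))" for n by (rule pc_sample[OF assms]) simp
    show "\<bar>sample w (Suc n) t\<bar> \<le> B" if "0 \<le> t" "t \<le> 1" for n t
      using B(1)[OF sample_arg(1)[OF that] order_trans[OF sample_arg(2)[OF that] that(2)], of "Suc n"]
      unfolding sample_def by (simp del: of_nat_Suc)
    show "finite (insert 0 (insert 1 F))" using F by simp
    show "(\<lambda>n. sample w (Suc n) t) \<longlonglongrightarrow> w t" if "t \<in> {0..1} - insert 0 (insert 1 F)" for t
      using that by (intro sample_tendsto F(2)) auto
  qed (use assms B in auto)
qed

lemma elop_continuous: "continuous_on {0..1} S \<Longrightarrow> continuous_on {0..1} (elop S)"
  unfolding elop_def by (intro continuous_intros continuous_on_prim pc_continuous)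

text \<open>The four differences carry the coefficients 24, 8, 12 and 4, with sum 48.\<close>

lemma elop_diff_bound:
  assumes "continuous_on {0..1} S" "continuous_on {0..1} T"
    "\<And>t. 0 \<le> t \<Longrightarrow> t \<le> 1 \<Longrightarrow> \<bar>S t - T t\<bar> \<le> e" "0 \<le> t" "t \<le> 1"
  shows "\<bar>elop S t - elop T t\<bar> \<le> 48 * e"
proof -
  have pcST: "pc S" "pc T" using assms by (auto intro: pc_continuous)
  have e: "0 \<le> e" using assms(3)[of 0] by simp
  have "\<bar>prim (\<lambda>t. S t - T t) x\<bar> \<le> e" if "0 \<le> x" "x \<le> 1" for x
    using prim_norm_bound[OF pc_diff[OF pcST] pc_const, of e x] assms(3) that by simp
  then have 1: "\<bar>prim S x - prim T x\<bar> \<le> e" if "0 \<le> x" "x \<le> 1" for x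
    using prim_diff[OF pcST, of x] that by (metis (no_types))
  have 2: "\<bar>J S - J T\<bar> \<le> e" using 1[of 1] by (simp add: prim_1)
  have 3: "\<bar>S 1 - T 1\<bar> \<le> e" using assms(3)[of 1] by simp
  have 4: "\<bar>(S 1 - T 1) * (1 - t)\<bar> \<le> e"
    unfolding abs_mult using 3 assms(4,5) mult_mono[of "\<bar>S 1 - T 1\<bar>" e "\<bar>1 - t\<bar>" 1] e by simp
  have "elop S t - elop T t = 24 * (S 1 - T 1) - 8 * ((S 1 - T 1) * (1 - t)) - 12 * (J S - J T) + 4 * (prim S t - prim T t)"
    by (simp add: elop_def algebra_simps)
  moreover have "\<bar>24 * a - 8 * b - 12 * c + 4 * d\<bar> \<le> 48 * e" if "\<bar>a\<bar> \<le> e" "\<bar>b\<bar> \<le> e" "\<bar>c\<bar> \<le> e" "\<bar>d\<bar> \<le> e" for a b c d :: real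
    using that by (smt (verit))
  ultimately show ?thesis using 1[OF assms(4,5)] 2 3 4 by simp
qed

text \<open>For a minimizing sequence the residual of the kernel equation tends to zero in mean
  square, and along a subsequence the primitives converge uniformly. As the weight is bounded away
  from zero, the functions themselves then converge in mean square, to a continuous limit.\<close>

lemma kernel_exists:
  assumes \<nu>: "-1/10 < \<nu>" "\<nu> < 0"
    and nonneg: "\<And>s. pc s \<Longrightarrow> 0 \<le> bform \<nu> s s"
    and small: "\<And>e. e > 0 \<Longrightarrow> \<exists>s. pc s \<and> qform2 s = 1 \<and> bform \<nu> s s \<le> e"
  obtains s where "continuous_on {0..1} s" "qform2 s = 1"
    "\<And>t. 0 \<le> t \<Longrightarrow> t \<le> 1 \<Longrightarrow> (1 + \<nu> * wt t) * s t + \<nu> * elop (prim s) t = 0"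
proof -
  have "\<forall>n. \<exists>s. pc s \<and> qform2 s = 1 \<and> bform \<nu> s s \<le> 1 / real (Suc n)"
    by (intro allI small) simp
  then obtain w where w: "\<And>n. pc (w n)" "\<And>n. qform2 (w n) = 1" "\<And>n. bform \<nu> (w n) (w n) \<le> 1 / real (Suc n)"
    by metis
  define \<delta> where "\<delta> = 1 + 10 * \<nu>"
  have \<delta>: "\<delta> > 0" using \<nu> by (simp add: \<delta>_def)
  define D where "D t = 1 + \<nu> * wt t" for t
  have D: "\<delta> \<le> D t" if "0 \<le> t" "t \<le> 1" for t
    using mult_left_mono_neg[OF wt_le_10[OF that], of \<nu>] \<nu> by (simp add: D_def \<delta>_def)
  have pcD: "pc D" unfolding D_def by (intro pc_intros pc_wt)
  define S where "S n = prim (w n)" for n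
  have contS: "continuous_on {0..1} (S n)" for n unfolding S_def by (rule continuous_on_prim[OF w(1)])
  \<comment> \<open>Arzela-Ascoli for the primitives: the bound 1 and the Hoelder exponent 1/2 both
    follow from \<open>qform2 (w n) = 1\<close>.\<close>
  obtain g k where g: "continuous_on {0..1} g" "strict_mono (k :: nat \<Rightarrow> nat)"
    "\<And>e. 0 < e \<Longrightarrow> \<exists>N. \<forall>n x. n \<ge> N \<and> x \<in> {0..1} \<longrightarrow> norm (S (k n) x - g x) < e"
  proof (rule Arzela_Ascoli[of "{0..1}" S 1])
    show "norm (S n x) \<le> 1" if "x \<in> {0..1}" for n x
      using prim_square_le[OF w(1), of x n] w(2)[of n] that by (simp add: S_def power2_le_iff_abs_le abs_square_le_1)
    show "\<exists>d>0. \<forall>n y. y \<in> {0..1} \<and> norm (x - y) < d \<longrightarrow> norm (S n x - S n y) < e"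
      if "x \<in> {0..1}" "0 < e" for x e
    proof (intro exI[of _ "e\<^sup>2"] conjI allI impI)
      have *: "\<bar>S n a - S n b\<bar> < e" if "0 \<le> a" "a \<le> b" "b \<le> 1" "b - a < e\<^sup>2" for a b n
      proof -
        have "(S n b - S n a)\<^sup>2 \<le> (b - a) * 1"
          unfolding S_def prim_increment[OF w(1) that(1-3)]
          using integral_square_le[OF w(1) that(1-3), of n] w(2)[of n] by (simp add: qform2_def)
        also have "\<dots> < e\<^sup>2" using that by simp
        finally have "(S n b - S n a)\<^sup>2 < e\<^sup>2" .
        then have "\<bar>S n b - S n a\<bar> < e" using \<open>0 < e\<close> power2_less_imp_less[of "\<bar>S n b - S n a\<bar>" e] by simp
        then show ?thesis by (simp add: abs_minus_commute)
      qed
      fix n y assume y: "y \<in> {0..1} \<and> norm (x - y) < e\<^sup>2"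
      show "norm (S n x - S n y) < e"
      proof (cases "x \<le> y")
        case True then show ?thesis using *[of x y n] y that by (auto simp: abs_if split: if_splits)
      next
        case False then show ?thesis using *[of y x n] y that by (auto simp: abs_minus_commute)
      qed
    qed (use that in simp)
  qed (use that in \<open>auto simp: compact_Icc\<close>)
  \<comment> \<open>The residual of the kernel equation. Pairing \<open>w n\<close> with
    \<open>r n\<close> in the form gives the square integral R of \<open>r n\<close>, so
    Cauchy-Schwarz for the nonnegative form bounds R^2 by a small factor times R.\<close>
  define r where "r n t = D t * w n t + \<nu> * elop (S n) t" for n t
  have pcr: "pc (r n)" for n
    unfolding r_def by (intro pc_intros pcD w pc_continuous elop_continuous contS)
  have J_r: "J (\<lambda>t. (r n t)\<^sup>2) \<le> 7 / real (Suc n)" for n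
  proof -
    define R where "R = J (\<lambda>t. (r n t)\<^sup>2)"
    have R0: "0 \<le> R" unfolding R_def by (intro J_nonneg pc_intros pcr) auto
    have "bform \<nu> (w n) (r n) = R"
      unfolding bform_elop[OF w(1) pcr] R_def
      by (rule J_cong) (simp add: r_def D_def S_def power2_eq_square)
    then have "R\<^sup>2 \<le> bform \<nu> (w n) (w n) * bform \<nu> (r n) (r n)"
      using bform_Cauchy_Schwarz[OF nonneg w(1) pcr, of n n] by simp
    \<comment> \<open>Here 7 exceeds 1 + 54/10, the bound of the form relative to
      \<open>qform2\<close>.\<close>
    also have "\<dots> \<le> (1 / real (Suc n)) * (7 * R)"
    proof (intro mult_mono w nonneg pcr)
      have "\<bar>\<nu> * qform4 (r n)\<bar> \<le> 1/10 * (54 * qform2 (r n))"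
        unfolding abs_mult using \<nu> qform4_bound[OF pcr, of n] by (intro mult_mono) auto
      then show "bform \<nu> (r n) (r n) \<le> 7 * R"
        using qform2_nonneg[OF pcr, of n] unfolding bform_eq_qform[OF pcr] R_def qform2_def[symmetric] by linarith
    qed simp
    finally have "R * R \<le> (7 / real (Suc n)) * R" by (simp add: power2_eq_square)
    then show ?thesis using R0 unfolding R_def[symmetric]
      by (metis mult_le_cancel_right not_le order_le_less divide_nonneg_nonneg of_nat_0_le_iff zero_le_numeral)
  qed
  \<comment> \<open>The kernel equation solved for the function, with the uniform limit
    \<open>g\<close> in place of its primitive; that \<open>g\<close> is indeed the primitive of
    \<open>v\<close> is shown afterwards.\<close>
  define v where "v t = - \<nu> * elop g t / D t" for t
  have contv: "continuous_on {0..1} v"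
    unfolding v_def
  proof (intro continuous_intros elop_continuous g)
    show "continuous_on {0..1} D" unfolding D_def by (intro continuous_intros continuous_wt)
    show "\<forall>t\<in>{0..1}. D t \<noteq> 0" using D \<delta> by fastforce
  qed
  have pcv: "pc v" by (rule pc_continuous[OF contv])
  have dist: "\<exists>n. J (\<lambda>t. (w n t - v t)\<^sup>2) < e \<and> (\<forall>t\<in>{0..1}. \<bar>S n t - g t\<bar> < e)" if "e > 0" for e
  proof -
    \<comment> \<open>The number 24 below bounds (48/10)^2, and 24/200 is less than 1/8, so this
      part of the error uses at most \<open>\<delta>^2 * e / 8\<close>.\<close>
    define e1 where "e1 = min e (min 1 (\<delta>\<^sup>2 * e / 200))"
    have e1: "e1 > 0" "e1 \<le> e" "e1 \<le> 1" "e1 \<le> \<delta>\<^sup>2 * e / 200" using that \<delta> by (auto simp: e1_def)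
    obtain N where N: "\<And>n x. n \<ge> N \<Longrightarrow> x \<in> {0..1} \<Longrightarrow> norm (S (k n) x - g x) < e1"
      using g(3)[OF e1(1)] by blast
    obtain M :: nat where M: "14 / (\<delta>\<^sup>2 * e / 4) < real M" using reals_Archimedean2 by blast
    define n where "n = k (max N M)"
    have nM: "n \<ge> M" using seq_suble[OF g(2), of "max N M"] by (simp add: n_def)
    have close: "\<bar>S n t - g t\<bar> < e1" if "t \<in> {0..1}" for t
      using N[of "max N M" t] that by (simp add: n_def)
    have pw: "(w n t - v t)\<^sup>2 \<le> (2 / \<delta>\<^sup>2) * (r n t)\<^sup>2 + (2 / \<delta>\<^sup>2) * (24 * e1\<^sup>2)" if t: "0 \<le> t" "t \<le> 1" for t
    proof -
      let ?a = "elop (S n) t - elop g t"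
      have a: "\<bar>?a\<bar> \<le> 48 * e1"
        by (rule elop_diff_bound[OF contS g(1)]) (use close t in \<open>auto intro: less_imp_le\<close>)
      have Dp: "D t > 0" using D[OF t] \<delta> by linarith
      have "\<bar>\<nu> * ?a\<bar> \<le> 1/10 * (48 * e1)" unfolding abs_mult using \<nu> a by (intro mult_mono) auto
      then have "\<bar>\<nu> * ?a\<bar>\<^sup>2 \<le> (1/10 * (48 * e1))\<^sup>2" by (intro power_mono) auto
      also have "\<dots> \<le> 24 * e1\<^sup>2" by (simp add: power2_eq_square)
      finally have na: "(\<nu> * ?a)\<^sup>2 \<le> 24 * e1\<^sup>2" by simp
      have "D t * (w n t - v t) = r n t - \<nu> * ?a"
        using Dp by (simp add: r_def v_def algebra_simps)
      then have "(D t)\<^sup>2 * (w n t - v t)\<^sup>2 = (r n t - \<nu> * ?a)\<^sup>2" by (metis power_mult_distrib)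
      also have "\<dots> \<le> 2 * (r n t)\<^sup>2 + 2 * (\<nu> * ?a)\<^sup>2"
        using zero_le_power2[of "r n t + \<nu> * ?a"] by (simp add: power2_sum power2_diff)
      also have "\<dots> \<le> 2 * (r n t)\<^sup>2 + 2 * (24 * e1\<^sup>2)" using na by simp
      finally have "(D t)\<^sup>2 * (w n t - v t)\<^sup>2 \<le> 2 * (r n t)\<^sup>2 + 2 * (24 * e1\<^sup>2)" .
      moreover have "\<delta>\<^sup>2 * (w n t - v t)\<^sup>2 \<le> (D t)\<^sup>2 * (w n t - v t)\<^sup>2"
        using D[OF t] \<delta> by (intro mult_right_mono power_mono) auto
      ultimately show ?thesis using \<delta> by (simp add: field_simps)
    qed
    have "J (\<lambda>t. (w n t - v t)\<^sup>2) \<le> J (\<lambda>t. (2 / \<delta>\<^sup>2) * (r n t)\<^sup>2 + (2 / \<delta>\<^sup>2) * (24 * e1\<^sup>2))"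
      by (intro J_mono pw pc_intros w pcv pcr)
    also have "\<dots> = J (\<lambda>t. (2 / \<delta>\<^sup>2) * (r n t)\<^sup>2) + J (\<lambda>t. (2 / \<delta>\<^sup>2) * (24 * e1\<^sup>2))"
      by (intro J_add pc_intros pcr)
    also have "\<dots> = (2 / \<delta>\<^sup>2) * J (\<lambda>t. (r n t)\<^sup>2) + (2 / \<delta>\<^sup>2) * (24 * e1\<^sup>2)" by simp
    also have "\<dots> < e"
    proof -
      have "7 / real (Suc n) < \<delta>\<^sup>2 * e / 8"
      proof -
        have "14 / (\<delta>\<^sup>2 * e / 4) < real (Suc n)" using M nM by simp
        then show ?thesis using \<delta> that by (simp add: field_simps)
      qed
      then have a: "J (\<lambda>t. (r n t)\<^sup>2) < \<delta>\<^sup>2 * e / 8" using J_r[of n] by linarith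
      have "e1\<^sup>2 \<le> e1 * 1" unfolding power2_eq_square using e1 by (intro mult_left_mono) auto
      moreover have "0 < \<delta>\<^sup>2 * e" using \<delta> that by simp
      ultimately have b: "24 * e1\<^sup>2 \<le> \<delta>\<^sup>2 * e / 8" using e1(1,4) by linarith
      have "J (\<lambda>t. (r n t)\<^sup>2) + 24 * e1\<^sup>2 < \<delta>\<^sup>2 * e / 4" using a b by linarith
      then have "(2 / \<delta>\<^sup>2) * (J (\<lambda>t. (r n t)\<^sup>2) + 24 * e1\<^sup>2) < (2 / \<delta>\<^sup>2) * (\<delta>\<^sup>2 * e / 4)"
        using \<delta> by (intro mult_strict_left_mono) auto
      also have "\<dots> = e / 2" using \<delta> by simp
      finally show ?thesis using that by (simp add: distrib_left)
    qed
    finally have "J (\<lambda>t. (w n t - v t)\<^sup>2) < e" .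
    moreover have "\<forall>t\<in>{0..1}. \<bar>S n t - g t\<bar> < e" using close e1 by fastforce
    ultimately show ?thesis by blast
  qed
  \<comment> \<open>This closes the circle: mean square convergence of \<open>w n\<close> to
    \<open>v\<close> identifies the limit of the primitives, so \<open>v\<close> solves the kernel
    equation with its own primitive.\<close>
  have g_eq: "prim v t = g t" if t: "0 \<le> t" "t \<le> 1" for t
  proof (rule ccontr)
    assume ne: "prim v t \<noteq> g t"
    define d where "d = \<bar>prim v t - g t\<bar>"
    have d: "d > 0" using ne by (simp add: d_def)
    define e where "e = min (d/2) ((d/2)\<^sup>2)"
    have e: "e > 0" "e \<le> d/2" "e \<le> (d/2)\<^sup>2" using d by (auto simp: e_def)
    obtain n where n: "J (\<lambda>t. (w n t - v t)\<^sup>2) < e" "\<bar>S n t - g t\<bar> < e" using dist[OF e(1)] t by auto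
    have "(prim (\<lambda>t. w n t - v t) t)\<^sup>2 \<le> J (\<lambda>t. (w n t - v t)\<^sup>2)"
      using prim_square_le[OF pc_diff[OF w(1) pcv] t, of n] by (simp add: qform2_def)
    then have "(S n t - prim v t)\<^sup>2 < (d/2)\<^sup>2"
      using n e prim_diff[OF w(1) pcv t(2), of n] by (simp add: S_def)
    then have "\<bar>S n t - prim v t\<bar> < d/2" using d by (metis abs_le_square_iff abs_of_pos half_gt_zero linorder_not_le)
    then show False using n(2) e(2) d_def by linarith
  qed
  have J_g: "J (prim v) = J g" "\<And>t. 0 \<le> t \<Longrightarrow> t \<le> 1 \<Longrightarrow> prim (prim v) t = prim g t"
    using g_eq unfolding prim_def[of "prim v"] prim_def[of g] by (auto intro!: integral_cong)
  have el: "elop (prim v) t = elop g t" if "0 \<le> t" "t \<le> 1" for t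
    unfolding elop_def using J_g g_eq[of 1] that by simp
  have eq: "(1 + \<nu> * wt t) * v t + \<nu> * elop (prim v) t = 0" if "0 \<le> t" "t \<le> 1" for t
    using D[OF that] \<delta> unfolding el[OF that] v_def D_def[symmetric] by simp
  \<comment> \<open>The normalization survives mean square convergence; it excludes the zero
    solution.\<close>
  have "qform2 v = 1"
  proof (rule ccontr)
    assume ne: "qform2 v \<noteq> 1"
    define d where "d = \<bar>qform2 v - 1\<bar>"
    have d: "d > 0" using ne by (simp add: d_def)
    have q0: "0 \<le> qform2 v" by (rule qform2_nonneg[OF pcv])
    define c where "c = 2 * sqrt (qform2 v) + 1"
    have c: "c \<ge> 1" using q0 by (simp add: c_def)
    define e where "e = min 1 (d / c)"
    have e: "e > 0" "e \<le> 1" "e * c \<le> d" using d c by (auto simp: e_def min_def field_simps)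
    obtain n where n: "J (\<lambda>t. (w n t - v t)\<^sup>2) < e\<^sup>2" using dist[of "e\<^sup>2"] e by auto
    let ?h = "\<lambda>t. w n t - v t"
    have ph: "pc ?h" by (intro pc_intros w pcv)
    have "qform2 (w n) = J (\<lambda>t. (v t)\<^sup>2 + (2 * (v t * ?h t) + (?h t)\<^sup>2))"
      unfolding qform2_def by (rule J_cong) (simp add: power2_eq_square algebra_simps)
    also have "\<dots> = J (\<lambda>t. (v t)\<^sup>2) + (J (\<lambda>t. 2 * (v t * ?h t)) + J (\<lambda>t. (?h t)\<^sup>2))"
      by (simp only: J_add pc_intros w pcv)
    finally have q: "1 - qform2 v = 2 * J (\<lambda>t. v t * ?h t) + J (\<lambda>t. (?h t)\<^sup>2)"
      using w(2)[of n] by (simp add: qform2_def)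
    have h0: "0 \<le> J (\<lambda>t. (?h t)\<^sup>2)" by (intro J_nonneg pc_intros w pcv) auto
    have "(J (\<lambda>t. v t * ?h t))\<^sup>2 \<le> qform2 v * J (\<lambda>t. (?h t)\<^sup>2)"
      using J_Cauchy_Schwarz[OF pcv ph] by (simp add: qform2_def)
    also have "\<dots> \<le> qform2 v * e\<^sup>2" using n q0 by (intro mult_left_mono) auto
    finally have "\<bar>J (\<lambda>t. v t * ?h t)\<bar> \<le> sqrt (qform2 v) * e"
      using e q0 real_sqrt_le_mono[of "(J (\<lambda>t. v t * ?h t))\<^sup>2" "qform2 v * e\<^sup>2"] by (simp add: real_sqrt_mult)
    moreover have "J (\<lambda>t. (?h t)\<^sup>2) < e" using n e power2_eq_square[of e] mult_left_le[of e e] by linarith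
    ultimately have "d < 2 * (sqrt (qform2 v) * e) + e" using q h0 unfolding d_def by linarith
    also have "\<dots> = e * c" by (simp add: c_def algebra_simps)
    finally show False using e by simp
  qed
  then show ?thesis using that[OF contv] eq by blast
qed

section \<open>The Cauchy problem\<close>

lemma zero_of_zero_derivative:
  fixes h :: "real \<Rightarrow> real"
  assumes "\<And>t. 0 \<le> t \<Longrightarrow> t \<le> 1 \<Longrightarrow> (h has_real_derivative 0) (at t within {0..1})" "h 0 = 0" "0 \<le> t" "t \<le> 1"
  shows "h t = 0"
proof -
  have "\<exists>c. \<forall>x\<in>{0..1}. h x = c"
    by (rule has_field_derivative_zero_constant) (use assms in auto)
  then show ?thesis using assms by force
qed

lemma prim_has_real_derivative:
  fixes f :: "real \<Rightarrow> real"
  assumes "continuous_on {0..1} f" "0 \<le> t" "t \<le> 1"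
  shows "(prim f has_real_derivative f t) (at t within {0..1})"
  unfolding prim_def [abs_def] has_real_derivative_iff_has_vector_derivative
  using integral_has_vector_derivative[OF assms(1)] assms by simp

text \<open>A Gronwall argument: the sum of the squares of the first and second primitive, damped by
  an exponential, is nonincreasing and vanishes at 0.\<close>

lemma volterra_zero:
  fixes x D :: "real \<Rightarrow> real"
  assumes x: "continuous_on {0..1} x" and D: "\<And>t. 0 \<le> t \<Longrightarrow> t \<le> 1 \<Longrightarrow> \<delta> \<le> D t" "\<delta> > 0"
    and eq: "\<And>t. 0 \<le> t \<Longrightarrow> t \<le> 1 \<Longrightarrow> D t * x t = c * prim (prim x) t" and t: "0 \<le> t" "t \<le> 1"
  shows "x t = 0"
proof -
  let ?E = "prim x" and ?P = "prim (prim x)"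
  have pcx: "pc x" by (rule pc_continuous[OF x])
  have cE: "continuous_on {0..1} ?E" by (rule continuous_on_prim[OF pcx])
  have cP: "continuous_on {0..1} ?P" by (rule continuous_on_prim[OF pc_prim[OF pcx]])
  \<comment> \<open>Since \<open>\<bar>x\<bar>\<close> is at most
    \<open>\<bar>c\<bar> / \<delta>\<close> times the second primitive, the derivative of the sum of
    squares is at most \<open>C\<close> times that sum.\<close>
  define C where "C = \<bar>c\<bar> / \<delta> + 1"
  define N where "N t = ((?E t)\<^sup>2 + (?P t)\<^sup>2) * exp (- C * t)" for t
  have dN: "\<exists>y. (N has_real_derivative y) (at s) \<and> y \<le> 0" if s: "0 < s" "s < 1" for s
  proof -
    have int: "s \<in> interior {0..1}" using s by simp
    have dE: "(?E has_real_derivative x s) (at s)"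
      using prim_has_real_derivative[OF x, of s] s at_within_interior[OF int] by simp
    have dP: "(?P has_real_derivative ?E s) (at s)"
      using prim_has_real_derivative[OF cE, of s] s at_within_interior[OF int] by simp
    have "(N has_real_derivative (2 * ?E s * x s + 2 * ?P s * ?E s - C * ((?E s)\<^sup>2 + (?P s)\<^sup>2)) * exp (- C * s)) (at s)"
      unfolding N_def by (auto intro!: derivative_eq_intros dE dP simp: algebra_simps)
    moreover have "2 * ?E s * x s + 2 * ?P s * ?E s - C * ((?E s)\<^sup>2 + (?P s)\<^sup>2) \<le> 0"
    proof -
      have Ds: "D s > 0" "\<delta> \<le> D s" using D(1)[of s] D(2) s by auto
      have "\<bar>x s\<bar> = \<bar>c\<bar> * \<bar>?P s\<bar> / D s"
        using eq[of s] s Ds by (simp add: field_simps flip: abs_mult) (metis abs_mult abs_of_pos)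
      also have "\<dots> \<le> \<bar>c\<bar> * \<bar>?P s\<bar> / \<delta>" using Ds D(2) by (intro divide_left_mono) auto
      finally have "\<bar>x s\<bar> \<le> \<bar>c\<bar> / \<delta> * \<bar>?P s\<bar>" by simp
      then have "\<bar>?E s * x s\<bar> \<le> \<bar>?E s\<bar> * (\<bar>c\<bar> / \<delta> * \<bar>?P s\<bar>)"
        unfolding abs_mult by (intro mult_left_mono) auto
      moreover have "?P s * ?E s \<le> \<bar>?E s\<bar> * \<bar>?P s\<bar>"
        using abs_ge_self[of "?P s * ?E s"] by (simp add: abs_mult mult.commute)
      moreover have "C * (2 * \<bar>?E s\<bar> * \<bar>?P s\<bar>) = 2 * (\<bar>?E s\<bar> * (\<bar>c\<bar> / \<delta> * \<bar>?P s\<bar>)) + 2 * (\<bar>?E s\<bar> * \<bar>?P s\<bar>)"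
        by (simp add: C_def algebra_simps)
      ultimately have "2 * ?E s * x s + 2 * ?P s * ?E s \<le> C * (2 * \<bar>?E s\<bar> * \<bar>?P s\<bar>)"
        using abs_ge_self[of "?E s * x s"] unfolding mult.assoc by linarith
      also have "\<dots> \<le> C * (\<bar>?E s\<bar>\<^sup>2 + \<bar>?P s\<bar>\<^sup>2)"
        using D(2) by (intro mult_left_mono sum_squares_bound) (auto simp: C_def)
      finally show ?thesis by simp
    qed
    ultimately show ?thesis by (meson mult_nonpos_nonneg exp_ge_zero)
  qed
  have "N t \<le> N 0"
  proof (rule DERIV_nonpos_imp_decreasing_open[OF t(1)])
    show "\<exists>y. (N has_real_derivative y) (at s) \<and> y \<le> 0" if "0 < s" "s < t" for s
      using dN that t by simp
    show "continuous_on {0..t} N"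
      unfolding N_def by (intro continuous_intros continuous_on_subset[OF cE] continuous_on_subset[OF cP]) (use t in auto)
  qed
  then have "?P t = 0" by (simp add: N_def sum_power2_le_zero_iff mult_le_0_iff)
  then show ?thesis using eq[OF t] D(1)[OF t] D(2) by simp
qed

definition ucomb :: "real \<Rightarrow> (nat \<Rightarrow> real \<Rightarrow> real) \<Rightarrow> real \<Rightarrow> real \<Rightarrow> real \<Rightarrow> real" where
  "ucomb \<nu> y \<alpha> \<beta> t = \<alpha> * u_p \<nu> y t + \<beta> * u_q \<nu> y t"

context
  fixes \<nu> :: real and y :: "nat \<Rightarrow> real \<Rightarrow> real" and \<alpha> \<beta> :: real
  assumes \<nu>: "- 1 / 10 < \<nu>" "\<nu> < 0" and sol: "cauchy_solution \<nu> y"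
begin

abbreviation uc :: "real \<Rightarrow> real" where
  "uc \<equiv> ucomb \<nu> y \<alpha> \<beta>"

lemma weight_pos: "0 \<le> t \<Longrightarrow> t \<le> 1 \<Longrightarrow> 1 + 10 * \<nu> \<le> 1 + \<nu> * wt t"
  using mult_left_mono_neg[OF wt_le_10, of t \<nu>] \<nu> by simp

lemma sol_deriv:
  assumes "k \<in> {1..15}" "0 \<le> t" "t \<le> 1"
  shows "(y k has_real_derivative cauchy_rhs \<nu> y t ! (k - 1)) (at t within {0..1})"
  using sol assms unfolding cauchy_solution_def by auto

lemma sol_init: "k \<in> {1..15} \<Longrightarrow> y k 0 = (if k = 6 then 1 else 0)"
  using sol unfolding cauchy_solution_def by auto

lemma sol_cont: "k \<in> {1..15} \<Longrightarrow> continuous_on {0..1} (y k)"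
  using sol_deriv by (intro DERIV_continuous_on) auto

lemma u_eqs:
  assumes "0 \<le> t" "t \<le> 1"
  shows "(1 + \<nu> * wt t) * u_p \<nu> y t = 2 * \<nu> * (3 - 5 * t) * y 4 t + 2 * \<nu> * y 5 t - y 6 t"
    "(1 + \<nu> * wt t) * u_q \<nu> y t = 2 * \<nu> * (3 - 5 * t) * y 10 t + 2 * \<nu> * y 11 t - y 12 t + 2 * (1 - 3 * t)"
proof -
  have eq: "16 * \<nu> * t\<^sup>2 - 8 * \<nu> * t + 2 * \<nu> + 1 = 1 + \<nu> * wt t" by (simp add: wt_def algebra_simps)
  have "1 + \<nu> * wt t \<noteq> 0" using weight_pos[OF assms] \<nu> by linarith
  then show "(1 + \<nu> * wt t) * u_p \<nu> y t = 2 * \<nu> * (3 - 5 * t) * y 4 t + 2 * \<nu> * y 5 t - y 6 t"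
    "(1 + \<nu> * wt t) * u_q \<nu> y t = 2 * \<nu> * (3 - 5 * t) * y 10 t + 2 * \<nu> * y 11 t - y 12 t + 2 * (1 - 3 * t)"
    unfolding u_p_def u_q_def eq by simp_all
qed

lemma ucomb_cont: "continuous_on {0..1} uc"
proof -
  have "16 * \<nu> * t\<^sup>2 - 8 * \<nu> * t + 2 * \<nu> + 1 \<noteq> 0" if "t \<in> {0..1}" for t
    using weight_pos[of t] \<nu> that by (simp add: wt_def algebra_simps)
  then show ?thesis unfolding ucomb_def u_p_def u_q_def
    by (intro continuous_intros sol_cont) auto
qed

text \<open>The functions with indices 1, 13, 7, then 2, 14, 8 and 3, 15, 9 are coefficients of
  quadratic forms in \<open>(\<alpha>, \<beta>)\<close>, those with indices 4, 10, then 5, 11 and 6,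
  12 of linear forms. The combined quantities obey one system driven by the single function
  \<open>uc\<close>.\<close>

lemma comb_derivs:
  assumes t: "0 \<le> t" "t \<le> 1"
  defines "Y1 \<equiv> \<lambda>t. \<alpha>\<^sup>2 * y 1 t + 2 * \<alpha> * \<beta> * y 13 t + \<beta>\<^sup>2 * y 7 t"
    and "Y2 \<equiv> \<lambda>t. \<alpha>\<^sup>2 * y 2 t + 2 * \<alpha> * \<beta> * y 14 t + \<beta>\<^sup>2 * y 8 t"
    and "Y3 \<equiv> \<lambda>t. \<alpha>\<^sup>2 * y 3 t + 2 * \<alpha> * \<beta> * y 15 t + \<beta>\<^sup>2 * y 9 t"
    and "Z \<equiv> \<lambda>t. \<alpha> * y 4 t + \<beta> * y 10 t" and "Y5 \<equiv> \<lambda>t. \<alpha> * y 5 t + \<beta> * y 11 t"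
    and "Y6 \<equiv> \<lambda>t. \<alpha> * y 6 t + \<beta> * y 12 t"
  shows "(Y1 has_real_derivative - 2 * (uc t)\<^sup>2) (at t within {0..1})"
    "(Y2 has_real_derivative 4 * (Y1 t + 2 * Z t * uc t - 2 * (2 * t - 1) * (uc t)\<^sup>2)) (at t within {0..1})"
    "(Y3 has_real_derivative 2 * (7 * t - 3) * Y1 t + 4 * Y2 t - 4 * (Z t)\<^sup>2 + 8 * (5 * t - 3) * Z t * uc t
        + 8 * Y5 t * uc t - 2 * (47 * t\<^sup>2 - 46 * t + 9) * (uc t)\<^sup>2) (at t within {0..1})"
    "(Z has_real_derivative - 2 * uc t) (at t within {0..1})"
    "(Y5 has_real_derivative 4 * (Z t + (1 - 3 * t) * uc t)) (at t within {0..1})"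
    "(Y6 has_real_derivative - 4 * \<nu> * ((t + 1) * uc t + Z t) - 4 * \<beta>) (at t within {0..1})"
proof -
  note d = sol_deriv[OF _ t, of 1] sol_deriv[OF _ t, of 2] sol_deriv[OF _ t, of 3] sol_deriv[OF _ t, of 4]
    sol_deriv[OF _ t, of 5] sol_deriv[OF _ t, of 6] sol_deriv[OF _ t, of 7] sol_deriv[OF _ t, of 8]
    sol_deriv[OF _ t, of 9] sol_deriv[OF _ t, of 10] sol_deriv[OF _ t, of 11] sol_deriv[OF _ t, of 12]
    sol_deriv[OF _ t, of 13] sol_deriv[OF _ t, of 14] sol_deriv[OF _ t, of 15]
  note d' = d[unfolded cauchy_rhs_def, simplified, folded One_nat_def]
  show "(Y1 has_real_derivative - 2 * (uc t)\<^sup>2) (at t within {0..1})"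
    unfolding Y1_def ucomb_def
    by (rule d' derivative_eq_intros refl)+ (simp add: power2_eq_square algebra_simps)
  show "(Y2 has_real_derivative 4 * (Y1 t + 2 * Z t * uc t - 2 * (2 * t - 1) * (uc t)\<^sup>2)) (at t within {0..1})"
    unfolding Y1_def Y2_def Z_def ucomb_def
    by (rule d' derivative_eq_intros refl)+ (simp add: power2_eq_square algebra_simps)
  show "(Y3 has_real_derivative 2 * (7 * t - 3) * Y1 t + 4 * Y2 t - 4 * (Z t)\<^sup>2 + 8 * (5 * t - 3) * Z t * uc t
        + 8 * Y5 t * uc t - 2 * (47 * t\<^sup>2 - 46 * t + 9) * (uc t)\<^sup>2) (at t within {0..1})"
    unfolding Y1_def Y2_def Y3_def Y5_def Z_def ucomb_def
    by (rule d' derivative_eq_intros refl)+ (simp add: power2_eq_square algebra_simps)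
  show "(Z has_real_derivative - 2 * uc t) (at t within {0..1})"
    unfolding Z_def ucomb_def by (rule d' derivative_eq_intros refl)+ (simp add: algebra_simps)
  show "(Y5 has_real_derivative 4 * (Z t + (1 - 3 * t) * uc t)) (at t within {0..1})"
    unfolding Y5_def Z_def ucomb_def by (rule d' derivative_eq_intros refl)+ (simp add: algebra_simps)
  show "(Y6 has_real_derivative - 4 * \<nu> * ((t + 1) * uc t + Z t) - 4 * \<beta>) (at t within {0..1})"
    unfolding Y6_def Z_def ucomb_def by (rule d' derivative_eq_intros refl)+ (simp add: algebra_simps)
qed

text \<open>This is the second-order linear equation in integrated form, so that no
  differentiability of \<open>u_p\<close> and \<open>u_q\<close> is required.\<close>

lemma ucomb_volterra:
  assumes t: "0 \<le> t" "t \<le> 1"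
  shows "(1 + \<nu> * wt t) * uc t = - \<alpha> + 2 * \<beta> - 2 * \<beta> * t - 4 * \<nu> * prim (prim uc) t"
proof -
  let ?S = "prim uc"
  have cS: "continuous_on {0..1} ?S" by (rule continuous_on_prim[OF pc_continuous[OF ucomb_cont]])
  note dS = prim_has_real_derivative[OF ucomb_cont]
  note dP = prim_has_real_derivative[OF cS]
  have Z: "\<alpha> * y 4 s + \<beta> * y 10 s = - 2 * ?S s" if s: "0 \<le> s" "s \<le> 1" for s
  proof -
    have "\<alpha> * y 4 s + \<beta> * y 10 s + 2 * ?S s = 0"
    proof (rule zero_of_zero_derivative[OF _ _ s])
      show "((\<lambda>s. \<alpha> * y 4 s + \<beta> * y 10 s + 2 * ?S s) has_real_derivative 0) (at r within {0..1})"
        if r: "0 \<le> r" "r \<le> 1" for r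
        by (rule comb_derivs(4)[OF r] dS[OF r] derivative_eq_intros refl)+ simp
    qed (simp add: sol_init)
    then show ?thesis by simp
  qed
  \<comment> \<open>The combined numerator of \<open>u_p\<close> and \<open>u_q\<close> minus its
    claimed value vanishes at 0, and its derivative cancels once \<open>Z\<close> is
    inserted.\<close>
  have main: "2 * \<nu> * (3 - 5 * t) * (\<alpha> * y 4 t + \<beta> * y 10 t) + 2 * \<nu> * (\<alpha> * y 5 t + \<beta> * y 11 t) - (\<alpha> * y 6 t + \<beta> * y 12 t)
      + 2 * (1 - 3 * t) * \<beta> + \<alpha> - 2 * \<beta> + 2 * \<beta> * t + 4 * \<nu> * prim ?S t = 0" (is "?h t = 0")
  proof (rule zero_of_zero_derivative[of ?h, OF _ _ t])
    show "(?h has_real_derivative 0) (at r within {0..1})" if r: "0 \<le> r" "r \<le> 1" for r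
      by (rule comb_derivs(4)[OF r] comb_derivs(5)[OF r] comb_derivs(6)[OF r] dP[OF r] derivative_eq_intros refl)+
        (simp add: Z[OF r] algebra_simps)
  qed (simp add: sol_init)
  have "(1 + \<nu> * wt t) * uc t = \<alpha> * ((1 + \<nu> * wt t) * u_p \<nu> y t) + \<beta> * ((1 + \<nu> * wt t) * u_q \<nu> y t)"
    by (simp add: ucomb_def algebra_simps)
  also have "\<dots> = - \<alpha> + 2 * \<beta> - 2 * \<beta> * t - 4 * \<nu> * prim ?S t"
    unfolding u_eqs[OF t] using main by (simp add: algebra_simps)
  finally show ?thesis .
qed

text \<open>The system can be integrated explicitly: the combined quantities are expressed by the
  moments \<open>E\<close>, \<open>F\<close>, \<open>G\<close> of the square of \<open>uc\<close>,
  by the iterated primitives of \<open>uc\<close> and by \<open>P\<close>. At time 1 these are the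
  ingredients of \<open>qform2\<close> and \<open>qform4\<close>.\<close>

lemma ucomb_form:
  "\<alpha>\<^sup>2 * (y 1 1 + \<nu> * y 3 1) + 2 * \<alpha> * \<beta> * (y 13 1 + \<nu> * y 15 1) + \<beta>\<^sup>2 * (y 7 1 + \<nu> * y 9 1) = - 2 * bform \<nu> uc uc"
proof -
  let ?u = uc
  have pcu: "pc ?u" by (rule pc_continuous[OF ucomb_cont])
  define S where "S = prim ?u"
  define \<Sigma> where "\<Sigma> = prim S"
  define P where "P = prim (\<lambda>t. (S t)\<^sup>2)"
  define E where "E = prim (\<lambda>t. (?u t)\<^sup>2)"
  define F where "F = prim (\<lambda>t. t * (?u t)\<^sup>2)"
  define G where "G = prim (\<lambda>t. t\<^sup>2 * (?u t)\<^sup>2)"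
  have cS: "continuous_on {0..1} S" unfolding S_def by (rule continuous_on_prim[OF pcu])
  note dS = prim_has_real_derivative[OF ucomb_cont, folded S_def]
  note d\<Sigma> = prim_has_real_derivative[OF cS, folded \<Sigma>_def]
  have dP: "(P has_real_derivative (S t)\<^sup>2) (at t within {0..1})" if "0 \<le> t" "t \<le> 1" for t
    unfolding P_def by (rule prim_has_real_derivative[OF _ that]) (intro continuous_intros cS)
  have dE: "(E has_real_derivative (?u t)\<^sup>2) (at t within {0..1})" if "0 \<le> t" "t \<le> 1" for t
    unfolding E_def by (rule prim_has_real_derivative[OF _ that]) (intro continuous_intros ucomb_cont)
  have dF: "(F has_real_derivative t * (?u t)\<^sup>2) (at t within {0..1})" if "0 \<le> t" "t \<le> 1" for t
    unfolding F_def by (rule prim_has_real_derivative[OF _ that]) (intro continuous_intros ucomb_cont)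
  have dG: "(G has_real_derivative t\<^sup>2 * (?u t)\<^sup>2) (at t within {0..1})" if "0 \<le> t" "t \<le> 1" for t
    unfolding G_def by (rule prim_has_real_derivative[OF _ that]) (intro continuous_intros ucomb_cont)
  have z: "S 0 = 0" "\<Sigma> 0 = 0" "P 0 = 0" "E 0 = 0" "F 0 = 0" "G 0 = 0"
    by (simp_all add: S_def \<Sigma>_def P_def E_def F_def G_def)
  have Z: "\<alpha> * y 4 s + \<beta> * y 10 s = - 2 * S s" if s: "0 \<le> s" "s \<le> 1" for s
  proof -
    have "\<alpha> * y 4 s + \<beta> * y 10 s + 2 * S s = 0"
    proof (rule zero_of_zero_derivative[OF _ _ s])
      show "((\<lambda>s. \<alpha> * y 4 s + \<beta> * y 10 s + 2 * S s) has_real_derivative 0) (at r within {0..1})"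
        if r: "0 \<le> r" "r \<le> 1" for r
        by (rule comb_derivs(4)[OF r] dS[OF r] derivative_eq_intros refl)+ simp
    qed (simp add: sol_init z)
    then show ?thesis by simp
  qed
  have Y5: "\<alpha> * y 5 s + \<beta> * y 11 s = 4 * \<Sigma> s + 4 * (1 - 3 * s) * S s" if s: "0 \<le> s" "s \<le> 1" for s
  proof -
    have "\<alpha> * y 5 s + \<beta> * y 11 s - (4 * \<Sigma> s + 4 * (1 - 3 * s) * S s) = 0"
    proof (rule zero_of_zero_derivative[OF _ _ s])
      show "((\<lambda>s. \<alpha> * y 5 s + \<beta> * y 11 s - (4 * \<Sigma> s + 4 * (1 - 3 * s) * S s)) has_real_derivative 0) (at r within {0..1})"
        if r: "0 \<le> r" "r \<le> 1" for r
        by (rule comb_derivs(5)[OF r] dS[OF r] d\<Sigma>[OF r] derivative_eq_intros refl)+ (simp add: Z[OF r] algebra_simps)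
    qed (simp add: sol_init z)
    then show ?thesis by simp
  qed
  have Y1: "\<alpha>\<^sup>2 * y 1 s + 2 * \<alpha> * \<beta> * y 13 s + \<beta>\<^sup>2 * y 7 s = - 2 * E s" if s: "0 \<le> s" "s \<le> 1" for s
  proof -
    have "\<alpha>\<^sup>2 * y 1 s + 2 * \<alpha> * \<beta> * y 13 s + \<beta>\<^sup>2 * y 7 s - (- 2 * E s) = 0"
    proof (rule zero_of_zero_derivative[OF _ _ s])
      show "((\<lambda>s. \<alpha>\<^sup>2 * y 1 s + 2 * \<alpha> * \<beta> * y 13 s + \<beta>\<^sup>2 * y 7 s - (- 2 * E s)) has_real_derivative 0) (at r within {0..1})"
        if r: "0 \<le> r" "r \<le> 1" for r
        by (rule comb_derivs(1)[OF r] dE[OF r] derivative_eq_intros refl)+ simp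
    qed (simp add: sol_init z)
    then show ?thesis by simp
  qed
  have Y2: "\<alpha>\<^sup>2 * y 2 s + 2 * \<alpha> * \<beta> * y 14 s + \<beta>\<^sup>2 * y 8 s = 8 * (1 - s) * E s - 8 * (S s)\<^sup>2 - 8 * F s" if s: "0 \<le> s" "s \<le> 1" for s
  proof -
    have "\<alpha>\<^sup>2 * y 2 s + 2 * \<alpha> * \<beta> * y 14 s + \<beta>\<^sup>2 * y 8 s - (8 * (1 - s) * E s - 8 * (S s)\<^sup>2 - 8 * F s) = 0"
    proof (rule zero_of_zero_derivative[OF _ _ s])
      show "((\<lambda>s. \<alpha>\<^sup>2 * y 2 s + 2 * \<alpha> * \<beta> * y 14 s + \<beta>\<^sup>2 * y 8 s - (8 * (1 - s) * E s - 8 * (S s)\<^sup>2 - 8 * F s)) has_real_derivative 0) (at r within {0..1})"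
        if r: "0 \<le> r" "r \<le> 1" for r
        by (rule comb_derivs(2)[OF r] dE[OF r] dF[OF r] dS[OF r] derivative_eq_intros refl)+
          (use Y1[OF r] in \<open>simp add: Z[OF r] algebra_simps power2_eq_square\<close>)
    qed (simp add: sol_init z)
    then show ?thesis by simp
  qed
  \<comment> \<open>At \<open>s = 1\<close> the right-hand side is -2 times \<open>qform4\<close> of
    \<open>uc\<close>.\<close>
  have Y3: "\<alpha>\<^sup>2 * y 3 s + 2 * \<alpha> * \<beta> * y 15 s + \<beta>\<^sup>2 * y 9 s = (44 * s - 30 * s\<^sup>2 - 18) * E s + (48 - 32 * s) * F s - 32 * G s
     + (40 - 88 * s) * (S s)\<^sup>2 + 32 * \<Sigma> s * S s + 8 * P s" (is "?l s = ?r s") if s: "0 \<le> s" "s \<le> 1" for s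
  proof -
    have "?l s - ?r s = 0"
    proof (rule zero_of_zero_derivative[OF _ _ s])
      show "((\<lambda>s. ?l s - ?r s) has_real_derivative 0) (at r within {0..1})"
        if r: "0 \<le> r" "r \<le> 1" for r
        by (rule comb_derivs(3)[OF r] dE[OF r] dF[OF r] dS[OF r] dG[OF r] d\<Sigma>[OF r] dP[OF r] derivative_eq_intros refl)+
          (use arg_cong[OF Y1[OF r], of "\<lambda>x. r * x"] Y1[OF r] Y2[OF r] in \<open>simp add: Z[OF r] Y5[OF r] algebra_simps power2_eq_square\<close>)
    qed (simp add: sol_init z)
    then show ?thesis by simp
  qed
  have "J (\<lambda>t. wt t * (?u t)\<^sup>2) = J (\<lambda>t. 16 * (t\<^sup>2 * (?u t)\<^sup>2) + ((- 8) * (t * (?u t)\<^sup>2) + 2 * (?u t)\<^sup>2))"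
    by (rule J_cong) (simp add: wt_def algebra_simps)
  also have "\<dots> = J (\<lambda>t. 16 * (t\<^sup>2 * (?u t)\<^sup>2)) + (J (\<lambda>t. (- 8) * (t * (?u t)\<^sup>2)) + J (\<lambda>t. 2 * (?u t)\<^sup>2))"
    by (simp only: J_add pc_intros pcu)
  also have "\<dots> = 16 * G 1 - 8 * F 1 + 2 * E 1"
    by (simp add: G_def F_def E_def prim_1)
  finally have w: "J (\<lambda>t. wt t * (?u t)\<^sup>2) = 16 * G 1 - 8 * F 1 + 2 * E 1" .
  have q: "qform2 ?u = E 1" "qform4 ?u = 16 * G 1 - 8 * F 1 + 2 * E 1 + 24 * (S 1)\<^sup>2 - 16 * S 1 * \<Sigma> 1 - 4 * P 1"
    unfolding qform2_def qform4_def w qcross_def by (simp_all add: E_def S_def \<Sigma>_def P_def prim_1 power2_eq_square)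
  have "\<alpha>\<^sup>2 * (y 1 1 + \<nu> * y 3 1) + 2 * \<alpha> * \<beta> * (y 13 1 + \<nu> * y 15 1) + \<beta>\<^sup>2 * (y 7 1 + \<nu> * y 9 1)
    = (\<alpha>\<^sup>2 * y 1 1 + 2 * \<alpha> * \<beta> * y 13 1 + \<beta>\<^sup>2 * y 7 1) + \<nu> * (\<alpha>\<^sup>2 * y 3 1 + 2 * \<alpha> * \<beta> * y 15 1 + \<beta>\<^sup>2 * y 9 1)"
    by (simp add: algebra_simps)
  also have "\<dots> = - 2 * bform \<nu> ?u ?u"
    unfolding bform_eq_qform[OF pcu] q by (subst Y1 Y3; simp)+ (simp add: algebra_simps power2_eq_square)
  finally show ?thesis .
qed

end

text \<open>For a vanishing combination the Volterra equation leaves an affine function equal to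
  zero; evaluating it at 0 and at 1 gives both coefficients.\<close>

lemma ucomb_independent:
  assumes "- 1 / 10 < \<nu>" "\<nu> < 0" "cauchy_solution \<nu> y" "\<And>t. 0 \<le> t \<Longrightarrow> t \<le> 1 \<Longrightarrow> ucomb \<nu> y \<alpha> \<beta> t = 0"
  shows "\<alpha> = 0" "\<beta> = 0"
proof -
  have 1: "prim (ucomb \<nu> y \<alpha> \<beta>) t = 0" if "0 \<le> t" "t \<le> 1" for t
    unfolding prim_def using integral_cong[of "{0..t}" "ucomb \<nu> y \<alpha> \<beta>" "\<lambda>t. 0"] assms(4) that by simp
  have 2: "prim (prim (ucomb \<nu> y \<alpha> \<beta>)) t = 0" if "0 \<le> t" "t \<le> 1" for t
    unfolding prim_def[of "prim _"] using integral_cong[of "{0..t}" "prim (ucomb \<nu> y \<alpha> \<beta>)" "\<lambda>t. 0"] 1 that by simp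
  have "- \<alpha> + 2 * \<beta> = 0" "- \<alpha> = 0"
    using ucomb_volterra[OF assms(1-3), of 0 \<alpha> \<beta>] ucomb_volterra[OF assms(1-3), of 1 \<alpha> \<beta>] assms(4)[of 0] assms(4)[of 1] 2[of 1] by simp_all
  then show "\<alpha> = 0" "\<beta> = 0" by simp_all
qed

text \<open>The function \<open>elop (prim s)\<close> is affine plus
  \<open>4 * prim (prim s)\<close>. Hence both functions satisfy the same Volterra equation, and
  \<open>volterra_zero\<close> applies to their difference.\<close>

lemma kernel_is_ucomb:
  assumes \<nu>: "- 1 / 10 < \<nu>" "\<nu> < 0" and sol: "cauchy_solution \<nu> y"
    and s: "continuous_on {0..1} s"
    and eq: "\<And>t. 0 \<le> t \<Longrightarrow> t \<le> 1 \<Longrightarrow> (1 + \<nu> * wt t) * s t + \<nu> * elop (prim s) t = 0"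
  obtains \<alpha> \<beta> where "\<And>t. 0 \<le> t \<Longrightarrow> t \<le> 1 \<Longrightarrow> s t = ucomb \<nu> y \<alpha> \<beta> t"
proof -
  \<comment> \<open>the parameters for which the kernel equation turns into the Volterra equation of \<open>ucomb\<close>\<close>
  define \<beta> where "\<beta> = 4 * \<nu> * J s"
  define \<alpha> where "\<alpha> = 2 * \<beta> - (1 + \<nu> * wt 0) * s 0"
  let ?u = "ucomb \<nu> y \<alpha> \<beta>"
  have cu: "continuous_on {0..1} ?u" by (rule ucomb_cont[OF assms(1-3)])
  have pcs: "pc s" "pc ?u" using s cu by (auto intro: pc_continuous)
  have "s t - ?u t = 0" if t: "0 \<le> t" "t \<le> 1" for t
  proof (rule volterra_zero[where D = "\<lambda>t. 1 + \<nu> * wt t" and c = "- 4 * \<nu>" and \<delta> = "1 + 10 * \<nu>", OF _ _ _ _ t])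
    show "continuous_on {0..1} (\<lambda>t. s t - ?u t)" by (intro continuous_intros s cu)
    show "1 + 10 * \<nu> \<le> 1 + \<nu> * wt r" if "0 \<le> r" "r \<le> 1" for r by (rule weight_pos[OF assms(1-3) that])
    show "0 < 1 + 10 * \<nu>" using \<nu> by simp
    show "(1 + \<nu> * wt r) * (s r - ?u r) = - 4 * \<nu> * prim (prim (\<lambda>t. s t - ?u t)) r" if r: "0 \<le> r" "r \<le> 1" for r
    proof -
      have 1: "prim (prim (\<lambda>t. s t - ?u t)) r = prim (prim s) r - prim (prim ?u) r"
      proof -
        have "prim (prim (\<lambda>t. s t - ?u t)) r = prim (\<lambda>t. prim s t - prim ?u t) r"
          unfolding prim_def[of _ r] by (rule integral_cong) (use r in \<open>simp add: prim_diff pcs\<close>)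
        then show ?thesis by (simp add: prim_diff pc_prim pcs r)
      qed
      have "(1 + \<nu> * wt 0) * s 0 = - \<nu> * elop (prim s) 0" using eq[of 0] by simp
      moreover have "(1 + \<nu> * wt r) * s r = - \<nu> * elop (prim s) r" using eq[OF r] by simp
      ultimately show ?thesis
        unfolding right_diff_distrib ucomb_volterra[OF assms(1-3) r] 1
        by (simp add: \<alpha>_def \<beta>_def elop_def prim_1 algebra_simps)
    qed
  qed
  then show ?thesis using that by simp
qed

section \<open>The extremal parameter and the two root equations\<close>

lemma qform_scale: "qform2 (\<lambda>t. c * s t) = c\<^sup>2 * qform2 s" "qform4 (\<lambda>t. c * s t) = c\<^sup>2 * qform4 s"
proof -
  have "(\<lambda>t. prim (\<lambda>t. c * s t) t * prim (\<lambda>t. c * s t) t) = (\<lambda>t. c\<^sup>2 * (prim s t * prim s t))"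
    by (simp add: prim_cmult power2_eq_square mult.assoc mult.left_commute)
  moreover have "prim (\<lambda>t. c * s t) = (\<lambda>t. c * prim s t)" by (simp add: prim_cmult fun_eq_iff)
  moreover have "(\<lambda>t. wt t * (c * s t)\<^sup>2) = (\<lambda>t. c\<^sup>2 * (wt t * (s t)\<^sup>2))"
    by (simp add: power_mult_distrib mult.left_commute)
  ultimately show "qform4 (\<lambda>t. c * s t) = c\<^sup>2 * qform4 s"
    by (simp add: qform4_def qcross_def power2_eq_square algebra_simps)
  show "qform2 (\<lambda>t. c * s t) = c\<^sup>2 * qform2 s" by (simp add: qform2_def power_mult_distrib)
qed

lemma extremal_root:
  fixes y :: "real \<Rightarrow> nat \<Rightarrow> real \<Rightarrow> real"
  assumes y: "\<And>\<nu>. \<lbrakk>- 1 / 10 < \<nu>; \<nu> < 0\<rbrakk> \<Longrightarrow> cauchy_solution \<nu> (y \<nu>)"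
  defines "A \<equiv> \<lambda>\<nu>. y \<nu> 1 1 + \<nu> * y \<nu> 3 1"
    and "B \<equiv> \<lambda>\<nu>. y \<nu> 7 1 + \<nu> * y \<nu> 9 1"
    and "C \<equiv> \<lambda>\<nu>. y \<nu> 13 1 + \<nu> * y \<nu> 15 1"
  obtains \<nu>s where "- 1 / 10 < \<nu>s" "\<nu>s < 0" "A \<nu>s = 0 \<or> A \<nu>s * B \<nu>s - (C \<nu>s)\<^sup>2 = 0"
    "\<And>\<nu>. \<nu>s < \<nu> \<Longrightarrow> \<nu> < 0 \<Longrightarrow> A \<nu> \<noteq> 0 \<and> A \<nu> * B \<nu> - (C \<nu>)\<^sup>2 \<noteq> 0"
    "\<And>s. pc s \<Longrightarrow> 0 \<le> bform \<nu>s s s"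
    "\<And>e. e > 0 \<Longrightarrow> \<exists>s N. pc s \<and> N > 0 \<and> qform2 (sample s N) < (- \<nu>s + e) * qform4 (sample s N)"
proof -
  \<comment> \<open>The infimum of the admissible parameters is the extremal one. It turns out to be
    admissible itself, because the form is affine in \<open>\<nu>\<close>.\<close>
  define P where "P = {\<nu>. - 1/10 < \<nu> \<and> \<nu> < 0 \<and> (\<forall>s. pc s \<longrightarrow> 0 \<le> bform \<nu> s s)}"
  define \<nu>s where "\<nu>s = Inf P"
  \<comment> \<open>By \<open>qform4_bound\<close> the form is here at least (1 - 54/60) times
    \<open>qform2\<close>.\<close>
  have in_P: "- 1/60 \<in> P"
  proof -
    have "0 \<le> bform (-1/60) s s" if "pc s" for s
      using qform4_bound[OF that] qform2_nonneg[OF that] unfolding bform_eq_qform[OF that] by simp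
    then show ?thesis by (simp add: P_def)
  qed
  have lower: "- 1/18 \<le> \<nu>" if "\<nu> \<in> P" for \<nu>
  proof -
    have "0 \<le> bform \<nu> (\<lambda>t. 1) (\<lambda>t. 1)" using that pc_const by (auto simp: P_def)
    then show ?thesis unfolding bform_eq_qform[OF pc_const] qform_const by simp
  qed
  have bdd: "bdd_below P" by (rule bdd_belowI[of P "- 1/18"]) (rule lower)
  have \<nu>s_le: "\<nu>s \<le> - 1/60" unfolding \<nu>s_def by (rule cInf_lower[OF in_P bdd])
  have \<nu>s_ge: "- 1/18 \<le> \<nu>s" unfolding \<nu>s_def using in_P lower by (intro cInf_greatest) auto
  have \<nu>s: "- 1/10 < \<nu>s" "\<nu>s < 0" using \<nu>s_le \<nu>s_ge by auto
  have nonneg: "0 \<le> bform \<nu>s s s" if s: "pc s" for s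
  proof (rule ccontr)
    assume "\<not> 0 \<le> bform \<nu>s s s"
    then have neg: "qform2 s + \<nu>s * qform4 s < 0" using bform_eq_qform[OF s] by simp
    define d where "d = - (qform2 s + \<nu>s * qform4 s) / (\<bar>qform4 s\<bar> + 1)"
    have d: "d > 0" using neg by (simp add: d_def divide_pos_pos)
    have "\<exists>\<nu>\<in>P. \<nu> < \<nu>s + d"
      using in_P d cInf_lessD[of P "\<nu>s + d"] unfolding \<nu>s_def by auto
    then obtain \<nu> where \<nu>: "\<nu> \<in> P" "\<nu> < \<nu>s + d" by auto
    have "\<nu>s \<le> \<nu>" unfolding \<nu>s_def by (rule cInf_lower[OF \<nu>(1) bdd])
    then have "(\<nu> - \<nu>s) * qform4 s \<le> d * \<bar>qform4 s\<bar>"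
      using \<nu>(2) d by (intro order_trans[OF mult_left_mono[OF abs_ge_self] mult_right_mono]) auto
    also have "\<dots> < d * (\<bar>qform4 s\<bar> + 1)" using d by simp
    also have "\<dots> = - (qform2 s + \<nu>s * qform4 s)" by (simp add: d_def)
    finally have "qform2 s + \<nu> * qform4 s < 0" by (simp add: algebra_simps)
    moreover have "0 \<le> bform \<nu> s s" using \<nu>(1) s by (simp add: P_def)
    ultimately show False using bform_eq_qform[OF s] by simp
  qed
  have neg: "\<exists>s. pc s \<and> bform \<nu> s s < 0" if "\<nu> < \<nu>s" "-1/10 < \<nu>" for \<nu>
  proof -
    have "\<nu> \<notin> P" using that cInf_lower[OF _ bdd, of \<nu>] by (auto simp: \<nu>s_def)
    then show ?thesis using that \<nu>s by (auto simp: P_def not_le)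
  qed
  have small: "\<exists>s. pc s \<and> qform2 s = 1 \<and> bform \<nu>s s s \<le> e" if e: "e > 0" for e
  proof -
    \<comment> \<open>The bound 54 of \<open>qform4\<close> makes a shift of the parameter by
      \<open>d\<close> cost at most \<open>e\<close>; 1/100 keeps \<open>\<nu>s - d\<close> above
      -1/10, as \<open>\<nu>s\<close> is at least -1/18.\<close>
    define d where "d = min (e / 54) (1/100)"
    have d: "d > 0" "d \<le> e / 54" "d \<le> 1/100" using e by (auto simp: d_def)
    obtain s where s: "pc s" "bform (\<nu>s - d) s s < 0"
      using neg[of "\<nu>s - d"] d \<nu>s_ge by auto
    have n: "qform2 s + (\<nu>s - d) * qform4 s < 0" using s bform_eq_qform[OF s(1)] by simp
    have q: "qform2 s > 0"
    proof (rule ccontr)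
      assume "\<not> ?thesis"
      then have "qform2 s = 0" using qform2_nonneg[OF s(1)] by simp
      moreover from this have "qform4 s = 0" using qform4_bound[OF s(1)] by simp
      ultimately show False using n by simp
    qed
    define c where "c = 1 / sqrt (qform2 s)"
    have c: "c\<^sup>2 = 1 / qform2 s" using q by (simp add: c_def power_divide)
    have pcs: "pc (\<lambda>t. c * s t)" by (intro pc_intros s)
    have "d * qform4 s \<le> d * (54 * qform2 s)" using qform4_bound[OF s(1)] d by (intro mult_left_mono) auto
    also have "\<dots> \<le> e * qform2 s" using d q by simp
    finally have "qform2 s + \<nu>s * qform4 s \<le> e * qform2 s" using n by (simp add: algebra_simps)
    then have "bform \<nu>s (\<lambda>t. c * s t) (\<lambda>t. c * s t) \<le> e"
      unfolding bform_eq_qform[OF pcs] qform_scale c using q by (simp add: field_simps)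
    then show ?thesis using pcs qform_scale(1)[of c s] c q by (intro exI[of _ "\<lambda>t. c * s t"]) auto
  qed
  have form: "\<alpha>\<^sup>2 * A \<nu> + 2 * \<alpha> * \<beta> * C \<nu> + \<beta>\<^sup>2 * B \<nu> = - 2 * bform \<nu> (ucomb \<nu> (y \<nu>) \<alpha> \<beta>) (ucomb \<nu> (y \<nu>) \<alpha> \<beta>)"
    if "- 1/10 < \<nu>" "\<nu> < 0" for \<nu> \<alpha> \<beta>
    using ucomb_form[OF _ _ y] that unfolding A_def B_def C_def by simp
  have pcu: "pc (ucomb \<nu> (y \<nu>) \<alpha> \<beta>)" and contu: "continuous_on {0..1} (ucomb \<nu> (y \<nu>) \<alpha> \<beta>)"
    if "- 1/10 < \<nu>" "\<nu> < 0" for \<nu> \<alpha> \<beta>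
    using ucomb_cont[OF _ _ y] that by (auto intro: pc_continuous)
  \<comment> \<open>The kernel element is an isotropic vector \<open>(\<alpha>, \<beta>)\<close> of
    a negative semidefinite matrix. If \<open>\<beta> = 0\<close>, it yields the first equation;
    otherwise the determinant must vanish.\<close>
  have root: "A \<nu>s = 0 \<or> A \<nu>s * B \<nu>s - (C \<nu>s)\<^sup>2 = 0"
  proof -
    obtain s where s: "continuous_on {0..1} s" "qform2 s = 1"
      "\<And>t. 0 \<le> t \<Longrightarrow> t \<le> 1 \<Longrightarrow> (1 + \<nu>s * wt t) * s t + \<nu>s * elop (prim s) t = 0"
      using kernel_exists[OF \<nu>s nonneg small] by metis
    obtain \<alpha> \<beta> where ab: "\<And>t. 0 \<le> t \<Longrightarrow> t \<le> 1 \<Longrightarrow> s t = ucomb \<nu>s (y \<nu>s) \<alpha> \<beta> t"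
      using kernel_is_ucomb[OF _ _ y s(1,3)] \<nu>s by auto
    let ?u = "ucomb \<nu>s (y \<nu>s) \<alpha> \<beta>"
    have pcs: "pc s" by (rule pc_continuous[OF s(1)])
    have "bform \<nu>s s s = J (\<lambda>t. s t * ((1 + \<nu>s * wt t) * s t + \<nu>s * elop (prim s) t))"
      by (rule bform_elop[OF pcs pcs])
    also have "\<dots> = J (\<lambda>t. 0)" by (rule J_cong) (simp add: s(3))
    finally have s0: "bform \<nu>s s s = 0" by simp
    have Jeq: "J (\<lambda>t. F (s t) t) = J (\<lambda>t. F (?u t) t)" for F :: "real \<Rightarrow> real \<Rightarrow> real"
      by (rule J_cong) (simp add: ab)
    have peq: "prim s t = prim ?u t" if "t \<le> 1" for t
      unfolding prim_def by (rule integral_cong) (use ab that in auto)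
    have "bform \<nu>s s s = bform \<nu>s ?u ?u"
    proof -
      have "J s = J ?u" using Jeq[of "\<lambda>x t. x"] by simp
      moreover have "J (prim s) = J (prim ?u)" by (rule J_cong) (simp add: peq)
      moreover have "J (\<lambda>t. prim s t * prim s t) = J (\<lambda>t. prim ?u t * prim ?u t)" by (rule J_cong) (simp add: peq)
      ultimately show ?thesis
        unfolding bform_def qcross_def using Jeq[of "\<lambda>x t. (1 + \<nu>s * wt t) * x * x"] by simp
    qed
    then have M0: "\<alpha>\<^sup>2 * A \<nu>s + 2 * \<alpha> * \<beta> * C \<nu>s + \<beta>\<^sup>2 * B \<nu>s = 0" using form \<nu>s s0 by simp
    have Mle: "a\<^sup>2 * A \<nu>s + 2 * a * b * C \<nu>s + b\<^sup>2 * B \<nu>s \<le> 0" for a b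
      using form[of \<nu>s a b] \<nu>s nonneg[OF pcu[of \<nu>s a b]] by simp
    show ?thesis
    proof (cases "\<beta> = 0")
      case True
      have "\<alpha> \<noteq> 0"
      proof
        assume "\<alpha> = 0"
        with True ab have "qform2 s = J (\<lambda>t. 0)" unfolding qform2_def
          by (intro J_cong) (simp add: ucomb_def y \<nu>s)
        then show False using s(2) by simp
      qed
      then show ?thesis using M0 True by simp
    next
      case False
      have "(- C \<nu>s)\<^sup>2 \<le> (- A \<nu>s) * (- B \<nu>s)"
      proof (rule quadratic_nonneg_discriminant)
        show "0 \<le> - A \<nu>s + 2 * r * (- C \<nu>s) + r\<^sup>2 * (- B \<nu>s)" for r
          using Mle[of 1 r] by (simp add: algebra_simps)
      qed
      then have c: "0 \<le> A \<nu>s * B \<nu>s - (C \<nu>s)\<^sup>2" by simp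
      have "A \<nu>s * (\<alpha>\<^sup>2 * A \<nu>s + 2 * \<alpha> * \<beta> * C \<nu>s + \<beta>\<^sup>2 * B \<nu>s) =
        (A \<nu>s * \<alpha> + C \<nu>s * \<beta>)\<^sup>2 + (A \<nu>s * B \<nu>s - (C \<nu>s)\<^sup>2) * \<beta>\<^sup>2"
        by (simp add: power2_eq_square algebra_simps)
      then have "(A \<nu>s * B \<nu>s - (C \<nu>s)\<^sup>2) * \<beta>\<^sup>2 \<le> 0" using M0 zero_le_power2[of "A \<nu>s * \<alpha> + C \<nu>s * \<beta>"] by (simp only: mult_zero_right)
      then show ?thesis using c False by (simp add: mult_le_0_iff)
    qed
  qed
  have nonroot: "A \<nu> \<noteq> 0 \<and> A \<nu> * B \<nu> - (C \<nu>)\<^sup>2 \<noteq> 0" if \<nu>: "\<nu>s < \<nu>" "\<nu> < 0" for \<nu>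
  proof -
    have \<nu>': "- 1/10 < \<nu>" using \<nu> \<nu>s by simp
    have M: "a\<^sup>2 * A \<nu> + 2 * a * b * C \<nu> + b\<^sup>2 * B \<nu> < 0" if ne: "a \<noteq> 0 \<or> b \<noteq> 0" for a b
    proof -
      let ?u = "ucomb \<nu> (y \<nu>) a b"
      have pu: "pc ?u" and cu: "continuous_on {0..1} ?u" using pcu contu \<nu> \<nu>' by auto
      have "qform2 ?u \<noteq> 0"
      proof
        assume z: "qform2 ?u = 0"
        have "?u t = 0" if "0 \<le> t" "t \<le> 1" for t
          using J_zero_imp_zero[OF cu _, of t] z that by (simp add: qform2_def)
        then show False using ucomb_independent[of \<nu> "y \<nu>" a b] y \<nu> \<nu>' ne by auto
      qed
      then have q: "qform2 ?u > 0" using qform2_nonneg[OF pu] by simp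
      \<comment> \<open>The form at \<open>\<nu>\<close> is a convex combination of
        \<open>qform2\<close> and the form at \<open>\<nu>s\<close>, with positive weight on
        \<open>qform2\<close>.\<close>
      define \<theta> where "\<theta> = \<nu> / \<nu>s"
      have th: "0 < \<theta>" "\<theta> < 1" "\<nu> = \<theta> * \<nu>s" using \<nu> \<nu>s by (auto simp: \<theta>_def field_simps)
      have "a + \<nu> * b = (1 - \<theta>) * a + \<theta> * (a + \<nu>s * b)" for a b
        unfolding th(3) by (simp add: algebra_simps)
      then have "bform \<nu> ?u ?u = (1 - \<theta>) * qform2 ?u + \<theta> * bform \<nu>s ?u ?u"
        unfolding bform_eq_qform[OF pu] .
      also have "\<dots> > 0" using th q nonneg[OF pu] by (intro add_pos_nonneg mult_pos_pos mult_nonneg_nonneg) auto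
      finally show ?thesis using form[OF \<nu>' \<nu>(2), of a b] by simp
    qed
    have A: "A \<nu> < 0" using M[of 1 0] by simp
    \<comment> \<open>The vector \<open>(C, -A)\<close> turns the quadratic form into
      \<open>A\<close> times the determinant.\<close>
    have "A \<nu> * (A \<nu> * B \<nu> - (C \<nu>)\<^sup>2) = (C \<nu>)\<^sup>2 * A \<nu> + 2 * (C \<nu>) * (- A \<nu>) * C \<nu> + (- A \<nu>)\<^sup>2 * B \<nu>"
      by (simp add: power2_eq_square algebra_simps)
    also have "\<dots> < 0" by (rule M) (use A in auto)
    finally show ?thesis using A by auto
  qed
  \<comment> \<open>Strict negativity of the form just below \<open>\<nu>s\<close> survives sampling
    on a fine grid.\<close>
  have upper: "\<exists>s N. pc s \<and> N > 0 \<and> qform2 (sample s N) < (- \<nu>s + e) * qform4 (sample s N)" if e: "e > 0" for e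
  proof -
    define d where "d = min e (1/100)"
    have d: "d > 0" "d \<le> e" "d \<le> 1/100" using e by (auto simp: d_def)
    obtain s where s: "pc s" "bform (\<nu>s - d) s s < 0"
      using neg[of "\<nu>s - d"] d \<nu>s_ge by auto
    have "eventually (\<lambda>n. bform (\<nu>s - d) (sample s (Suc n)) (sample s (Suc n)) < 0) sequentially"
      by (rule order_tendstoD(2)[OF bform_sample_tendsto[OF s(1)] s(2)])
    then obtain n where n: "bform (\<nu>s - d) (sample s (Suc n)) (sample s (Suc n)) < 0"
      by (auto simp: eventually_sequentially)
    let ?s = "sample s (Suc n)"
    have pcs: "pc ?s" by (rule pc_sample[OF s(1)]) simp
    have lt: "qform2 ?s < (- \<nu>s + d) * qform4 ?s" using n bform_eq_qform[OF pcs] by (simp add: algebra_simps)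
    then have "0 < (- \<nu>s + d) * qform4 ?s" using qform2_nonneg[OF pcs] by linarith
    then have "qform4 ?s > 0" using d \<nu>s by (simp add: zero_less_mult_iff)
    then have "(- \<nu>s + d) * qform4 ?s \<le> (- \<nu>s + e) * qform4 ?s" using d by (intro mult_right_mono) auto
    then show ?thesis using lt s(1) by (intro exI[of _ s] exI[of _ "Suc n"]) auto
  qed
  show ?thesis
    using that[of \<nu>s] \<nu>s root nonroot nonneg upper by simp
qed

section \<open>Coefficients of the Loewner flow\<close>

text \<open>\<open>lw2\<close>, \<open>lw3\<close>, \<open>lw4\<close> are the coefficients of \<open>z\<^sup>2\<close>, \<open>z\<^sup>3\<close>, \<open>z\<^sup>4\<close> in the solution of
  \<open>dw/dt = 2 p w\<^sup>2 / (1 + (1 - t) p w)\<close>, \<open>w(0) = z\<close>. This is Loewner's equation for the normalized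
  flow, in the time for which the inner radius is \<open>1 - t\<close>; \<open>p = 1\<close> leads to \<open>w(1) = K\<close>.\<close>

definition lw2 :: "(real \<Rightarrow> complex) \<Rightarrow> real \<Rightarrow> complex" where
  "lw2 p t = 2 * prim p t"

definition lwI :: "(real \<Rightarrow> complex) \<Rightarrow> real \<Rightarrow> complex" where
  "lwI p = prim (\<lambda>t. of_real (1 - t) * p t ^ 2)"

definition lwW :: "(real \<Rightarrow> complex) \<Rightarrow> real \<Rightarrow> complex" where
  "lwW p = prim (\<lambda>t. of_real (1 - t) * lw2 p t * p t ^ 2)"

definition lwV :: "(real \<Rightarrow> complex) \<Rightarrow> real \<Rightarrow> complex" where
  "lwV p = prim (\<lambda>t. of_real ((1 - t)\<^sup>2) * p t ^ 3)"

definition lw3 :: "(real \<Rightarrow> complex) \<Rightarrow> real \<Rightarrow> complex" where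
  "lw3 p t = (lw2 p t)\<^sup>2 - 2 * lwI p t"

text \<open>The equation gives a4' = 2p(2 a3 + a2^2) - 6(1-t)p^2 a2 + 2(1-t)^2 p^3. Apart from the
  last two summands, this is integrated by a2^3 - 4 a2 \<open>lwI\<close>.\<close>

definition lw4 :: "(real \<Rightarrow> complex) \<Rightarrow> real \<Rightarrow> complex" where
  "lw4 p t = lw2 p t ^ 3 - 4 * lw2 p t * lwI p t - 2 * lwW p t + 2 * lwV p t"

lemma Re_prim: "pc f \<Longrightarrow> 0 \<le> t \<Longrightarrow> t \<le> 1 \<Longrightarrow> Re (prim f t) = prim (\<lambda>t. Re (f t)) t"
  unfolding prim_def using integral_linear[OF pc_integrable[of f 0 t] bounded_linear_Re] by (simp add: o_def)

lemma Im_prim: "pc f \<Longrightarrow> 0 \<le> t \<Longrightarrow> t \<le> 1 \<Longrightarrow> Im (prim f t) = prim (\<lambda>t. Im (f t)) t"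
  unfolding prim_def using integral_linear[OF pc_integrable[of f 0 t] bounded_linear_Im] by (simp add: o_def)

lemma pc_lw2: "pc p \<Longrightarrow> pc (lw2 p)"
  unfolding lw2_def [abs_def] by (intro pc_intros)

lemma ftc_poly:
  fixes f f' :: "real \<Rightarrow> real"
  assumes "\<And>t. (f has_real_derivative f' t) (at t)"
  shows "J f' = f 1 - f 0"
  using assms by (intro integral_unique fundamental_theorem_of_calculus)
      (auto simp: has_real_derivative_iff_has_vector_derivative[symmetric] intro: has_field_derivative_at_within)

text \<open>The function \<open>(1 - t) * (prim x t)^2\<close> vanishes at both ends, so its
  derivative has integral zero.\<close>

lemma J_linear_prim_half:
  assumes "pc x"
  shows "J (\<lambda>t. (1 - t) * prim x t * x t) = J (\<lambda>t. prim x t * prim x t) / 2"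
proof -
  obtain F where F: "finite F" "\<And>t. t \<in> {0<..<1} - F \<Longrightarrow> (prim x has_vector_derivative x t) (at t)"
    using prim_has_vector_derivative[OF assms] by metis
  have "((\<lambda>t. 2 * ((1 - t) * prim x t * x t) - prim x t * prim x t) has_integral
     (1 - 1) * (prim x 1)\<^sup>2 - (1 - 0) * (prim x 0)\<^sup>2) {0..1}"
  proof (rule pc_ftc[OF F(1)])
    show "continuous_on {0..1} (\<lambda>t. (1 - t) * (prim x t)\<^sup>2)"
      by (intro continuous_intros continuous_on_prim assms)
    show "((\<lambda>t. (1 - t) * (prim x t)\<^sup>2) has_vector_derivative 2 * ((1 - t) * prim x t * x t) - prim x t * prim x t) (at t)"
      if "t \<in> {0<..<1} - F" for t
      using F(2)[OF that] unfolding has_real_derivative_iff_has_vector_derivative[symmetric]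
      by (auto intro!: derivative_eq_intros simp: power2_eq_square algebra_simps)
  qed auto
  then have "J (\<lambda>t. 2 * ((1 - t) * prim x t * x t) - prim x t * prim x t) = 0"
    by (simp add: integral_unique)
  then show ?thesis by (subst (asm) J_diff) (auto intro!: pc_intros assms)
qed

lemma J_prim_weight:
  fixes c :: "real \<Rightarrow> real"
  assumes "pc c"
  shows "J (\<lambda>t. (1 - t) * prim c t) = J (\<lambda>t. (1 - t)\<^sup>2 * c t) / 2"
proof -
  obtain F where F: "finite F" "\<And>t. t \<in> {0<..<1} - F \<Longrightarrow> (prim c has_vector_derivative c t) (at t)"
    using prim_has_vector_derivative[OF assms] by metis
  have "((\<lambda>t. (1 - t)\<^sup>2 * c t - 2 * ((1 - t) * prim c t)) has_integral
     (1 - 1)\<^sup>2 * prim c 1 - (1 - 0)\<^sup>2 * prim c 0) {0..1}"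
  proof (rule pc_ftc[OF F(1)])
    show "continuous_on {0..1} (\<lambda>t. (1 - t)\<^sup>2 * prim c t)"
      by (intro continuous_intros continuous_on_prim assms)
    show "((\<lambda>t. (1 - t)\<^sup>2 * prim c t) has_vector_derivative (1 - t)\<^sup>2 * c t - 2 * ((1 - t) * prim c t)) (at t)"
      if "t \<in> {0<..<1} - F" for t
      using F(2)[OF that] unfolding has_real_derivative_iff_has_vector_derivative[symmetric]
      by (auto intro!: derivative_eq_intros simp: power2_eq_square algebra_simps)
  qed auto
  then have "J (\<lambda>t. (1 - t)\<^sup>2 * c t - 2 * ((1 - t) * prim c t)) = 0"
    by (simp add: integral_unique)
  then show ?thesis by (subst (asm) J_diff) (auto intro!: pc_intros assms)
qed

lemma J_abs_le_sqrt:
  fixes f :: "real \<Rightarrow> real"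
  assumes "pc f" "J (\<lambda>t. (f t)\<^sup>2) \<le> e\<^sup>2" "0 \<le> e" "0 \<le> t" "t \<le> 1"
  shows "\<bar>prim f t\<bar> \<le> e"
proof -
  have "(prim f t)\<^sup>2 \<le> e\<^sup>2"
    using prim_square_le[OF assms(1,4,5)] assms(2) unfolding qform2_def by linarith
  then show ?thesis using abs_le_square_iff[of "prim f t" e] assms(3) by simp
qed

section \<open>The expansion at the Koebe function for a control of any size\<close>

locale control =
  fixes v :: "real \<Rightarrow> real"
  assumes v: "pc v"
begin

definition p :: "real \<Rightarrow> complex" where "p t = cis (v t)"
definition c :: "real \<Rightarrow> real" where "c t = 1 - cos (v t)"
definition s :: "real \<Rightarrow> real" where "s t = sin (v t)"
definition x :: "real \<Rightarrow> real" where "x t = sin (v t) * cos (v t)"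
definition X :: real where "X = 2 * J c"
text \<open>What remains of \<open>4 - Re a\<^sub>4\<close> after splitting off \<open>Q\<^sub>4(x)\<close>: it is of order \<open>c\<^sup>2\<close>, hence negligible
  for uniformly small controls, but not for controls that are large on a small set.\<close>
definition needle :: "real \<Rightarrow> real" where
  "needle t = wt t * ((s t)\<^sup>2 - (x t)\<^sup>2) + (c t)\<^sup>2 * (10 - (1 - t)\<^sup>2 * (16 - 8 * c t))"

lemma pc_p: "pc p" and pc_c: "pc c" and pc_s: "pc s" and pc_x: "pc x"
  unfolding p_def [abs_def] c_def [abs_def] s_def [abs_def] x_def [abs_def] by (intro pc_intros v)+

lemma pc_needle: "pc needle"
  unfolding needle_def by (intro pc_intros pc_c pc_s pc_x pc_wt)

lemma c_bounds: "0 \<le> c t" "c t \<le> 2"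
  by (simp_all add: c_def)

lemma s_sq: "(s t)\<^sup>2 = 2 * c t - (c t)\<^sup>2"
  using sin_cos_squared_add[of "v t"] by (simp add: s_def c_def power2_eq_square algebra_simps)

lemma x_eq: "x t = s t * (1 - c t)"
  by (simp add: x_def s_def c_def)

lemma x_sq_le: "(x t)\<^sup>2 \<le> (s t)\<^sup>2"
  unfolding x_eq power_mult_distrib using c_bounds[of t] mult_left_mono[of "(1 - c t)\<^sup>2" 1 "(s t)\<^sup>2"]
  by (simp add: abs_square_le_1)

lemma X_bounds: "0 \<le> X" "X \<le> 4"
  using J_nonneg[OF pc_c] J_le_const[OF pc_c, of 2] c_bounds by (auto simp: X_def)

lemma Re_p2: "Re (p t ^ 2) = 1 - 2 * (s t)\<^sup>2" and Im_p2: "Im (p t ^ 2) = 2 * x t"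
  using sin_cos_squared_add[of "v t"] by (simp_all add: p_def s_def x_def power2_eq_square algebra_simps)

lemma Re_p3: "Re (p t ^ 3) = 1 - (9 * c t - 12 * (c t)\<^sup>2 + 4 * (c t) ^ 3)"
proof -
  have "Re (p t ^ 3) = cos (v t) ^ 3 - 3 * cos (v t) * (sin (v t))\<^sup>2"
    by (simp add: p_def power3_eq_cube power2_eq_square algebra_simps)
  also have "(sin (v t))\<^sup>2 = 1 - (cos (v t))\<^sup>2" by (simp add: sin_squared_eq)
  finally show ?thesis by (simp add: c_def power3_eq_cube power2_eq_square algebra_simps)
qed

lemma Re_lw2: "0 \<le> t \<Longrightarrow> t \<le> 1 \<Longrightarrow> Re (lw2 p t) = 2 * t - 2 * prim c t"
  and Im_lw2: "0 \<le> t \<Longrightarrow> t \<le> 1 \<Longrightarrow> Im (lw2 p t) = 2 * prim s t"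
proof -
  assume t: "0 \<le> t" "t \<le> 1"
  have "prim c t = prim (\<lambda>t. 1) t - prim (\<lambda>t. cos (v t)) t"
    unfolding c_def [abs_def] by (intro prim_diff pc_intros v t)
  moreover have "prim (\<lambda>t. 1::real) t = t" using t by (simp add: prim_def)
  ultimately show "Re (lw2 p t) = 2 * t - 2 * prim c t" using t by (simp add: lw2_def Re_prim pc_p p_def)
  show "Im (lw2 p t) = 2 * prim s t" using t by (simp add: lw2_def Im_prim pc_p p_def s_def [abs_def])
qed

lemma Re_lw2_1: "Re (lw2 p 1) = 2 - X"
  by (simp add: Re_lw2 X_def prim_1)

lemma Re_lwI: "Re (lwI p 1) = 1/2 - 2 * J (\<lambda>t. (1 - t) * (s t)\<^sup>2)"
  and Im_lwI: "Im (lwI p 1) = 2 * J (prim x)"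
proof -
  have pc1: "pc (\<lambda>t. of_real (1 - t) * p t ^ 2)" by (intro pc_intros pc_p)
  have RelwI: "Re (lwI p 1) = J (\<lambda>t. Re (of_real (1 - t) * p t ^ 2))"
    unfolding lwI_def prim_1[symmetric] by (rule Re_prim[OF pc1]) auto
  have ImlwI: "Im (lwI p 1) = J (\<lambda>t. Im (of_real (1 - t) * p t ^ 2))"
    unfolding lwI_def prim_1[symmetric] by (rule Im_prim[OF pc1]) auto
  have "Re (lwI p 1) = J (\<lambda>t. (1 - t) - 2 * ((1 - t) * (s t)\<^sup>2))"
    unfolding RelwI
    by (rule J_cong) (simp add: Re_p2 algebra_simps del: Re_complex_of_real of_real_diff flip: scaleR_conv_of_real)
  also have "\<dots> = J (\<lambda>t. 1 - t) - J (\<lambda>t. 2 * ((1 - t) * (s t)\<^sup>2))"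
    by (intro J_diff pc_intros pc_s)
  also have "J (\<lambda>t. 1 - t :: real) = 1/2"
  proof -
    have "((\<lambda>t. t - t\<^sup>2 / 2) has_real_derivative 1 - t) (at t)" for t :: real
      by (auto intro!: derivative_eq_intros simp: power2_eq_square algebra_simps)
    from ftc_poly[OF this] show ?thesis by simp
  qed
  finally show "Re (lwI p 1) = 1/2 - 2 * J (\<lambda>t. (1 - t) * (s t)\<^sup>2)" by simp
  have "Im (lwI p 1) = J (\<lambda>t. 2 * (x t * (1 - t)))"
    unfolding ImlwI
    by (rule J_cong) (simp add: Im_p2 algebra_simps del: of_real_diff flip: scaleR_conv_of_real)
  then show "Im (lwI p 1) = 2 * J (prim x)" by (simp add: J_prim[OF pc_x])
qed

lemma Re_lwW: "Re (lwW p 1) = 1/3 - J (\<lambda>t. (1 - t)\<^sup>2 * c t) - 4 * J (\<lambda>t. t * (1 - t) * (s t)\<^sup>2)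
    + 4 * J (\<lambda>t. (1 - t) * prim c t * (s t)\<^sup>2) - 4 * J (\<lambda>t. (1 - t) * prim s t * x t)"
proof -
  have pc1: "pc (\<lambda>t. of_real (1 - t) * lw2 p t * p t ^ 2)" by (intro pc_intros pc_p pc_lw2)
  have RelwW: "Re (lwW p 1) = J (\<lambda>t. Re (of_real (1 - t) * lw2 p t * p t ^ 2))"
    unfolding lwW_def prim_1[symmetric] by (rule Re_prim[OF pc1]) auto
  have ImlwW: "Im (lwW p 1) = J (\<lambda>t. Im (of_real (1 - t) * lw2 p t * p t ^ 2))"
    unfolding lwW_def prim_1[symmetric] by (rule Im_prim[OF pc1]) auto
  have "Re (lwW p 1) = J (\<lambda>t. 2 * t * (1 - t) - 2 * ((1 - t) * prim c t) - 4 * (t * (1 - t) * (s t)\<^sup>2)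
     + 4 * ((1 - t) * prim c t * (s t)\<^sup>2) - 4 * ((1 - t) * prim s t * x t))"
    unfolding RelwW
  proof (rule J_cong)
    fix t :: real assume t: "0 \<le> t" "t \<le> 1"
    have "Re (of_real (1 - t) * lw2 p t * p t ^ 2) = (1 - t) * (Re (lw2 p t) * Re (p t ^ 2) - Im (lw2 p t) * Im (p t ^ 2))"
      by (simp only: mult.assoc times_complex.sel Re_complex_of_real Im_complex_of_real mult_zero_left diff_zero)
    then show "Re (of_real (1 - t) * lw2 p t * p t ^ 2) = 2 * t * (1 - t) - 2 * ((1 - t) * prim c t) - 4 * (t * (1 - t) * (s t)\<^sup>2)
     + 4 * ((1 - t) * prim c t * (s t)\<^sup>2) - 4 * ((1 - t) * prim s t * x t)"
      unfolding Re_p2 Im_p2 Re_lw2[OF t] Im_lw2[OF t] by (simp add: algebra_simps)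
  qed
  also have "\<dots> = J (\<lambda>t. 2 * t * (1 - t)) - J (\<lambda>t. 2 * ((1 - t) * prim c t)) - J (\<lambda>t. 4 * (t * (1 - t) * (s t)\<^sup>2))
     + J (\<lambda>t. 4 * ((1 - t) * prim c t * (s t)\<^sup>2)) - J (\<lambda>t. 4 * ((1 - t) * prim s t * x t))"
    by (simp only: J_add J_diff pc_intros pc_c pc_s pc_x)
  also have "J (\<lambda>t::real. 2 * t * (1 - t)) = 1/3"
  proof -
    have "((\<lambda>t. t\<^sup>2 - 2 * t^3/3) has_real_derivative 2 * t * (1 - t)) (at t)" for t :: real
      by (auto intro!: derivative_eq_intros simp: power2_eq_square algebra_simps)
    from ftc_poly[OF this] show ?thesis by simp
  qed
  finally show ?thesis by (simp add: J_prim_weight[OF pc_c])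
qed

lemma Re_lwV: "Re (lwV p 1) = 1/3 - J (\<lambda>t. (1 - t)\<^sup>2 * (9 * c t - 12 * (c t)\<^sup>2 + 4 * (c t) ^ 3))"
proof -
  have pc1: "pc (\<lambda>t. of_real ((1 - t)\<^sup>2) * p t ^ 3)" by (intro pc_intros pc_p)
  have RelwV: "Re (lwV p 1) = J (\<lambda>t. Re (of_real ((1 - t)\<^sup>2) * p t ^ 3))"
    unfolding lwV_def prim_1[symmetric] by (rule Re_prim[OF pc1]) auto
  have ImlwV: "Im (lwV p 1) = J (\<lambda>t. Im (of_real ((1 - t)\<^sup>2) * p t ^ 3))"
    unfolding lwV_def prim_1[symmetric] by (rule Im_prim[OF pc1]) auto
  have "Re (lwV p 1) = J (\<lambda>t. (1 - t)\<^sup>2 - (1 - t)\<^sup>2 * (9 * c t - 12 * (c t)\<^sup>2 + 4 * (c t) ^ 3))"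
    unfolding RelwV
  proof (rule J_cong)
    fix t :: real
    have "Re (of_real ((1 - t)\<^sup>2) * p t ^ 3) = (1 - t)\<^sup>2 * Re (p t ^ 3)"
      by (simp only: times_complex.sel Re_complex_of_real Im_complex_of_real mult_zero_left diff_zero)
    then show "Re (of_real ((1 - t)\<^sup>2) * p t ^ 3) = (1 - t)\<^sup>2 - (1 - t)\<^sup>2 * (9 * c t - 12 * (c t)\<^sup>2 + 4 * (c t) ^ 3)"
      unfolding Re_p3 by (simp add: algebra_simps)
  qed
  also have "\<dots> = J (\<lambda>t. (1 - t)\<^sup>2) - J (\<lambda>t. (1 - t)\<^sup>2 * (9 * c t - 12 * (c t)\<^sup>2 + 4 * (c t) ^ 3))"
    by (intro J_diff pc_intros pc_c)
  also have "J (\<lambda>t::real. (1 - t)\<^sup>2) = 1/3"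
  proof -
    have "((\<lambda>t. - ((1 - t)^3) / 3) has_real_derivative (1 - t)\<^sup>2) (at t)" for t :: real
      by (auto intro!: derivative_eq_intros simp: power2_eq_square field_simps)
    from ftc_poly[OF this] show ?thesis by simp
  qed
  finally show ?thesis by simp
qed

lemma J_s2: "J (\<lambda>t. (s t)\<^sup>2) \<le> X"
proof -
  have "J (\<lambda>t. (s t)\<^sup>2) \<le> J (\<lambda>t. 2 * c t)"
    by (intro J_mono pc_intros pc_c pc_s) (simp add: s_sq)
  then show ?thesis by (simp add: X_def)
qed

lemma J_x2: "J (\<lambda>t. (x t)\<^sup>2) \<le> X"
proof -
  have "J (\<lambda>t. (x t)\<^sup>2) \<le> J (\<lambda>t. (s t)\<^sup>2)"
    by (intro J_mono pc_intros pc_x pc_s) (simp add: x_sq_le)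
  then show ?thesis using J_s2 by simp
qed

text \<open>An exact identity. With \<open>s^2 = 2 * c - c^2\<close> the local terms collect into
  \<open>wt * x^2 + needle\<close>; what stands on the right is of third order in
  \<open>sqrt X\<close>.\<close>

lemma lw4_expansion:
  "4 - Re (lw4 p 1) - (qform4 x + J needle) =
    - 24 * (J c)\<^sup>2 + 8 * (J c)^3 + 24 * (J s - J x) * (J s + J x) - 24 * J c * (J s)\<^sup>2
    + 16 * J c * J (\<lambda>t. (1 - t) * (s t)\<^sup>2) - 16 * (J s - J x) * J (prim x)
    + 8 * J (\<lambda>t. (1 - t) * prim c t * (s t)\<^sup>2) - 8 * J (\<lambda>t. (1 - t) * (prim s t - prim x t) * x t)"
proof -
  define a where "a = J (\<lambda>t. (1 - t) * (s t)\<^sup>2)"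
  have re: "Re (lw2 p 1) = 2 - 2 * J c" "Im (lw2 p 1) = 2 * J s"
    by (simp_all add: Re_lw2 Im_lw2 prim_1)
  have "Re (lw4 p 1) = (2 - 2 * J c)^3 - 3 * (2 - 2 * J c) * (2 * J s)\<^sup>2
     - 4 * ((2 - 2 * J c) * (1/2 - 2 * a) - 2 * J s * (2 * J (prim x))) - 2 * Re (lwW p 1) + 2 * Re (lwV p 1)"
    unfolding lw4_def re[symmetric] Re_lwI[folded a_def, symmetric] Im_lwI[symmetric]
    by (simp add: power3_eq_cube power2_eq_square algebra_simps)
  then have 1: "4 - Re (lw4 p 1) = 20 * J c - 16 * a - 8 * J (\<lambda>t. t * (1 - t) * (s t)\<^sup>2)
     - 2 * J (\<lambda>t. (1 - t)\<^sup>2 * c t) + 2 * J (\<lambda>t. (1 - t)\<^sup>2 * (9 * c t - 12 * (c t)\<^sup>2 + 4 * (c t) ^ 3))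
     - 24 * (J c)\<^sup>2 + 8 * (J c)^3 + 24 * (J s)\<^sup>2 - 24 * J c * (J s)\<^sup>2 + 16 * J c * a - 16 * J s * J (prim x)
     + 8 * J (\<lambda>t. (1 - t) * prim c t * (s t)\<^sup>2) - 8 * J (\<lambda>t. (1 - t) * prim s t * x t)"
    unfolding Re_lwW Re_lwV by (simp add: power3_eq_cube power2_eq_square algebra_simps)
  have "20 * J c - 16 * a - 8 * J (\<lambda>t. t * (1 - t) * (s t)\<^sup>2)
     - 2 * J (\<lambda>t. (1 - t)\<^sup>2 * c t) + 2 * J (\<lambda>t. (1 - t)\<^sup>2 * (9 * c t - 12 * (c t)\<^sup>2 + 4 * (c t) ^ 3))
    = J (\<lambda>t. 20 * c t) - J (\<lambda>t. 16 * ((1 - t) * (s t)\<^sup>2)) - J (\<lambda>t. 8 * (t * (1 - t) * (s t)\<^sup>2))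
     - J (\<lambda>t. 2 * ((1 - t)\<^sup>2 * c t)) + J (\<lambda>t. 2 * ((1 - t)\<^sup>2 * (9 * c t - 12 * (c t)\<^sup>2 + 4 * (c t) ^ 3)))"
    by (simp add: a_def)
  also have "\<dots> = J (\<lambda>t. 20 * c t - 16 * ((1 - t) * (s t)\<^sup>2) - 8 * (t * (1 - t) * (s t)\<^sup>2)
     - 2 * ((1 - t)\<^sup>2 * c t) + 2 * ((1 - t)\<^sup>2 * (9 * c t - 12 * (c t)\<^sup>2 + 4 * (c t) ^ 3)))"
    by (simp only: J_add J_diff pc_intros pc_c pc_s)
  also have "\<dots> = J (\<lambda>t. wt t * (x t)\<^sup>2 + needle t)"
    unfolding needle_def s_sq
    by (rule J_cong) (simp add: wt_def power3_eq_cube power2_eq_square algebra_simps)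
  also have "\<dots> = J (\<lambda>t. wt t * (x t)\<^sup>2) + J needle"
    by (intro J_add pc_intros pc_wt pc_x pc_needle)
  finally have 2: "20 * J c - 16 * a - 8 * J (\<lambda>t. t * (1 - t) * (s t)\<^sup>2)
     - 2 * J (\<lambda>t. (1 - t)\<^sup>2 * c t) + 2 * J (\<lambda>t. (1 - t)\<^sup>2 * (9 * c t - 12 * (c t)\<^sup>2 + 4 * (c t) ^ 3)) =
     J (\<lambda>t. wt t * (x t)\<^sup>2) + J needle" .
  have 3: "qform4 x = J (\<lambda>t. wt t * (x t)\<^sup>2) + 24 * (J x)\<^sup>2 - 16 * J x * J (prim x) - 8 * J (\<lambda>t. (1 - t) * prim x t * x t)"
    unfolding J_linear_prim_half[OF pc_x] by (simp add: qform4_def qcross_def power2_eq_square)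
  have "J (\<lambda>t. (1 - t) * (prim s t - prim x t) * x t) = J (\<lambda>t. (1 - t) * prim s t * x t - (1 - t) * prim x t * x t)"
    by (rule J_cong) (simp add: algebra_simps)
  also have "\<dots> = J (\<lambda>t. (1 - t) * prim s t * x t) - J (\<lambda>t. (1 - t) * prim x t * x t)"
    by (intro J_diff pc_intros pc_s pc_x)
  finally have 4: "J (\<lambda>t. (1 - t) * (prim s t - prim x t) * x t) = J (\<lambda>t. (1 - t) * prim s t * x t) - J (\<lambda>t. (1 - t) * prim x t * x t)" .
  show ?thesis unfolding 1 3 4 a_def[symmetric] using 2 by (simp add: power2_eq_square algebra_simps)
qed

text \<open>With e = \<open>sqrt X\<close>, \<open>J c\<close> equals e^2/2, the integrals of
  \<open>s\<close>, \<open>x\<close> and \<open>prim x\<close> are at most e, and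
  \<open>prim s - prim x\<close> is at most e^2/2 because \<open>s - x = s * c\<close>. Powers of e
  above the third are absorbed by e at most 2. The eight terms contribute 12 + 8 + 24 + 24 + 16 + 8
  + 8 + 4 = 104.\<close>

lemma lw4_estimate:
  "\<bar>4 - Re (lw4 p 1) - (qform4 x + J needle)\<bar> \<le> 104 * sqrt X ^ 3"
proof -
  define e where "e = sqrt X"
  have e: "0 \<le> e" "e \<le> 2" "e\<^sup>2 = X" using X_bounds real_sqrt_le_mono[of X 4] by (auto simp: e_def)
  have C: "J c = e\<^sup>2 / 2" by (simp add: e X_def)
  have e4: "e ^ 4 \<le> 2 * e ^ 3"
    using mult_right_mono[OF e(2), of "e^3"] e(1) by (simp add: eval_nat_numeral)
  have e6: "e ^ 6 \<le> 8 * e ^ 3"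
  proof -
    have "e ^ 3 * e ^ 3 \<le> 2 ^ 3 * e ^ 3" using e by (intro mult_right_mono power_mono) auto
    then show ?thesis by (simp add: eval_nat_numeral)
  qed
  have ps: "\<bar>prim s t\<bar> \<le> e" and px: "\<bar>prim x t\<bar> \<le> e" if "0 \<le> t" "t \<le> 1" for t
    using J_abs_le_sqrt[OF pc_s _ e(1) that] J_abs_le_sqrt[OF pc_x _ e(1) that] J_s2 J_x2 e(3) by auto
  have pd: "\<bar>prim s t - prim x t\<bar> \<le> e\<^sup>2 / 2" if "0 \<le> t" "t \<le> 1" for t
  proof -
    have "norm (prim (\<lambda>t. s t - x t) t) \<le> J c"
    proof (rule prim_norm_bound[OF pc_diff[OF pc_s pc_x] pc_c _ that])
      fix t :: real
      have "\<bar>s t\<bar> \<le> 1" by (simp add: s_def)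
      then have "\<bar>s t\<bar> * c t \<le> 1 * c t" using c_bounds[of t] by (intro mult_right_mono) auto
      moreover have "norm (s t - x t) = \<bar>s t\<bar> * c t"
        using c_bounds[of t] by (simp add: x_eq algebra_simps abs_mult flip: abs_mult) (simp add: abs_mult)
      ultimately show "norm (s t - x t) \<le> c t" by simp
    qed
    then show ?thesis using prim_diff[OF pc_s pc_x that(2)] C by simp
  qed
  have pcb: "\<bar>prim c t\<bar> \<le> e\<^sup>2 / 2" if "0 \<le> t" "t \<le> 1" for t
    using prim_norm_bound[OF pc_c pc_c _ that] c_bounds C by simp
  have 1: "\<bar>J s\<bar> \<le> e" "\<bar>J x\<bar> \<le> e" "\<bar>J s - J x\<bar> \<le> e\<^sup>2 / 2"
    using ps[of 1] px[of 1] pd[of 1] by (simp_all add: prim_1)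
  have 2: "\<bar>J (prim x)\<bar> \<le> e"
    using J_norm_bound[OF pc_prim[OF pc_x] pc_const, of e] px by simp
  have 3: "\<bar>J (\<lambda>t. (1 - t) * (s t)\<^sup>2)\<bar> \<le> e\<^sup>2"
  proof -
    have "norm (J (\<lambda>t. (1 - t) * (s t)\<^sup>2)) \<le> J (\<lambda>t. (s t)\<^sup>2)"
      by (intro J_norm_bound pc_intros pc_s) (simp add: abs_mult mult_left_le_one_le)
    then show ?thesis using J_s2 e(3) by simp
  qed
  have 4: "\<bar>J (\<lambda>t. (1 - t) * prim c t * (s t)\<^sup>2)\<bar> \<le> e\<^sup>2 / 2 * e\<^sup>2"
  proof -
    have "norm (J (\<lambda>t. (1 - t) * prim c t * (s t)\<^sup>2)) \<le> J (\<lambda>t. (e\<^sup>2 / 2) * (s t)\<^sup>2)"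
    proof (intro J_norm_bound pc_intros pc_s pc_c)
      fix t :: real assume t: "0 \<le> t" "t \<le> 1"
      have "\<bar>1 - t\<bar> * \<bar>prim c t\<bar> * (s t)\<^sup>2 \<le> 1 * (e\<^sup>2 / 2) * (s t)\<^sup>2"
        using t pcb[OF t] by (intro mult_right_mono mult_mono) auto
      then show "norm ((1 - t) * prim c t * (s t)\<^sup>2) \<le> (e\<^sup>2 / 2) * (s t)\<^sup>2" by (simp add: abs_mult)
    qed
    also have "\<dots> = e\<^sup>2 / 2 * J (\<lambda>t. (s t)\<^sup>2)" by (rule integral_mult_right)
    also have "\<dots> \<le> e\<^sup>2 / 2 * e\<^sup>2" using J_s2 e(3) X_bounds by (intro mult_left_mono) auto
    finally show ?thesis by simp
  qed
  have absx: "J (\<lambda>t. \<bar>x t\<bar>) \<le> e"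
  proof -
    have "J (\<lambda>t. (\<bar>x t\<bar>)\<^sup>2) \<le> e\<^sup>2" using J_x2 e(3) by simp
    from J_abs_le_sqrt[OF pc_abs[OF pc_x] this e(1), of 1] show ?thesis by (simp add: prim_1)
  qed
  have 5: "\<bar>J (\<lambda>t. (1 - t) * (prim s t - prim x t) * x t)\<bar> \<le> e\<^sup>2 / 2 * e"
  proof -
    have "norm (J (\<lambda>t. (1 - t) * (prim s t - prim x t) * x t)) \<le> J (\<lambda>t. (e\<^sup>2 / 2) * \<bar>x t\<bar>)"
    proof (intro J_norm_bound pc_intros pc_s pc_x)
      fix t :: real assume t: "0 \<le> t" "t \<le> 1"
      have "\<bar>1 - t\<bar> * \<bar>prim s t - prim x t\<bar> * \<bar>x t\<bar> \<le> 1 * (e\<^sup>2 / 2) * \<bar>x t\<bar>"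
        using t pd[OF t] by (intro mult_right_mono mult_mono) auto
      then show "norm ((1 - t) * (prim s t - prim x t) * x t) \<le> (e\<^sup>2 / 2) * \<bar>x t\<bar>" by (simp add: abs_mult)
    qed
    also have "\<dots> = e\<^sup>2 / 2 * J (\<lambda>t. \<bar>x t\<bar>)" by (rule integral_mult_right)
    also have "\<dots> \<le> e\<^sup>2 / 2 * e" using absx by (intro mult_left_mono) auto
    finally show ?thesis by simp
  qed
  have t1: "\<bar>24 * (J c)\<^sup>2\<bar> \<le> 12 * e ^ 3" using e4 e(1) by (simp add: C power_divide)
  have t2: "\<bar>8 * (J c) ^ 3\<bar> \<le> 8 * e ^ 3" using e6 e(1) by (simp add: C power_divide)
  have t3: "\<bar>24 * (J s - J x) * (J s + J x)\<bar> \<le> 24 * e ^ 3"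
  proof -
    have "\<bar>J s - J x\<bar> * \<bar>J s + J x\<bar> \<le> e\<^sup>2 / 2 * (2 * e)" using 1 e X_bounds by (intro mult_mono) auto
    then show ?thesis unfolding mult.assoc abs_mult by (simp add: power3_eq_cube power2_eq_square mult_ac)
  qed
  have t4: "\<bar>24 * J c * (J s)\<^sup>2\<bar> \<le> 24 * e ^ 3"
  proof -
    have "(J s)\<^sup>2 \<le> e\<^sup>2" using 1(1) e(1) by (simp add: abs_le_square_iff[symmetric])
    then have "e\<^sup>2 * (J s)\<^sup>2 \<le> e\<^sup>2 * e\<^sup>2" by (intro mult_left_mono) auto
    then have "12 * (e\<^sup>2 * (J s)\<^sup>2) \<le> 12 * e ^ 4" by (simp add: eval_nat_numeral)
    then show ?thesis using e4 unfolding C by (simp add: abs_mult)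
  qed
  have t5: "\<bar>16 * J c * J (\<lambda>t. (1 - t) * (s t)\<^sup>2)\<bar> \<le> 16 * e ^ 3"
  proof -
    have "e\<^sup>2 * \<bar>J (\<lambda>t. (1 - t) * (s t)\<^sup>2)\<bar> \<le> e\<^sup>2 * e\<^sup>2" using 3 by (intro mult_left_mono) auto
    then have "8 * (e\<^sup>2 * \<bar>J (\<lambda>t. (1 - t) * (s t)\<^sup>2)\<bar>) \<le> 8 * e ^ 4" by (simp add: eval_nat_numeral)
    then show ?thesis using e4 unfolding C by (simp add: abs_mult)
  qed
  have t6: "\<bar>16 * (J s - J x) * J (prim x)\<bar> \<le> 8 * e ^ 3"
  proof -
    have "\<bar>J s - J x\<bar> * \<bar>J (prim x)\<bar> \<le> e\<^sup>2 / 2 * e" using 1 2 e X_bounds by (intro mult_mono) auto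
    then show ?thesis unfolding mult.assoc abs_mult by (simp add: power3_eq_cube power2_eq_square mult_ac)
  qed
  have t7: "\<bar>8 * J (\<lambda>t. (1 - t) * prim c t * (s t)\<^sup>2)\<bar> \<le> 8 * e ^ 3"
    using 4 e4 by (simp add: abs_mult eval_nat_numeral)
  have t8: "\<bar>8 * J (\<lambda>t. (1 - t) * (prim s t - prim x t) * x t)\<bar> \<le> 4 * e ^ 3"
    using 5 by (simp add: abs_mult power3_eq_cube power2_eq_square)
  have "\<bar>- a1 + a2 + a3 - a4 + a5 - a6 + a7 - a8\<bar> \<le> 104 * E"
    if "\<bar>a1\<bar> \<le> 12 * E" "\<bar>a2\<bar> \<le> 8 * E" "\<bar>a3\<bar> \<le> 24 * E" "\<bar>a4\<bar> \<le> 24 * E" "\<bar>a5\<bar> \<le> 16 * E" "\<bar>a6\<bar> \<le> 8 * E" "\<bar>a7\<bar> \<le> 8 * E" "\<bar>a8\<bar> \<le> 4 * E"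
    for a1 a2 a3 a4 a5 a6 a7 a8 E :: real
  proof -
    have "\<bar>- a1 + a2 + a3 - a4 + a5 - a6 + a7 - a8\<bar> \<le> \<bar>a1\<bar> + \<bar>a2\<bar> + \<bar>a3\<bar> + \<bar>a4\<bar> + \<bar>a5\<bar> + \<bar>a6\<bar> + \<bar>a7\<bar> + \<bar>a8\<bar>"
      by (intro order_trans[OF abs_triangle_ineq4] order_trans[OF abs_triangle_ineq] add_mono order_refl) auto
    also have "\<dots> \<le> 12 * E + 8 * E + 24 * E + 24 * E + 16 * E + 8 * E + 8 * E + 4 * E"
      by (intro add_mono that)
    finally show ?thesis by simp
  qed
  from this[OF t1 t2 t3 t4 t5 t6 t7 t8]
  show ?thesis unfolding lw4_expansion e_def by simp
qed

text \<open>Since \<open>s^2 + c^2 = 2 * c\<close>, the quantity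
  \<open>X - qform2 x + \<nu> * J needle\<close> is the integral of a nonnegative function: both
  \<open>wt\<close> and the bracket of the needle term are at most 10, and
  \<open>\<nu> > -1/10\<close>. The factor 11 exceeds 104/10.\<close>

lemma lower_bound_by_form:
  assumes \<nu>: "- 1 / 10 < \<nu>" "\<nu> < 0" and nonneg: "0 \<le> bform \<nu> x x"
  shows "- \<nu> * (4 - Re (lw4 p 1)) \<le> X * (1 + 11 * sqrt X)"
proof -
  define Y where "Y = qform4 x + J needle"
  have "0 \<le> J (\<lambda>t. (1 + \<nu> * wt t) * ((s t)\<^sup>2 - (x t)\<^sup>2) + (c t)\<^sup>2 * (1 + \<nu> * (10 - (1 - t)\<^sup>2 * (16 - 8 * c t))))"
  proof (intro J_nonneg pc_intros pc_wt pc_s pc_x pc_c)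
    fix t :: real assume t: "0 \<le> t" "t \<le> 1"
    have "\<nu> * 10 \<le> \<nu> * wt t" using wt_le_10[OF t] \<nu> by (intro mult_left_mono_neg) auto
    with \<nu> have "0 \<le> 1 + \<nu> * wt t" by linarith
    moreover have "0 \<le> (s t)\<^sup>2 - (x t)\<^sup>2" using x_sq_le by simp
    moreover have "0 \<le> (1 - t)\<^sup>2 * (16 - 8 * c t)" using c_bounds[of t] by (intro mult_nonneg_nonneg) auto
    then have "\<nu> * 10 \<le> \<nu> * (10 - (1 - t)\<^sup>2 * (16 - 8 * c t))" using \<nu> by (intro mult_left_mono_neg) auto
    with \<nu> have "0 \<le> 1 + \<nu> * (10 - (1 - t)\<^sup>2 * (16 - 8 * c t))" by linarith
    ultimately show "0 \<le> (1 + \<nu> * wt t) * ((s t)\<^sup>2 - (x t)\<^sup>2) + (c t)\<^sup>2 * (1 + \<nu> * (10 - (1 - t)\<^sup>2 * (16 - 8 * c t)))"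
      by - (rule add_nonneg_nonneg[OF mult_nonneg_nonneg mult_nonneg_nonneg], assumption, assumption, rule zero_le_power2, assumption)
  qed
  also have "\<dots> = J (\<lambda>t. 2 * c t - (x t)\<^sup>2 + \<nu> * needle t)"
    by (rule J_cong) (use s_sq in \<open>simp add: needle_def algebra_simps\<close>)
  also have "\<dots> = J (\<lambda>t. 2 * c t) - J (\<lambda>t. (x t)\<^sup>2) + J (\<lambda>t. \<nu> * needle t)"
    by (simp only: J_add J_diff pc_intros pc_c pc_x pc_needle)
  finally have "0 \<le> X - qform2 x + \<nu> * J needle" by (simp add: X_def qform2_def)
  then have 1: "0 \<le> X + \<nu> * Y"
    using nonneg unfolding bform_eq_qform[OF pc_x] Y_def by (simp add: algebra_simps)
  have est: "4 - Re (lw4 p 1) \<le> Y + 104 * sqrt X ^ 3"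
    using lw4_estimate unfolding Y_def by (simp add: abs_le_iff)
  have "- \<nu> * (4 - Re (lw4 p 1)) \<le> - \<nu> * (Y + 104 * sqrt X ^ 3)"
    using est \<nu> by (intro mult_left_mono) auto
  also have "\<dots> \<le> X + (- \<nu>) * (104 * sqrt X ^ 3)" using 1 by (simp add: algebra_simps)
  also have "\<dots> \<le> X + 1/10 * (104 * sqrt X ^ 3)"
    using \<nu> X_bounds by (intro add_left_mono mult_right_mono) auto
  also have "\<dots> \<le> X + 11 * sqrt X ^ 3" using X_bounds by simp
  also have "\<dots> = X * (1 + 11 * sqrt X)" using X_bounds by (simp add: power3_eq_cube algebra_simps)
  finally show ?thesis .
qed

text \<open>After division by \<open>c^2\<close> the claim concerns a quadratic in
  \<open>b = 2 - c\<close> with leading coefficient \<open>wt t\<close>. Its discriminant is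
  nonpositive exactly if \<open>16 * u^4 \<le> 9 * wt t\<close>, where
  \<open>u = 1 - t\<close>.\<close>

lemma needle_ge:
  assumes t: "0 \<le> t" "t \<le> 1"
  shows "(c t)\<^sup>2 \<le> needle t"
proof -
  define u where "u = 1 - t"
  define b where "b = 2 - c t"
  have u: "0 \<le> u" "u \<le> 1" using t by (auto simp: u_def)
  have w: "wt t = 10 - 24 * u + 16 * u\<^sup>2" by (simp add: wt_def u_def power2_eq_square algebra_simps)
  have wp: "0 < wt t" using wt_ge_1[of t] by linarith
  have "0 \<le> 90 - 216 * u + 144 * u\<^sup>2 - 16 * u ^ 3"
  proof -
    \<comment> \<open>The cubic is nearly minimal at 22/25; the expression here falls short of it by
      a positive affine function of \<open>u\<close>.\<close>
    have "0 \<le> 16 * ((u - 22/25)\<^sup>2 * (1 - u)) + 2496/25 * (u - 22/25)\<^sup>2"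
      using u by (intro add_nonneg_nonneg mult_nonneg_nonneg) auto
    also have "\<dots> \<le> 90 - 216 * u + 144 * u\<^sup>2 - 16 * u ^ 3"
      using u by (simp add: power2_eq_square power3_eq_cube field_simps)
    finally show ?thesis .
  qed
  moreover have "u ^ 4 \<le> u ^ 3" using u by (intro power_decreasing) auto
  ultimately have "0 \<le> 9 * wt t - 16 * u ^ 4" unfolding w by simp
  moreover have "wt t * (wt t * b\<^sup>2 + 9 - 8 * b * u\<^sup>2) = (wt t * b - 4 * u\<^sup>2)\<^sup>2 + (9 * wt t - 16 * u ^ 4)"
    by (simp add: power2_eq_square eval_nat_numeral algebra_simps)
  ultimately have "0 \<le> wt t * (wt t * b\<^sup>2 + 9 - 8 * b * u\<^sup>2)" by simp
  then have "0 \<le> wt t * b\<^sup>2 + 9 - 8 * b * u\<^sup>2" using wp by (simp add: zero_le_mult_iff)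
  then have "0 \<le> (c t)\<^sup>2 * (wt t * b\<^sup>2 + 9 - 8 * b * u\<^sup>2)" by simp
  also have "\<dots> = needle t - (c t)\<^sup>2"
    unfolding needle_def x_eq power_mult_distrib s_sq u_def b_def by (simp add: power2_eq_square algebra_simps)
  finally show ?thesis by simp
qed

text \<open>This makes the denominator of the quotient positive near \<open>koebe\<close>. As
  \<open>x\<close> also vanishes for \<open>c = 1\<close> and \<open>c = 2\<close>,
  \<open>qform4 x\<close> alone cannot control \<open>X\<close>; for large \<open>c\<close> the
  needle term does.\<close>

lemma coercive_estimate: "X / 40 - 104 * sqrt X ^ 3 \<le> 4 - Re (lw4 p 1)"
proof -
  have pw: "1/20 * c t \<le> 1/20 * (x t)\<^sup>2 + needle t" if t: "0 \<le> t" "t \<le> 1" for t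
  proof -
    have "1/20 \<le> 1/20 * (2 - c t) * (1 - c t)\<^sup>2 + c t"
    proof (cases "c t \<le> 1/20")
      case True
      have "39/20 * (19/20)\<^sup>2 \<le> (2 - c t) * (1 - c t)\<^sup>2"
        using True c_bounds[of t] by (intro mult_mono power_mono) auto
      moreover have "(1::real) \<le> 39/20 * (19/20)\<^sup>2" by (simp add: power2_eq_square)
      ultimately show ?thesis using c_bounds[of t] by linarith
    next
      case False
      have "0 \<le> 1/20 * (2 - c t) * (1 - c t)\<^sup>2" using c_bounds[of t] by (intro mult_nonneg_nonneg) auto
      then show ?thesis using False by linarith
    qed
    then have "c t * (1/20) \<le> c t * (1/20 * (2 - c t) * (1 - c t)\<^sup>2 + c t)"
      using c_bounds[of t] by (intro mult_left_mono) auto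
    also have "\<dots> = 1/20 * (x t)\<^sup>2 + (c t)\<^sup>2"
      unfolding x_eq power_mult_distrib s_sq by (simp add: power2_eq_square field_simps)
    finally show ?thesis using needle_ge[OF t] by simp
  qed
  have "J (\<lambda>t. 1/20 * c t) \<le> J (\<lambda>t. 1/20 * (x t)\<^sup>2 + needle t)"
    by (intro J_mono pw pc_intros pc_c pc_x pc_needle)
  also have "\<dots> = J (\<lambda>t. 1/20 * (x t)\<^sup>2) + J needle"
    by (intro J_add pc_intros pc_x pc_needle)
  finally have "X / 40 \<le> qform2 x / 20 + J needle" by (simp add: X_def qform2_def)
  also have "\<dots> \<le> qform4 x + J needle" using qform4_coercive[OF pc_x] by simp
  finally show ?thesis using lw4_estimate by (simp add: abs_le_iff)
qed

end

section \<open>Koebe's square-root step\<close>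

definition disk_univalent :: "(complex \<Rightarrow> complex) \<Rightarrow> bool" where
  "disk_univalent g \<longleftrightarrow> g holomorphic_on ball 0 1 \<and> inj_on g (ball 0 1) \<and> g 0 = 0 \<and> g ` ball 0 1 \<subseteq> ball 0 1"

lemma disk_univalentD:
  assumes "disk_univalent g"
  shows "g holomorphic_on ball 0 1" "inj_on g (ball 0 1)" "g 0 = 0" "\<And>z. norm z < 1 \<Longrightarrow> norm (g z) < 1"
  using assms by (auto simp: disk_univalent_def image_subset_iff)

lemma blaschke_norm:
  assumes "0 < \<alpha>" "\<alpha> < 1" "norm (m::complex) < 1"
  shows "norm ((of_real \<alpha> - m) / (1 - of_real \<alpha> * m)) < 1" "1 - of_real \<alpha> * m \<noteq> 0"
proof -
  have "norm (of_real \<alpha> * m) < 1"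
    using assms mult_strict_mono[of \<alpha> 1 "norm m" 1] by (simp add: norm_mult)
  then show nz: "1 - of_real \<alpha> * m \<noteq> 0" by auto
  have eq: "(norm (1 - of_real \<alpha> * m))\<^sup>2 - (norm (of_real \<alpha> - m))\<^sup>2 = (1 - \<alpha>\<^sup>2) * (1 - (norm m)\<^sup>2)"
    unfolding cmod_power2 by (simp add: power2_eq_square algebra_simps)
  have "0 < (1 - \<alpha>\<^sup>2) * (1 - (norm m)\<^sup>2)"
    using assms by (intro mult_pos_pos) (auto simp: abs_square_less_1 power_less_one_iff)
  with eq have "(norm (of_real \<alpha> - m))\<^sup>2 < (norm (1 - of_real \<alpha> * m))\<^sup>2" by linarith
  then have "norm (of_real \<alpha> - m) < norm (1 - of_real \<alpha> * m)" by (rule power2_less_imp_less) simp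
  then show "norm ((of_real \<alpha> - m) / (1 - of_real \<alpha> * m)) < 1"
    using nz by (simp add: norm_divide divide_less_eq)
qed

lemma blaschke_inj:
  assumes "0 < \<alpha>" "\<alpha> < 1" "norm (m::complex) < 1" "norm (n::complex) < 1"
    "(of_real \<alpha> - m) / (1 - of_real \<alpha> * m) = (of_real \<alpha> - n) / (1 - of_real \<alpha> * n)"
  shows "m = n"
proof -
  have "(of_real \<alpha> - m) * (1 - of_real \<alpha> * n) = (of_real \<alpha> - n) * (1 - of_real \<alpha> * m)"
    using assms blaschke_norm(2)[of \<alpha> m] blaschke_norm(2)[of \<alpha> n] by (simp add: frac_eq_eq)
  then have "(1 - of_real \<alpha> * of_real \<alpha>) * (n - m) = 0" by (simp add: algebra_simps)
  moreover have "1 - of_real \<alpha> * of_real \<alpha> \<noteq> (0::complex)"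
  proof
    assume "1 - of_real \<alpha> * of_real \<alpha> = (0::complex)"
    then have "of_real (\<alpha> * \<alpha>) = (of_real 1 :: complex)" by simp
    then have "\<alpha> * \<alpha> = 1" by (simp only: of_real_eq_iff)
    then show False using assms mult_strict_mono[of \<alpha> 1 \<alpha> 1] by simp
  qed
  ultimately show ?thesis by simp
qed

text \<open>\<open>h\<close> is \<open>g\<close> followed by a disk automorphism moving the omitted point to 0, a square root and
  an automorphism fixing the normalization; inverting these maps gives the relation.\<close>
lemma koebe_step:
  assumes g: "disk_univalent g" and a: "a \<notin> g ` ball 0 1" "norm a = r" "0 < r" "r < 1"
  defines "\<rho> \<equiv> 2 * sqrt r / (1 + r)"
  obtains h k where "disk_univalent h" "norm k = 1"
    "\<And>z. norm z < 1 \<Longrightarrow> g z * (1 - of_real \<rho> * k * h z) = h z * (of_real \<rho> - k * h z)"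
proof -
  note gD = disk_univalentD[OF g]
  define k where "k = cnj a / of_real r"
  have k: "norm k = 1" "k \<noteq> 0" using a by (auto simp: k_def norm_divide)
  have ka: "k * a = of_real r"
    using a complex_norm_square[of a] by (simp add: k_def power2_eq_square mult.commute divide_eq_eq)
  define \<alpha> where "\<alpha> = sqrt r"
  have al: "0 < \<alpha>" "\<alpha> < 1" "\<alpha>\<^sup>2 = r" using a by (auto simp: \<alpha>_def)
  define X where "X z = k * g z" for z
  have X: "norm (X z) < 1" "X z \<noteq> of_real r" if "norm z < 1" for z
  proof -
    show "norm (X z) < 1" using gD(4)[OF that] by (simp add: X_def norm_mult k)
    show "X z \<noteq> of_real r"
    proof
      assume "X z = of_real r"
      then have "g z = a" using ka k by (metis X_def mult_left_cancel)
      then show False using a(1) that by auto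
    qed
  qed
  have Xhol: "X holomorphic_on ball 0 1" unfolding X_def by (intro holomorphic_intros gD)
  define T where "T z = (of_real r - X z) / (1 - of_real r * X z)" for z
  have T: "norm (T z) < 1" "T z \<noteq> 0" "1 - of_real r * X z \<noteq> 0" if "norm z < 1" for z
    using blaschke_norm[OF a(3,4) X(1)[OF that]] X(2)[OF that] by (auto simp: T_def)
  have Thol: "T holomorphic_on ball 0 1" unfolding T_def
    by (intro holomorphic_intros Xhol) (use T in auto)
  obtain m where m: "m holomorphic_on ball 0 1" "\<And>z. z \<in> ball 0 1 \<Longrightarrow> T z = m z ^ 2"
    using simply_connected_imp_holomorphic_sqrt[OF Thol convex_imp_simply_connected[OF convex_ball] _ T(2)]
    by (metis convex_ball convex_imp_locally_path_connected mem_ball_0)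
  \<comment> \<open>A sign: it selects the branch of the square root with the positive value
    \<open>\<alpha>\<close> at 0, so that the second automorphism sends the origin to 0.\<close>
  define \<sigma> where "\<sigma> = m 0 / of_real \<alpha>"
  have "m 0 ^ 2 = of_real r" using m(2)[of 0] by (simp add: T_def X_def gD)
  then have sg: "\<sigma>\<^sup>2 = 1" "m 0 = \<sigma> * of_real \<alpha>" using al by (auto simp: \<sigma>_def power_divide simp flip: of_real_power)
  define n where "n z = \<sigma> * m z" for z
  have n0: "n 0 = of_real \<alpha>" using sg by (simp add: n_def power2_eq_square flip: mult.assoc)
  have n2: "T z = (n z)\<^sup>2" if "norm z < 1" for z using m(2)[of z] that sg by (simp add: n_def power_mult_distrib)
  have nn: "norm (n z) < 1" if "norm z < 1" for z
  proof -
    have "(norm (n z))\<^sup>2 < 1\<^sup>2" using T(1)[OF that] n2[OF that] by (simp add: norm_power)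
    then show ?thesis by (rule power2_less_imp_less) simp
  qed
  have nhol: "n holomorphic_on ball 0 1" unfolding n_def by (intro holomorphic_intros m)
  define H where "H z = (of_real \<alpha> - n z) / (1 - of_real \<alpha> * n z)" for z
  have H: "norm (H z) < 1" "1 - of_real \<alpha> * n z \<noteq> 0" if "norm z < 1" for z
    using blaschke_norm[OF al(1,2) nn[OF that]] by (auto simp: H_def)
  have Hhol: "H holomorphic_on ball 0 1" unfolding H_def
    by (intro holomorphic_intros nhol) (use H in auto)
  define h where "h z = H z / k" for z
  have kh: "k * h z = H z" for z using k by (simp add: h_def)
  have "disk_univalent h"
    unfolding disk_univalent_def
  proof (intro conjI)
    show "h holomorphic_on ball 0 1" unfolding h_def by (intro holomorphic_intros Hhol) (use k in auto)
    show "h 0 = 0" by (simp add: h_def H_def n0)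
    show "h ` ball 0 1 \<subseteq> ball 0 1" using H k by (auto simp: h_def norm_divide)
    show "inj_on h (ball 0 1)"
    proof (rule inj_onI)
      fix z w assume zw: "z \<in> ball 0 1" "w \<in> ball 0 1" "h z = h w"
      then have "H z = H w" using kh by metis
      then have "n z = n w" using blaschke_inj[OF al(1,2) nn nn] zw by (simp add: H_def)
      then have "T z = T w" using n2 zw by simp
      then have "X z = X w" using blaschke_inj[OF a(3,4) X(1) X(1)] zw by (simp add: T_def)
      then have "g z = g w" using k by (simp add: X_def)
      then show "z = w" using gD(2) zw by (auto dest: inj_onD)
    qed
  qed
  moreover have "g z * (1 - of_real \<rho> * k * h z) = h z * (of_real \<rho> - k * h z)" if z: "norm z < 1" for z
  proof -
    define A where "A = (of_real \<alpha> :: complex)"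
    define N where "N = n z"
    define x where "x = X z"
    have rA: "(of_real r :: complex) = A\<^sup>2" using al by (simp add: A_def flip: of_real_power)
    have d1: "1 - A\<^sup>2 * x \<noteq> 0" using T(3)[OF z] by (simp add: rA x_def)
    have d2: "1 - A * N \<noteq> 0" using H(2)[OF z] by (simp add: A_def N_def)
    have "(A\<^sup>2 - x) = N\<^sup>2 * (1 - A\<^sup>2 * x)"
      using n2[OF z] d1 by (simp add: T_def rA x_def[symmetric] N_def[symmetric] field_simps)
    then have xN: "x * (1 - A\<^sup>2 * N\<^sup>2) = A\<^sup>2 - N\<^sup>2" by (simp add: algebra_simps)
    have HN: "H z * (1 - A * N) = A - N" using d2 by (simp add: H_def A_def N_def)
    have A1: "1 + A\<^sup>2 \<noteq> 0"
    proof -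
      have "1 + A\<^sup>2 = of_real (1 + \<alpha>\<^sup>2)" by (simp add: A_def)
      moreover have "1 + \<alpha>\<^sup>2 \<noteq> 0" using al a by simp
      ultimately show ?thesis by (metis of_real_eq_0_iff)
    qed
    have rho: "of_real \<rho> * (1 + A\<^sup>2) = 2 * A"
    proof -
      have "\<rho> * (1 + \<alpha>\<^sup>2) = 2 * \<alpha>" using a al by (simp add: \<rho>_def \<alpha>_def)
      then have "of_real (\<rho> * (1 + \<alpha>\<^sup>2)) = (of_real (2 * \<alpha>) :: complex)" by simp
      then show ?thesis by (simp add: A_def)
    qed
    have A2: "1 - A\<^sup>2 \<noteq> 0"
    proof -
      have "1 - A\<^sup>2 = of_real (1 - \<alpha>\<^sup>2)" by (simp add: A_def)
      moreover have "1 - \<alpha>\<^sup>2 \<noteq> 0" using al a by simp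
      ultimately show ?thesis by (metis of_real_eq_0_iff)
    qed
    \<comment> \<open>The nonzero factor clears all denominators; then \<open>rho\<close> and
      \<open>HN\<close> eliminate \<open>\<rho>\<close> and \<open>H\<close>, and a multiple of
      \<open>xN\<close> remains.\<close>
    have "(x * (1 - of_real \<rho> * H z) - H z * (of_real \<rho> - H z)) * ((1 + A\<^sup>2) * (1 - A * N)\<^sup>2) = 0"
    proof -
      have "(x * (1 - of_real \<rho> * H z) - H z * (of_real \<rho> - H z)) * ((1 + A\<^sup>2) * (1 - A * N)\<^sup>2)
        = x * ((1 + A\<^sup>2) * (1 - A * N)\<^sup>2 - (of_real \<rho> * (1 + A\<^sup>2)) * (H z * (1 - A * N)) * (1 - A * N))
          - (H z * (1 - A * N)) * ((of_real \<rho> * (1 + A\<^sup>2)) * (1 - A * N) - (H z * (1 - A * N)) * (1 + A\<^sup>2))"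
        by (simp add: power2_eq_square algebra_simps)
      also have "\<dots> = x * ((1 + A\<^sup>2) * (1 - A * N)\<^sup>2 - 2 * A * (A - N) * (1 - A * N))
          - (A - N) * (2 * A * (1 - A * N) - (A - N) * (1 + A\<^sup>2))"
        unfolding rho HN ..
      also have "\<dots> = (1 - A\<^sup>2) * (x * (1 - A\<^sup>2 * N\<^sup>2) - (A\<^sup>2 - N\<^sup>2))"
        by (simp add: power2_eq_square algebra_simps)
      also have "\<dots> = 0" unfolding xN by simp
      finally show ?thesis .
    qed
    then have "x * (1 - of_real \<rho> * H z) = H z * (of_real \<rho> - H z)" using A1 d2 by simp
    then have "k * (g z * (1 - of_real \<rho> * k * h z)) = k * (h z * (of_real \<rho> - k * h z))"
      unfolding kh[symmetric] x_def X_def by (simp add: algebra_simps)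
    then show ?thesis using k by simp
  qed
  ultimately show ?thesis using that k by blast
qed

text \<open>Otherwise the image contains the whole circle of radius \<open>r\<close>. The image is
  bounded and simply connected, so its complement is connected and cannot meet the inside of the
  circle. The inverse of \<open>g\<close> composed with scaling by \<open>r\<close> is then a
  self-map of the disk with derivative of modulus \<open>r / norm (deriv g 0) > 1\<close> at 0,
  against Schwarz.\<close>

lemma omitted_point:
  assumes g: "disk_univalent g" and r: "0 < r" "r < 1" "norm (deriv g 0) < r"
  obtains a where "norm a = r" "a \<notin> g ` ball 0 1"
proof -
  note gD = disk_univalentD[OF g]
  let ?O = "g ` ball 0 1"
  have "\<exists>a. norm a = r \<and> a \<notin> ?O"
  proof (rule ccontr)
    assume "\<not> ?thesis"
    then have sph: "norm a = r \<Longrightarrow> a \<in> ?O" for a by blast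
    have op: "open ?O" by (rule open_mapping_thm3[OF gD(1) open_ball gD(2)])
    have "ball (0::complex) 1 homeomorphic ?O"
    proof (rule invariance_of_domain_homeomorphic)
      show "continuous_on (ball 0 1) g" by (rule holomorphic_on_imp_continuous_on[OF gD(1)])
    qed (use gD(2) in auto)
    then have "simply_connected ?O"
      using homeomorphic_simply_connected convex_imp_simply_connected convex_ball by blast
    moreover have "bounded ?O" by (rule bounded_subset[OF bounded_ball[of 0 1]]) (use gD in auto)
    ultimately have conn: "connected (- ?O)" using simply_connected_iff_simple[OF op] by simp
    have sub: "b \<in> ?O" if b: "norm b < r" for b
    proof (rule ccontr)
      assume nb: "b \<notin> ?O"
      have "(2::complex) \<notin> ?O" using gD(4) by fastforce
      have "ball 0 r \<inter> - ?O = {} \<or> - cball 0 r \<inter> - ?O = {}"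
      proof (rule connectedD[OF conn])
        show "- ?O \<subseteq> ball 0 r \<union> - cball 0 r"
        proof
          fix x assume "x \<in> - ?O"
          then have "norm x \<noteq> r" using sph by blast
          then show "x \<in> ball 0 r \<union> - cball 0 r" by auto
        qed
      qed auto
      moreover have "b \<in> ball 0 r \<inter> - ?O" using nb b by simp
      moreover have "2 \<in> - cball 0 r \<inter> - ?O" using \<open>2 \<notin> ?O\<close> r by simp
      ultimately show False by blast
    qed
    obtain G where G: "G holomorphic_on ?O" "\<And>z. z \<in> ball 0 1 \<Longrightarrow> deriv g z * deriv G (g z) = 1"
      "\<And>z. z \<in> ball 0 1 \<Longrightarrow> G (g z) = z"
      using holomorphic_has_inverse[OF gD(1) open_ball gD(2)] by metis
    define F where "F z = G (of_real r * z)" for z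
    have in_O: "of_real r * z \<in> ?O" if "norm z < 1" for z
      by (rule sub) (use that r in \<open>simp add: norm_mult\<close>)
    have "(G \<circ> (\<lambda>z. of_real r * z)) holomorphic_on ball 0 1"
      by (rule holomorphic_on_compose_gen[OF _ G(1)]) (use in_O in \<open>auto intro!: holomorphic_intros\<close>)
    then have Fhol: "F holomorphic_on ball 0 1" by (simp add: F_def [abs_def] o_def)
    have F0: "F 0 = 0" using G(3)[of 0] gD(3) by (simp add: F_def)
    have Fn: "norm (F z) < 1" if z: "norm z < 1" for z
    proof -
      obtain w where "w \<in> ball 0 1" "of_real r * z = g w" using in_O[OF z] by auto
      then show ?thesis using G(3)[of w] by (simp add: F_def)
    qed
    have "norm (deriv F 0) \<le> 1" by (rule Schwarz_Lemma(2)[OF Fhol F0 Fn, of 0]) auto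
    moreover have "deriv F 0 = deriv G 0 * of_real r"
    proof -
      have "0 \<in> ?O" using sub[of 0] r by simp
      then have "(G has_field_derivative deriv G 0) (at (of_real r * 0))"
        using holomorphic_derivI[OF G(1) op] by simp
      moreover have "((\<lambda>z. of_real r * z) has_field_derivative of_real r) (at 0)"
        by (auto intro!: derivative_eq_intros)
      ultimately have "((\<lambda>z. G (of_real r * z)) has_field_derivative deriv G 0 * of_real r) (at 0)"
        by (rule DERIV_chain2)
      then show ?thesis unfolding F_def [abs_def] by (rule DERIV_imp_deriv)
    qed
    moreover have "deriv g 0 * deriv G 0 = 1" using G(2)[of 0] gD(3) by simp
    then have "norm (deriv g 0) * norm (deriv G 0) = 1" by (metis norm_mult norm_one)
    ultimately have "norm (deriv G 0) * r \<le> 1" "norm (deriv g 0) * norm (deriv G 0) = 1"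
      using r by (auto simp: norm_mult)
    then have "r * (norm (deriv g 0) * norm (deriv G 0)) \<le> norm (deriv g 0)"
      using mult_left_mono[of "norm (deriv G 0) * r" 1 "norm (deriv g 0)"] by (simp add: mult_ac)
    then show False using \<open>norm (deriv g 0) * norm (deriv G 0) = 1\<close> r by simp
  qed
  then show ?thesis using that by blast
qed

section \<open>Control representation of univalent functions\<close>

text \<open>For a constant driving value all integrands are polynomials in time.\<close>

lemma lw_const_step:
  fixes p :: "real \<Rightarrow> complex"
  assumes p: "pc p" and t: "0 \<le> t" "0 \<le> x" "t + x \<le> 1" and const: "\<And>\<tau>. t \<le> \<tau> \<Longrightarrow> \<tau> < t + x \<Longrightarrow> p \<tau> = q"
  defines "d \<equiv> 1 - t"
  shows "lw2 p (t + x) = lw2 p t + 2 * q * x"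
    "lwI p (t + x) = lwI p t + q\<^sup>2 * of_real (d * x - x\<^sup>2 / 2)"
    "lwW p (t + x) = lwW p t + q\<^sup>2 * (lw2 p t * of_real (d * x - x\<^sup>2 / 2) + 2 * q * of_real (d * x\<^sup>2 / 2 - x ^ 3 / 3))"
    "lwV p (t + x) = lwV p t + q ^ 3 * of_real (d\<^sup>2 * x - d * x\<^sup>2 + x ^ 3 / 3)"
proof -
  have ftc: "integral {t..t + x'} f = F (t + x') - F t"
    if "0 \<le> x'" "x' \<le> x" "\<And>\<tau>. (F has_vector_derivative f' \<tau>) (at \<tau>)" "\<And>\<tau>. t \<le> \<tau> \<Longrightarrow> \<tau> < t + x' \<Longrightarrow> f \<tau> = f' \<tau>" for f f' F :: "real \<Rightarrow> complex" and x'
  proof -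
    have "(f' has_integral F (t + x') - F t) {t..t + x'}"
      by (rule fundamental_theorem_of_calculus) (use that in \<open>auto intro: has_vector_derivative_at_within\<close>)
    then have "(f has_integral F (t + x') - F t) {t..t + x'}"
      by (rule has_integral_spike_finite[of "{t + x'}", rotated 2]) (use that in auto)
    then show ?thesis by (rule integral_unique)
  qed
  have inc: "prim f (t + x') = prim f t + integral {t..t + x'} f" if "pc f" "0 \<le> x'" "x' \<le> x" for f :: "real \<Rightarrow> complex" and x'
    using prim_increment[OF that(1), of t "t + x'"] t that by (simp add: algebra_simps)
  have lw2': "lw2 p (t + x') = lw2 p t + 2 * q * x'" if "0 \<le> x'" "x' \<le> x" for x'
  proof -
    have "integral {t..t + x'} p = q * of_real (t + x') - q * of_real t"
    proof (rule ftc[OF that])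
      show "((\<lambda>\<tau>. q * of_real \<tau>) has_vector_derivative q) (at \<tau>)" for \<tau>
        by (auto intro!: derivative_eq_intros)
    qed (use const that in auto)
    then show ?thesis unfolding lw2_def inc[OF p that] by (simp add: algebra_simps)
  qed
  show "lw2 p (t + x) = lw2 p t + 2 * q * x" using lw2' t by simp
  have pcp: "pc (\<lambda>t. of_real (1 - t) * p t ^ 2)" "pc (\<lambda>t. of_real (1 - t) * lw2 p t * p t ^ 2)" "pc (\<lambda>t. of_real ((1 - t)\<^sup>2) * p t ^ 3)"
    by (intro pc_intros pc_lw2 p)+
  have real_ftc: "((\<lambda>\<tau>. c * complex_of_real (F \<tau>)) has_vector_derivative c * of_real (F' \<tau>)) (at \<tau>)"
    if "\<And>\<tau>. (F has_real_derivative F' \<tau>) (at \<tau>)" for F F' :: "real \<Rightarrow> real" and c \<tau>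
    using that by (intro has_vector_derivative_mult_right has_vector_derivative_of_real)
      (simp add: has_real_derivative_iff_has_vector_derivative)
  have "integral {t..t + x} (\<lambda>t. of_real (1 - t) * p t ^ 2) = q\<^sup>2 * of_real ((t + x) - (t + x)\<^sup>2 / 2) - q\<^sup>2 * of_real (t - t\<^sup>2 / 2)"
  proof (rule ftc)
    show "((\<lambda>\<tau>. q\<^sup>2 * of_real (\<tau> - \<tau>\<^sup>2 / 2)) has_vector_derivative q\<^sup>2 * of_real (1 - \<tau>)) (at \<tau>)" for \<tau>
      by (rule real_ftc) (auto intro!: derivative_eq_intros)
  qed (use const t in auto)
  then have "integral {t..t + x} (\<lambda>t. of_real (1 - t) * p t ^ 2) = q\<^sup>2 * of_real (((t + x) - (t + x)\<^sup>2 / 2) - (t - t\<^sup>2 / 2))"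
    by (simp only: right_diff_distrib of_real_diff)
  moreover have "((t + x) - (t + x)\<^sup>2 / 2) - (t - t\<^sup>2 / 2) = d * x - x\<^sup>2 / 2"
    by (simp add: d_def power2_eq_square field_simps)
  ultimately show "lwI p (t + x) = lwI p t + q\<^sup>2 * of_real (d * x - x\<^sup>2 / 2)"
    unfolding lwI_def inc[OF pcp(1) t(2) order_refl] by (simp only:)
  have "integral {t..t + x} (\<lambda>t. of_real ((1 - t)\<^sup>2) * p t ^ 3) = q ^ 3 * of_real (- ((1 - (t + x)) ^ 3) / 3) - q ^ 3 * of_real (- ((1 - t) ^ 3) / 3)"
  proof (rule ftc)
    show "((\<lambda>\<tau>. q ^ 3 * of_real (- ((1 - \<tau>) ^ 3) / 3)) has_vector_derivative q ^ 3 * of_real ((1 - \<tau>)\<^sup>2)) (at \<tau>)" for \<tau>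
      by (rule real_ftc) (auto intro!: derivative_eq_intros)
  qed (use const t in auto)
  then have "integral {t..t + x} (\<lambda>t. of_real ((1 - t)\<^sup>2) * p t ^ 3) = q ^ 3 * of_real (- ((1 - (t + x)) ^ 3) / 3 - - ((1 - t) ^ 3) / 3)"
    by (simp only: right_diff_distrib of_real_diff)
  moreover have "- ((1 - (t + x)) ^ 3) / 3 - - ((1 - t) ^ 3) / 3 = d\<^sup>2 * x - d * x\<^sup>2 + x ^ 3 / 3"
    by (simp add: d_def power2_eq_square power3_eq_cube field_simps)
  ultimately show "lwV p (t + x) = lwV p t + q ^ 3 * of_real (d\<^sup>2 * x - d * x\<^sup>2 + x ^ 3 / 3)"
    unfolding lwV_def inc[OF pcp(3) t(2) order_refl] by (simp only:)
  let ?a = "\<lambda>\<tau>. of_real (d * (\<tau> - t) - (\<tau> - t)\<^sup>2 / 2) :: complex"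
  let ?b = "\<lambda>\<tau>. of_real (d * (\<tau> - t)\<^sup>2 / 2 - (\<tau> - t) ^ 3 / 3) :: complex"
  have "integral {t..t + x} (\<lambda>t. of_real (1 - t) * lw2 p t * p t ^ 2) =
     q\<^sup>2 * (lw2 p t * ?a (t + x) + 2 * q * ?b (t + x)) - q\<^sup>2 * (lw2 p t * ?a t + 2 * q * ?b t)"
  proof (rule ftc)
    show "((\<lambda>\<tau>. q\<^sup>2 * (lw2 p t * ?a \<tau> + 2 * q * ?b \<tau>)) has_vector_derivative
        of_real (1 - \<tau>) * (lw2 p t + 2 * q * of_real (\<tau> - t)) * q\<^sup>2) (at \<tau>)" for \<tau>
    proof -
      have a: "((\<lambda>\<tau>. d * (\<tau> - t) - (\<tau> - t)\<^sup>2 / 2) has_real_derivative d - (\<tau> - t)) (at \<tau>)"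
        by (auto intro!: derivative_eq_intros simp: field_simps)
      have b: "((\<lambda>\<tau>. d * (\<tau> - t)\<^sup>2 / 2 - (\<tau> - t) ^ 3 / 3) has_real_derivative d * (\<tau> - t) - (\<tau> - t)\<^sup>2) (at \<tau>)"
        by (auto intro!: derivative_eq_intros)
      have "((\<lambda>\<tau>. q\<^sup>2 * (lw2 p t * ?a \<tau> + 2 * q * ?b \<tau>)) has_vector_derivative
         q\<^sup>2 * (lw2 p t * of_real (d - (\<tau> - t)) + 2 * q * of_real (d * (\<tau> - t) - (\<tau> - t)\<^sup>2))) (at \<tau>)"
        by (intro has_vector_derivative_mult_right has_vector_derivative_add has_vector_derivative_of_real
            a b)
      moreover have "q\<^sup>2 * (lw2 p t * of_real (d - (\<tau> - t)) + 2 * q * of_real (d * (\<tau> - t) - (\<tau> - t)\<^sup>2)) =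
        of_real (1 - \<tau>) * (lw2 p t + 2 * q * of_real (\<tau> - t)) * q\<^sup>2"
        by (simp add: d_def power2_eq_square algebra_simps)
      ultimately show ?thesis by (simp only:)
    qed
    show "of_real (1 - \<tau>) * lw2 p \<tau> * p \<tau> ^ 2 = of_real (1 - \<tau>) * (lw2 p t + 2 * q * of_real (\<tau> - t)) * q\<^sup>2"
      if "t \<le> \<tau>" "\<tau> < t + x" for \<tau>
      using lw2'[of "\<tau> - t"] const[OF that] that by simp
  qed (use t in auto)
  then show "lwW p (t + x) = lwW p t + q\<^sup>2 * (lw2 p t * of_real (d * x - x\<^sup>2 / 2) + 2 * q * of_real (d * x\<^sup>2 / 2 - x ^ 3 / 3))"
    unfolding lwW_def inc[OF pcp(2) t(2) order_refl] by simp
qed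

text \<open>These exact increments are the common reference: a square-root step agrees with them to
  first order, a step of the explicit slit maps agrees exactly.\<close>

lemma lw34_const_step:
  fixes p :: "real \<Rightarrow> complex"
  assumes p: "pc p" and t: "0 \<le> t" "0 \<le> x" "t + x \<le> 1" and const: "\<And>\<tau>. t \<le> \<tau> \<Longrightarrow> \<tau> < t + x \<Longrightarrow> p \<tau> = q"
  defines "d \<equiv> complex_of_real (1 - t)" and "X \<equiv> complex_of_real x"
  shows "lw2 p (t + x) = lw2 p t + 2 * q * X"
    "lw3 p (t + x) = lw3 p t + 4 * q * X * lw2 p t - 2 * q\<^sup>2 * d * X + 5 * q\<^sup>2 * X\<^sup>2"
    "lw4 p (t + x) = lw4 p t + (2 * q * (lw2 p t)\<^sup>2 + 4 * q * lw3 p t - 6 * lw2 p t * q\<^sup>2 * d + 2 * q ^ 3 * d\<^sup>2) * X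
       + (15 * q\<^sup>2 * lw2 p t * X\<^sup>2 - 12 * q ^ 3 * d * X\<^sup>2 + 14 * q ^ 3 * X ^ 3)"
proof -
  note s = lw_const_step[OF p t const, simplified]
  show "lw2 p (t + x) = lw2 p t + 2 * q * X" using s(1) by (simp add: X_def)
  show "lw3 p (t + x) = lw3 p t + 4 * q * X * lw2 p t - 2 * q\<^sup>2 * d * X + 5 * q\<^sup>2 * X\<^sup>2"
    unfolding lw3_def s(1,2) by (simp add: X_def d_def power2_eq_square field_simps)
  show "lw4 p (t + x) = lw4 p t + (2 * q * (lw2 p t)\<^sup>2 + 4 * q * lw3 p t - 6 * lw2 p t * q\<^sup>2 * d + 2 * q ^ 3 * d\<^sup>2) * X
       + (15 * q\<^sup>2 * lw2 p t * X\<^sup>2 - 12 * q ^ 3 * d * X\<^sup>2 + 14 * q ^ 3 * X ^ 3)"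
    unfolding lw4_def lw3_def s by (simp add: X_def d_def power2_eq_square power3_eq_cube field_simps)
qed

section \<open>Coefficients of a square-root step compared with a Loewner step\<close>

lemma has_fps_taylor:
  assumes "f holomorphic_on ball 0 1"
  shows "f has_fps_expansion Abs_fps (taylor_coeff f)"
proof -
  have "Abs_fps (taylor_coeff f) = fps_expansion f 0"
    by (rule fps_ext) (simp add: taylor_coeff_def)
  then show ?thesis using has_fps_expansion_fps_expansion[OF open_ball _ assms] by simp
qed

lemma taylor_coeff_0: "taylor_coeff f 0 = f 0"
  by (simp add: taylor_coeff_def fps_expansion_def)

lemma taylor_coeff_1: "taylor_coeff f 1 = deriv f 0"
  by (simp add: taylor_coeff_def fps_expansion_def)

lemma fps_eq_of_eq_near_0:
  fixes f g :: "complex \<Rightarrow> complex"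
  assumes "f has_fps_expansion F" "g has_fps_expansion G" "\<And>z. norm z < 1 \<Longrightarrow> f z = g z"
  shows "F = G"
proof -
  have "eventually (\<lambda>z. z \<in> ball (0::complex) 1) (nhds 0)" by (rule eventually_nhds_in_open) auto
  then have "eventually (\<lambda>z. f z = g z) (nhds 0)" by eventually_elim (use assms in auto)
  then have "g has_fps_expansion F" using has_fps_expansion_cong[of f g F F] assms(1) by simp
  then show ?thesis using fps_expansion_unique_complex assms(2) by blast
qed

lemma koebe_step_coeffs:
  assumes g: "g holomorphic_on ball 0 1" "g 0 = 0" and h: "h holomorphic_on ball 0 1" "h 0 = 0"
    and eq: "\<And>z. norm z < 1 \<Longrightarrow> g z * (1 - of_real \<rho> * k * h z) = h z * (of_real \<rho> - k * h z)"
  shows "taylor_coeff g 1 = \<rho> * taylor_coeff h 1"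
    "taylor_coeff g 2 - \<rho> * k * (taylor_coeff g 1 * taylor_coeff h 1) = \<rho> * taylor_coeff h 2 - k * (taylor_coeff h 1)\<^sup>2"
    "taylor_coeff g 3 - \<rho> * k * (taylor_coeff g 1 * taylor_coeff h 2 + taylor_coeff g 2 * taylor_coeff h 1)
       = \<rho> * taylor_coeff h 3 - 2 * k * (taylor_coeff h 1 * taylor_coeff h 2)"
    "taylor_coeff g 4 - \<rho> * k * (taylor_coeff g 1 * taylor_coeff h 3 + taylor_coeff g 2 * taylor_coeff h 2 + taylor_coeff g 3 * taylor_coeff h 1)
       = \<rho> * taylor_coeff h 4 - k * (2 * taylor_coeff h 1 * taylor_coeff h 3 + (taylor_coeff h 2)\<^sup>2)"
proof -
  let ?G = "Abs_fps (taylor_coeff g)" and ?H = "Abs_fps (taylor_coeff h)"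
  have z: "taylor_coeff g 0 = 0" "taylor_coeff h 0 = 0" using g h by (simp_all add: taylor_coeff_0)
  have "?G * (1 - fps_const (of_real \<rho> * k) * ?H) = ?H * (fps_const (of_real \<rho>) - fps_const k * ?H)"
  proof (rule fps_eq_of_eq_near_0[OF _ _ eq])
    show "(\<lambda>z. g z * (1 - of_real \<rho> * k * h z)) has_fps_expansion ?G * (1 - fps_const (of_real \<rho> * k) * ?H)"
      by (intro fps_expansion_intros has_fps_taylor g h)
    show "(\<lambda>z. h z * (of_real \<rho> - k * h z)) has_fps_expansion ?H * (fps_const (of_real \<rho>) - fps_const k * ?H)"
      by (intro fps_expansion_intros has_fps_taylor g h)
  qed
  then have n: "fps_nth (?G * (1 - fps_const (of_real \<rho> * k) * ?H)) n = fps_nth (?H * (fps_const (of_real \<rho>) - fps_const k * ?H)) n" for n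
    by simp
  note e = fps_mult_nth eval_nat_numeral
  from n[of 1] show "taylor_coeff g 1 = \<rho> * taylor_coeff h 1" by (simp add: fps_mult_nth z)
  from n[of 2] show "taylor_coeff g 2 - \<rho> * k * (taylor_coeff g 1 * taylor_coeff h 1) = \<rho> * taylor_coeff h 2 - k * (taylor_coeff h 1)\<^sup>2"
    by (simp add: e z algebra_simps)
  from n[of 3] show "taylor_coeff g 3 - \<rho> * k * (taylor_coeff g 1 * taylor_coeff h 2 + taylor_coeff g 2 * taylor_coeff h 1)
       = \<rho> * taylor_coeff h 3 - 2 * k * (taylor_coeff h 1 * taylor_coeff h 2)"
    by (simp add: e z algebra_simps)
  from n[of 4] show "taylor_coeff g 4 - \<rho> * k * (taylor_coeff g 1 * taylor_coeff h 3 + taylor_coeff g 2 * taylor_coeff h 2 + taylor_coeff g 3 * taylor_coeff h 1)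
       = \<rho> * taylor_coeff h 4 - k * (2 * taylor_coeff h 1 * taylor_coeff h 3 + (taylor_coeff h 2)\<^sup>2)"
    by (simp add: e z algebra_simps)
qed

definition ncoeff :: "(complex \<Rightarrow> complex) \<Rightarrow> nat \<Rightarrow> complex" where
  "ncoeff g k = taylor_coeff g k / taylor_coeff g 1"

text \<open>Extracting \<open>1 - R^2\<close> displays the size of the step, about
  \<open>2 * l\<close> for \<open>R = 1 - l\<close>. The number \<open>- k\<close> takes the place
  of the driving value.\<close>

lemma koebe_step_ncoeffs:
  assumes g: "g holomorphic_on ball 0 1" "g 0 = 0" and h: "h holomorphic_on ball 0 1" "h 0 = 0"
    and eq: "\<And>z. norm z < 1 \<Longrightarrow> g z * (1 - of_real \<rho> * k * h z) = h z * (of_real \<rho> - k * h z)"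
    and nz: "taylor_coeff h 1 \<noteq> 0" "\<rho> \<noteq> 0"
  defines "d \<equiv> taylor_coeff h 1" and "R \<equiv> complex_of_real \<rho>"
  shows "ncoeff g 2 = ncoeff h 2 + (1 - R\<^sup>2) * (- k) * d / R"
    "ncoeff g 3 = ncoeff h 3 + (1 - R\<^sup>2) * (- k * d * 2 * ncoeff h 2 / R - (- k)\<^sup>2 * d\<^sup>2)"
    "ncoeff g 4 = ncoeff h 4 + (1 - R\<^sup>2) * (- k * d * (2 * ncoeff h 3 + (ncoeff h 2)\<^sup>2) / R - 3 * (- k)\<^sup>2 * d\<^sup>2 * ncoeff h 2 + R * (- k) ^ 3 * d ^ 3)"
proof -
  note c = koebe_step_coeffs[OF g h eq, folded R_def d_def]
  have R: "R \<noteq> 0" "d \<noteq> 0" using nz by (auto simp: R_def d_def)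
  define \<alpha>2 \<alpha>3 \<alpha>4 where "\<alpha>2 = ncoeff h 2" and "\<alpha>3 = ncoeff h 3" and "\<alpha>4 = ncoeff h 4"
  have h2: "taylor_coeff h 2 = d * \<alpha>2" and h3: "taylor_coeff h 3 = d * \<alpha>3" and h4: "taylor_coeff h 4 = d * \<alpha>4"
    using R by (simp_all add: \<alpha>2_def \<alpha>3_def \<alpha>4_def ncoeff_def d_def)
  have g1: "taylor_coeff g 1 = R * d" using c(1) by simp
  have g2: "taylor_coeff g 2 = R * d * \<alpha>2 - (1 - R\<^sup>2) * k * d\<^sup>2"
    using c(2) unfolding g1 h2 by (simp add: power2_eq_square algebra_simps)
  have g3: "taylor_coeff g 3 = R * d * \<alpha>3 - (1 - R\<^sup>2) * (2 * k * d\<^sup>2 * \<alpha>2 + R * k\<^sup>2 * d ^ 3)"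
    using c(3) unfolding g1 g2 h2 h3 by (simp add: power2_eq_square power3_eq_cube algebra_simps)
  have g4: "taylor_coeff g 4 = R * d * \<alpha>4 - (1 - R\<^sup>2) * (k * d\<^sup>2 * (2 * \<alpha>3 + \<alpha>2\<^sup>2) + 3 * R * k\<^sup>2 * d ^ 3 * \<alpha>2 + R\<^sup>2 * k ^ 3 * d ^ 4)"
    using c(4) unfolding g1 g2 g3 h2 h3 h4 by (simp add: eval_nat_numeral algebra_simps)
  define S where "S = inverse R"
  have RS: "R * S = 1" using R by (simp add: S_def)
  have div: "x / (R * d) = y" if "x = y * (R * d)" for x y using that R by simp
  have dR: "x / R = x * S" for x by (simp add: S_def divide_inverse)
  show "ncoeff g 2 = ncoeff h 2 + (1 - R\<^sup>2) * (- k) * d / R"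
    unfolding ncoeff_def[of g] g1 g2 \<alpha>2_def[symmetric] dR by (rule div) (use RS in algebra)
  show "ncoeff g 3 = ncoeff h 3 + (1 - R\<^sup>2) * (- k * d * 2 * ncoeff h 2 / R - (- k)\<^sup>2 * d\<^sup>2)"
    unfolding ncoeff_def[of g] g1 g3 \<alpha>2_def[symmetric] \<alpha>3_def[symmetric] dR by (rule div) (use RS in algebra)
  show "ncoeff g 4 = ncoeff h 4 + (1 - R\<^sup>2) * (- k * d * (2 * ncoeff h 3 + (ncoeff h 2)\<^sup>2) / R - 3 * (- k)\<^sup>2 * d\<^sup>2 * ncoeff h 2 + R * (- k) ^ 3 * d ^ 3)"
    unfolding ncoeff_def[of g] g1 g4 \<alpha>2_def[symmetric] \<alpha>3_def[symmetric] \<alpha>4_def[symmetric] dR by (rule div) (use RS in algebra)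
qed

lemma norm_sum_le2: "norm a \<le> x \<Longrightarrow> norm b \<le> y \<Longrightarrow> norm (a + b) \<le> x + (y::real)"
  using norm_triangle_ineq[of a b] by linarith

text \<open>A square-root step against a Loewner step of length \<open>x = l * d\<close> started
  from nearby coefficients: old errors are propagated with factors of order \<open>x\<close>, and
  the new error is of order \<open>x * l\<close>. The constants are 18 = 12 + 1 + 5 and 114 = 46 + 9
  + 3 + 30 + 12 + 14.\<close>

lemma step_error:
  fixes A2 A3 A4 a2 a3 a4 q :: complex
  assumes q: "norm q = 1" and d: "0 < d" "d \<le> 1" and l: "0 \<le> l" "l \<le> 1/2"
    and A: "norm A2 \<le> 2" "norm A3 \<le> 6"
    and e: "norm (a2 - A2) \<le> e2" "norm (a3 - A3) \<le> e3" "norm (a4 - A4) \<le> e4" "e2 \<le> 1" "e3 \<le> 1"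
  defines "R \<equiv> complex_of_real (1 - l)" and "x \<equiv> l * d" and "D \<equiv> complex_of_real d" and "X \<equiv> complex_of_real (l * d)"
  shows "norm (a2 + (1 - R\<^sup>2) * q * D / R - (A2 + 2 * q * X)) \<le> e2 + 2 * x * l"
    "norm (a3 + (1 - R\<^sup>2) * (q * D * 2 * a2 / R - q\<^sup>2 * D\<^sup>2) - (A3 + 4 * q * X * A2 - 2 * q\<^sup>2 * D * X + 5 * q\<^sup>2 * X\<^sup>2))
       \<le> e3 + 4 * x * e2 + 18 * x * l"
    "norm (a4 + (1 - R\<^sup>2) * (q * D * (2 * a3 + a2\<^sup>2) / R - 3 * q\<^sup>2 * D\<^sup>2 * a2 + R * q ^ 3 * D ^ 3)
       - (A4 + (2 * q * A2\<^sup>2 + 4 * q * A3 - 6 * A2 * q\<^sup>2 * D + 2 * q ^ 3 * D\<^sup>2) * X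
       + (15 * q\<^sup>2 * A2 * X\<^sup>2 - 12 * q ^ 3 * D * X\<^sup>2 + 14 * q ^ 3 * X ^ 3)))
       \<le> e4 + 4 * x * e3 + 16 * x * e2 + 114 * x * l"
proof -
  define \<mu> where "\<mu> = l / (1 - l)"
  define M where "M = complex_of_real \<mu>"
  define L where "L = complex_of_real l"
  have R: "R = 1 - L" by (simp add: R_def L_def)
  have R0: "R \<noteq> 0" using l unfolding R_def of_real_eq_0_iff by simp
  have XL: "X = L * D" by (simp add: X_def L_def D_def)
  have MR: "M * R = L" using l unfolding M_def R_def L_def of_real_mult[symmetric] by (simp add: \<mu>_def)
  have mu: "0 \<le> \<mu>" "\<mu> \<le> 2 * l" using l mult_left_mono[of "2 * l" 1 l] by (auto simp: \<mu>_def field_simps)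
  have x: "0 \<le> x" "x \<le> l" using l d by (auto simp: x_def mult_left_le)
  have nX: "norm X = x" and nD: "norm D = d" and nM: "norm M = \<mu>" and nL: "norm L = l"
    using l d mu by (auto simp: X_def D_def M_def L_def x_def norm_mult)
  \<comment> \<open>The Loewner increment corresponds to \<open>2 * L\<close>; \<open>M\<close>, of
    the order of \<open>l\<close>, carries the deviation.\<close>
  have key: "(1 - R\<^sup>2) / R = L * (2 + M)"
  proof -
    have "1 - R\<^sup>2 = L * (2 * R + L)" unfolding R by (simp add: power2_eq_square algebra_simps)
    also have "\<dots> = L * (2 + M) * R" by (simp add: MR algebra_simps flip: MR)
    finally show ?thesis using R0 by simp
  qed
  have e0: "0 \<le> e2" "0 \<le> e3" using e(1,2) norm_ge_zero order_trans by blast+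
  have na2: "norm a2 \<le> 3" using norm_triangle_ineq[of A2 "a2 - A2"] A e by simp
  have na3: "norm a3 \<le> 7" using norm_triangle_ineq[of A3 "a3 - A3"] A e by simp
  have xm: "x * \<mu> \<le> 2 * (x * l)" using mult_left_mono[OF mu(2) x(1)] by simp
  have xx: "x * x \<le> x * l" using mult_left_mono[OF x(2) x(1)] by simp
  have xl0: "0 \<le> x * l" using x l by simp
  have "a2 + (1 - R\<^sup>2) * q * D / R - (A2 + 2 * q * X) = (a2 - A2) + q * X * M"
  proof -
    have "(1 - R\<^sup>2) * q * D / R = (1 - R\<^sup>2) / R * q * D" by simp
    then show ?thesis unfolding key XL by (simp add: algebra_simps)
  qed
  moreover have "norm (q * X * M) \<le> 2 * x * l" using xm by (simp add: norm_mult q nX nM)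
  ultimately show "norm (a2 + (1 - R\<^sup>2) * q * D / R - (A2 + 2 * q * X)) \<le> e2 + 2 * x * l"
    using norm_sum_le2[OF e(1)] by metis
  have one: "1 - R\<^sup>2 = L * (2 - L)" unfolding R by (simp add: power2_eq_square algebra_simps)
  have gen: "(1 - R\<^sup>2) * (u / R - w) = L * (2 + M) * u - L * (2 - L) * w" for u w
  proof -
    have "(1 - R\<^sup>2) * (u / R - w) = (1 - R\<^sup>2) / R * u - (1 - R\<^sup>2) * w" by (simp add: right_diff_distrib)
    also have "\<dots> = L * (2 + M) * u - (1 - R\<^sup>2) * w" unfolding key ..
    also have "\<dots> = L * (2 + M) * u - L * (2 - L) * w" unfolding one ..
    finally show ?thesis .
  qed
  have n0: "a3 + (1 - R\<^sup>2) * (q * D * 2 * a2 / R - q\<^sup>2 * D\<^sup>2) - (A3 + 4 * q * X * A2 - 2 * q\<^sup>2 * D * X + 5 * q\<^sup>2 * X\<^sup>2)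
     = (a3 - A3) + 4 * q * X * (a2 - A2) + (2 * q * X * M * a2 + L * X * D * q\<^sup>2 + (- 5 * q\<^sup>2 * X\<^sup>2))"
    unfolding gen XL by (simp add: power2_eq_square algebra_simps)
  have n1: "norm (4 * q * X * (a2 - A2)) \<le> 4 * x * e2"
    using mult_left_mono[OF e(1) x(1)] by (simp add: norm_mult q nX)
  have n2: "norm (2 * q * X * M * a2) \<le> 12 * (x * l)"
  proof -
    have "x * \<mu> * norm a2 \<le> 2 * (x * l) * 3" using mult_mono[OF xm na2] xl0 by simp
    then show ?thesis by (simp add: norm_mult q nX nM mult_ac)
  qed
  have n3: "norm (L * X * D * q\<^sup>2) \<le> x * l"
    using mult_left_mono[OF d(2) xl0] d by (simp add: norm_mult norm_power q nX nL nD mult_ac)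
  have n4: "norm (- 5 * q\<^sup>2 * X\<^sup>2) \<le> 5 * (x * l)"
    using xx by (simp add: norm_mult norm_power q nX power2_eq_square)
  show "norm (a3 + (1 - R\<^sup>2) * (q * D * 2 * a2 / R - q\<^sup>2 * D\<^sup>2) - (A3 + 4 * q * X * A2 - 2 * q\<^sup>2 * D * X + 5 * q\<^sup>2 * X\<^sup>2))
       \<le> e3 + 4 * x * e2 + 18 * x * l"
    unfolding n0 by (rule order_trans[OF norm_sum_le2[OF norm_sum_le2[OF e(2) n1] norm_sum_le2[OF norm_sum_le2[OF n2 n3] n4]]]) (simp add: algebra_simps)
  have m0: "a4 + (1 - R\<^sup>2) * (q * D * (2 * a3 + a2\<^sup>2) / R - 3 * q\<^sup>2 * D\<^sup>2 * a2 + R * q ^ 3 * D ^ 3)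
       - (A4 + (2 * q * A2\<^sup>2 + 4 * q * A3 - 6 * A2 * q\<^sup>2 * D + 2 * q ^ 3 * D\<^sup>2) * X
       + (15 * q\<^sup>2 * A2 * X\<^sup>2 - 12 * q ^ 3 * D * X\<^sup>2 + 14 * q ^ 3 * X ^ 3))
     = (a4 - A4) + 4 * q * X * (a3 - A3) + (2 * q * X * ((a2 - A2) * (a2 + A2)) + (- 6 * q\<^sup>2 * D * X * (a2 - A2)))
       + (((q * X * M * (2 * a3 + a2\<^sup>2) + 3 * L * X * D * q\<^sup>2 * a2) + (- ((3 - L) * L * X * D\<^sup>2 * q ^ 3)))
       + ((- 15 * q\<^sup>2 * A2 * X\<^sup>2 + 12 * q ^ 3 * D * X\<^sup>2) + (- 14 * q ^ 3 * X ^ 3)))"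
  proof -
    have "(1 - R\<^sup>2) * (q * D * (2 * a3 + a2\<^sup>2) / R - 3 * q\<^sup>2 * D\<^sup>2 * a2 + R * q ^ 3 * D ^ 3)
      = (1 - R\<^sup>2) * (q * D * (2 * a3 + a2\<^sup>2) / R - (3 * q\<^sup>2 * D\<^sup>2 * a2 - R * q ^ 3 * D ^ 3))" by simp
    also have "\<dots> = L * (2 + M) * (q * D * (2 * a3 + a2\<^sup>2)) - L * (2 - L) * (3 * q\<^sup>2 * D\<^sup>2 * a2 - R * q ^ 3 * D ^ 3)"
      by (rule gen)
    finally show ?thesis unfolding XL by (simp only:) (simp add: R power2_eq_square power3_eq_cube algebra_simps)
  qed
  have m1: "norm (4 * q * X * (a3 - A3)) \<le> 4 * x * e3"
    using mult_left_mono[OF e(2) x(1)] by (simp add: norm_mult q nX)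
  have m2: "norm (2 * q * X * ((a2 - A2) * (a2 + A2))) \<le> 10 * x * e2"
  proof -
    have "norm (a2 + A2) \<le> 5" using norm_triangle_ineq[of a2 A2] na2 A by linarith
    then have "norm (a2 - A2) * norm (a2 + A2) \<le> e2 * 5" using e(1) e0 by (intro mult_mono) auto
    from mult_left_mono[OF this x(1)] show ?thesis unfolding norm_mult q nX by (simp add: mult_ac)
  qed
  have m3: "norm (- 6 * q\<^sup>2 * D * X * (a2 - A2)) \<le> 6 * x * e2"
  proof -
    have "d * (x * norm (a2 - A2)) \<le> 1 * (x * e2)" using d x e e0 by (intro mult_mono mult_left_mono mult_nonneg_nonneg) auto
    then show ?thesis by (simp add: norm_mult norm_power q nX nD)
  qed
  have m4: "norm (q * X * M * (2 * a3 + a2\<^sup>2)) \<le> 46 * (x * l)"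
  proof -
    have "norm (a2\<^sup>2) \<le> 3\<^sup>2" unfolding norm_power using na2 by (intro power_mono) auto
    then have "norm (2 * a3 + a2\<^sup>2) \<le> 23" using norm_triangle_ineq[of "2 * a3" "a2\<^sup>2"] na3 by (simp add: norm_mult)
    from mult_mono[OF xm this] have "x * \<mu> * norm (2 * a3 + a2\<^sup>2) \<le> 2 * (x * l) * 23" using xl0 by simp
    then show ?thesis by (simp add: norm_mult q nX nM mult_ac)
  qed
  have m5: "norm (3 * L * X * D * q\<^sup>2 * a2) \<le> 9 * (x * l)"
  proof -
    have "(x * l) * (d * norm a2) \<le> (x * l) * (1 * 3)" using d na2 xl0 by (intro mult_left_mono mult_mono) auto
    then show ?thesis by (simp add: norm_mult norm_power q nX nL nD mult_ac)
  qed
  have m6: "norm (- ((3 - L) * L * X * D\<^sup>2 * q ^ 3)) \<le> 3 * (x * l)"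
  proof -
    have "3 - L = of_real (3 - l)" by (simp add: L_def)
    then have "norm (3 - L) = 3 - l" using l by (simp only: norm_of_real)
    then have "norm (3 - L) \<le> 3" using l by simp
    moreover have "d\<^sup>2 \<le> 1" using d by (simp add: power_le_one)
    ultimately have "norm (3 - L) * d\<^sup>2 * (x * l) \<le> 3 * 1 * (x * l)" using xl0 by (intro mult_right_mono mult_mono) auto
    then show ?thesis unfolding norm_minus_cancel by (simp add: norm_mult norm_power q nX nL nD mult_ac)
  qed
  have m7: "norm (- 15 * q\<^sup>2 * A2 * X\<^sup>2) \<le> 30 * (x * l)"
  proof -
    have "norm A2 * (x * x) \<le> 2 * (x * l)" using A xx x by (intro mult_mono) auto
    then show ?thesis by (simp add: norm_mult norm_power q nX power2_eq_square mult_ac)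
  qed
  have m8: "norm (12 * q ^ 3 * D * X\<^sup>2) \<le> 12 * (x * l)"
  proof -
    have "d * (x * x) \<le> 1 * (x * l)" using d xx x by (intro mult_mono) auto
    then show ?thesis by (simp add: norm_mult norm_power q nX nD power2_eq_square mult_ac)
  qed
  have m9: "norm (- 14 * q ^ 3 * X ^ 3) \<le> 14 * (x * l)"
  proof -
    have "x * (x * x) \<le> 1 * (x * l)" using x l xx by (intro mult_mono) auto
    then show ?thesis by (simp add: norm_mult norm_power q nX power3_eq_cube mult_ac)
  qed
  show "norm (a4 + (1 - R\<^sup>2) * (q * D * (2 * a3 + a2\<^sup>2) / R - 3 * q\<^sup>2 * D\<^sup>2 * a2 + R * q ^ 3 * D ^ 3)
       - (A4 + (2 * q * A2\<^sup>2 + 4 * q * A3 - 6 * A2 * q\<^sup>2 * D + 2 * q ^ 3 * D\<^sup>2) * X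
       + (15 * q\<^sup>2 * A2 * X\<^sup>2 - 12 * q ^ 3 * D * X\<^sup>2 + 14 * q ^ 3 * X ^ 3)))
       \<le> e4 + 4 * x * e3 + 16 * x * e2 + 114 * x * l"
    unfolding m0 by (rule order_trans[OF norm_sum_le2[OF norm_sum_le2[OF norm_sum_le2[OF e(3) m1] norm_sum_le2[OF m2 m3]] norm_sum_le2[OF norm_sum_le2[OF norm_sum_le2[OF m4 m5] m6] norm_sum_le2[OF norm_sum_le2[OF m7 m8] m9]]]]) (simp add: algebra_simps)
qed

text \<open>Write \<open>g z = z * \<phi> z\<close>. Schwarz-Pick confines \<open>\<phi>\<close> on
  the disk of radius 1/2 to distance \<open>1 - d^2\<close> from its value \<open>d\<close> at 0,
  and Cauchy's inequality there costs \<open>2 ^ n\<close>. So an inner radius near 1 makes the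
  higher coefficients small, which starts the chain.\<close>

lemma schwarz_pick_coeffs:
  assumes g: "disk_univalent g" and d: "taylor_coeff g 1 = of_real d" "0 < d" and n: "1 \<le> n"
  shows "norm (taylor_coeff g (Suc n)) \<le> 2 ^ n * (1 - d\<^sup>2)" "d \<le> 1"
proof -
  note gD = disk_univalentD[OF g]
  have dg: "deriv g 0 = of_real d" using d by (simp add: taylor_coeff_1[symmetric])
  note sl = Schwarz_Lemma[OF gD(1,3,4)]
  show d1: "d \<le> 1" using sl(2)[of 0] dg d by simp
  obtain \<phi> where phi: "\<phi> holomorphic_on ball 0 1" "\<And>z. norm z < 1 \<Longrightarrow> g z = z * \<phi> z" "deriv g 0 = \<phi> 0"
    using Schwarz3[OF gD(1,3)] by metis
  have "Abs_fps (taylor_coeff g) = fps_X * Abs_fps (taylor_coeff \<phi>)"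
    by (rule fps_eq_of_eq_near_0[OF has_fps_taylor[OF gD(1)] _ phi(2)])
      (intro fps_expansion_intros has_fps_taylor phi)
  then have "fps_nth (Abs_fps (taylor_coeff g)) (Suc n) = fps_nth (fps_X * Abs_fps (taylor_coeff \<phi>)) (Suc n)" by simp
  then have tc: "taylor_coeff g (Suc n) = taylor_coeff \<phi> n" by simp
  have bound: "norm (\<phi> z - of_real d) \<le> 1 - d\<^sup>2" if z: "norm z \<le> 1/2" for z
  \<comment> \<open>In the case of equality in Schwarz' lemma \<open>g\<close> is a rotation and
    \<open>\<phi>\<close> is constant; in the other case \<open>\<phi>\<close> maps into the open
    disk.\<close>
  proof (cases "\<exists>z. norm z < 1 \<and> z \<noteq> 0 \<and> norm (g z) = norm z")
    case True
    then obtain \<alpha> where al: "\<And>z. norm z < 1 \<Longrightarrow> g z = \<alpha> * z" "norm \<alpha> = 1"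
      using sl(3)[of 0] by auto
    have "\<phi> z = \<alpha>" if "norm z < 1" "z \<noteq> 0" for z using al(1)[OF that(1)] phi(2)[OF that(1)] that by simp
    moreover have "deriv g 0 = \<alpha>"
    proof -
      have "((\<lambda>z. \<alpha> * z) has_field_derivative \<alpha>) (at 0)" by (auto intro!: derivative_eq_intros)
      then have "(g has_field_derivative \<alpha>) (at 0)"
        by (rule has_field_derivative_transform_within_open[of _ _ _ "ball 0 1"]) (use al in auto)
      then show ?thesis by (rule DERIV_imp_deriv)
    qed
    ultimately have "\<phi> z = of_real d" using phi(3) dg z by (cases "z = 0") auto
    moreover have "d\<^sup>2 \<le> 1" using d d1 by (simp add: power_le_one)
    ultimately show ?thesis by simp
  next
    case False
    have d_lt: "d < 1"
    proof (rule ccontr)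
      assume "\<not> d < 1"
      then have "norm (deriv g 0) = 1" using d1 dg by simp
      then obtain \<alpha> where "\<And>z. norm z < 1 \<Longrightarrow> g z = \<alpha> * z" "norm \<alpha> = 1" using sl(3)[of 0] by auto
      then have "norm (g (1/2)) = norm (1/2 :: complex)" by (simp add: norm_divide norm_mult)
      moreover have "norm (1/2 :: complex) < 1" "(1/2 :: complex) \<noteq> 0" by (simp_all add: norm_divide)
      ultimately show False using False by blast
    qed
    have phin: "norm (\<phi> z) < 1" if "norm z < 1" for z
    proof (cases "z = 0")
      case True then show ?thesis using phi(3) dg d d_lt by (metis norm_of_real abs_of_pos)
    next
      case zn: False
      have "norm (g z) \<le> norm z" by (rule sl(1)[OF _ that])
      then have "norm (g z) < norm z" using False that zn by (meson order_le_less)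
      then show ?thesis using phi(2)[OF that] zn by (simp add: norm_mult)
    qed
    define \<psi> where "\<psi> z = (of_real d - \<phi> z) / (1 - of_real d * \<phi> z)" for z
    have nz: "1 - of_real d * \<phi> z \<noteq> 0" "norm (\<psi> z) < 1" if "norm z < 1" for z
      using blaschke_norm[OF d(2) d_lt phin[OF that]] by (auto simp: \<psi>_def)
    have psi: "\<psi> holomorphic_on ball 0 1" unfolding \<psi>_def by (intro holomorphic_intros phi) (use nz in auto)
    have "\<psi> 0 = 0" using phi(3) dg by (simp add: \<psi>_def)
    have z1: "norm z < 1" using z by simp
    have pz: "norm (\<psi> z) \<le> 1/2" using Schwarz_Lemma(1)[OF psi \<open>\<psi> 0 = 0\<close> nz(2) z1] z by simp
    have "(\<phi> z - of_real d) * (1 - of_real d * \<psi> z) = - \<psi> z * (1 - of_real d * of_real d)"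
      using nz(1)[OF z1] by (simp add: \<psi>_def field_simps)
    then have eq: "norm (\<phi> z - of_real d) * norm (1 - of_real d * \<psi> z) = norm (\<psi> z) * (1 - d\<^sup>2)"
    proof -
      have "norm (1 - of_real d * of_real d :: complex) = \<bar>1 - d\<^sup>2\<bar>"
        unfolding power2_eq_square by (metis norm_of_real of_real_1 of_real_diff of_real_mult)
      then have "norm (1 - of_real d * of_real d :: complex) = 1 - d\<^sup>2" using d d1 by (simp add: power_le_one)
      with \<open>(\<phi> z - of_real d) * _ = _\<close> show ?thesis by (metis norm_mult norm_minus_cancel)
    qed
    have "1/2 \<le> norm (1 - of_real d * \<psi> z)"
    proof -
      have "d * norm (\<psi> z) \<le> 1 * (1/2)" using d d1 pz by (intro mult_mono) auto
      then show ?thesis using norm_triangle_ineq2[of 1 "of_real d * \<psi> z"] d by (simp add: norm_mult)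
    qed
    then have "norm (\<phi> z - of_real d) * (1/2) \<le> norm (\<phi> z - of_real d) * norm (1 - of_real d * \<psi> z)"
      by (intro mult_left_mono) auto
    also have "\<dots> \<le> 1/2 * (1 - d\<^sup>2)" unfolding eq using pz d d1 by (intro mult_right_mono) (auto simp: power_le_one)
    finally show ?thesis by simp
  qed
  let ?f = "\<lambda>z. \<phi> z - of_real d"
  have fh: "?f holomorphic_on ball 0 1" by (intro holomorphic_intros phi)
  have "norm ((deriv ^^ n) ?f 0) \<le> fact n * (1 - d\<^sup>2) / (1/2) ^ n"
  proof (rule Cauchy_inequality)
    show "?f holomorphic_on ball 0 (1/2)" by (rule holomorphic_on_subset[OF fh]) auto
    show "continuous_on (cball 0 (1/2)) ?f"
      by (rule holomorphic_on_imp_continuous_on[OF holomorphic_on_subset[OF fh]]) auto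
    show "norm (\<phi> x - of_real d) \<le> 1 - d\<^sup>2" if "norm (0 - x) = 1/2" for x
      using bound[of x] that by simp
  qed auto
  moreover have "taylor_coeff ?f n = taylor_coeff \<phi> n"
  proof -
    have "Abs_fps (taylor_coeff ?f) = Abs_fps (taylor_coeff \<phi>) - fps_const (of_real d)"
      by (rule fps_eq_of_eq_near_0[OF has_fps_taylor[OF fh] _ refl])
        (intro fps_expansion_intros has_fps_taylor phi)
    then have "fps_nth (Abs_fps (taylor_coeff ?f)) n = fps_nth (Abs_fps (taylor_coeff \<phi>) - fps_const (of_real d)) n" by simp
    then show ?thesis using n by simp
  qed
  ultimately show "norm (taylor_coeff g (Suc n)) \<le> 2 ^ n * (1 - d\<^sup>2)"
    unfolding tc by (simp add: taylor_coeff_def fps_expansion_def norm_divide field_simps power_divide)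
qed

text \<open>The coefficients at time \<open>t\<close> only see the control before \<open>t\<close>,
  so appending an arc leaves the earlier ones unchanged.\<close>

lemma lw_cong:
  assumes eq: "\<And>\<tau>. 0 \<le> \<tau> \<Longrightarrow> \<tau> < t \<Longrightarrow> p \<tau> = q \<tau>" and t: "0 \<le> t"
  shows "lw2 p t = lw2 q t" "lw3 p t = lw3 q t" "lw4 p t = lw4 q t"
proof -
  have pe: "prim f \<tau> = prim g \<tau>" if "\<And>\<tau>. 0 \<le> \<tau> \<Longrightarrow> \<tau> < t \<Longrightarrow> f \<tau> = g \<tau>" "\<tau> \<le> t" for f g :: "real \<Rightarrow> complex" and \<tau>
    unfolding prim_def by (rule integral_spike[of "{t}"]) (use that in auto)
  have 2: "lw2 p \<tau> = lw2 q \<tau>" if "\<tau> \<le> t" for \<tau> unfolding lw2_def using pe[OF eq that] by simp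
  have I: "lwI p t = lwI q t" unfolding lwI_def by (rule pe) (use eq in auto)
  have W: "lwW p t = lwW q t" unfolding lwW_def by (rule pe) (use eq 2 in auto)
  have V: "lwV p t = lwV q t" unfolding lwV_def by (rule pe) (use eq in auto)
  show "lw2 p t = lw2 q t" "lw3 p t = lw3 q t" "lw4 p t = lw4 q t"
    using 2[of t] I W V by (simp_all add: lw3_def lw4_def)
qed

section \<open>Bounds for the Loewner coefficients and their growth in time\<close>

lemma prim_lipschitz:
  fixes f :: "real \<Rightarrow> complex"
  assumes "pc f" "0 \<le> a" "a \<le> b" "b \<le> 1" "\<And>t. 0 \<le> t \<Longrightarrow> t \<le> 1 \<Longrightarrow> norm (f t) \<le> B"
  shows "norm (prim f b - prim f a) \<le> B * (b - a)"
proof -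
  have "norm (integral {a..b} f) \<le> integral {a..b} (\<lambda>t. B)"
    by (rule integral_norm_bound_integral) (use assms in \<open>auto intro: pc_integrable pc_const\<close>)
  also have "\<dots> = B * (b - a)" using assms(3) by simp
  finally show ?thesis unfolding prim_increment[OF assms(1-4)] .
qed

context
  fixes p :: "real \<Rightarrow> complex"
  assumes p: "pc p" "\<And>t. norm (p t) = 1"
begin

lemma lw2_lipschitz: "0 \<le> a \<Longrightarrow> a \<le> b \<Longrightarrow> b \<le> 1 \<Longrightarrow> norm (lw2 p b - lw2 p a) \<le> 2 * (b - a)"
proof -
  assume ab: "0 \<le> a" "a \<le> b" "b \<le> 1"
  have "norm (prim p b - prim p a) \<le> 1 * (b - a)" by (rule prim_lipschitz[OF p(1) ab]) (simp add: p)
  moreover have "lw2 p b - lw2 p a = 2 * (prim p b - prim p a)" by (simp add: lw2_def algebra_simps)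
  ultimately show "norm (lw2 p b - lw2 p a) \<le> 2 * (b - a)" by (simp only: norm_mult) simp
qed

lemma lw2_bound: "0 \<le> t \<Longrightarrow> t \<le> 1 \<Longrightarrow> norm (lw2 p t) \<le> 2 * t"
  using lw2_lipschitz[of 0 t] by (simp add: lw2_def)

lemma lwI_lipschitz: "0 \<le> a \<Longrightarrow> a \<le> b \<Longrightarrow> b \<le> 1 \<Longrightarrow> norm (lwI p b - lwI p a) \<le> 1 * (b - a)"
  unfolding lwI_def
proof (rule prim_lipschitz)
  show "norm (of_real (1 - t) * p t ^ 2) \<le> 1" if "0 \<le> t" "t \<le> 1" for t
    using that by (simp add: norm_mult norm_power p del: of_real_diff)
qed (auto intro!: pc_intros p)

lemma lwI_bound: "0 \<le> t \<Longrightarrow> t \<le> 1 \<Longrightarrow> norm (lwI p t) \<le> t"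
  using lwI_lipschitz[of 0 t] by (simp add: lwI_def)

lemma lwW_lipschitz: "0 \<le> a \<Longrightarrow> a \<le> b \<Longrightarrow> b \<le> 1 \<Longrightarrow> norm (lwW p b - lwW p a) \<le> 2 * (b - a)"
  unfolding lwW_def
proof (rule prim_lipschitz)
  show "norm (of_real (1 - t) * lw2 p t * p t ^ 2) \<le> 2" if "0 \<le> t" "t \<le> 1" for t
    using mult_mono[of "1 - t" 1 "norm (lw2 p t)" 2] lw2_bound[OF that] that
    by (simp add: norm_mult norm_power p del: of_real_diff)
qed (auto intro!: pc_intros pc_lw2 p)

lemma lwV_lipschitz: "0 \<le> a \<Longrightarrow> a \<le> b \<Longrightarrow> b \<le> 1 \<Longrightarrow> norm (lwV p b - lwV p a) \<le> 1 * (b - a)"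
  unfolding lwV_def
proof (rule prim_lipschitz)
  show "norm (of_real ((1 - t)\<^sup>2) * p t ^ 3) \<le> 1" if "0 \<le> t" "t \<le> 1" for t
    using that by (simp add: norm_mult norm_power p power_le_one del: of_real_diff of_real_power)
qed (auto intro!: pc_intros p)

lemma lw3_bound:
  assumes "0 \<le> t" "t \<le> 1"
  shows "norm (lw3 p t) \<le> 6 * t"
proof -
  have "(norm (lw2 p t))\<^sup>2 \<le> (2 * t)\<^sup>2" using lw2_bound[OF assms] by (intro power_mono) auto
  also have "\<dots> \<le> 4 * t" using mult_left_le[of t t] assms by (simp add: power2_eq_square)
  finally have "norm ((lw2 p t)\<^sup>2) \<le> 4 * t" by (simp add: norm_power)
  moreover have "norm (2 * lwI p t) \<le> 2 * t" using lwI_bound[OF assms] unfolding norm_mult by simp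
  ultimately show ?thesis unfolding lw3_def using norm_triangle_ineq4[of "(lw2 p t)\<^sup>2" "2 * lwI p t"] by linarith
qed

lemma lw4_lipschitz:
  assumes ab: "0 \<le> a" "a \<le> b" "b \<le> 1"
  shows "norm (lw4 p b - lw4 p a) \<le> 46 * (b - a)"
proof -
  define A B where "A = lw2 p a" and "B = lw2 p b"
  define \<delta> where "\<delta> = b - a"
  have AB: "norm A \<le> 2" "norm B \<le> 2" "norm (B - A) \<le> 2 * \<delta>"
    using lw2_bound[of a] lw2_bound[of b] lw2_lipschitz[OF ab] ab by (auto simp: A_def B_def \<delta>_def)
  have I: "norm (lwI p b) \<le> 1" "norm (lwI p b - lwI p a) \<le> \<delta>"
    using lwI_bound[of b] lwI_lipschitz[OF ab] ab by (auto simp: \<delta>_def)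
  have d: "0 \<le> \<delta>" using ab by (simp add: \<delta>_def)
  have eq: "lw4 p b - lw4 p a = (B - A) * (B\<^sup>2 + B * A + A\<^sup>2) + (- 4 * ((B - A) * lwI p b + A * (lwI p b - lwI p a)))
     + (- 2 * (lwW p b - lwW p a) + 2 * (lwV p b - lwV p a))"
    by (simp add: lw4_def A_def B_def power2_eq_square power3_eq_cube algebra_simps)
  have "norm (B\<^sup>2 + B * A + A\<^sup>2) \<le> 4 + 4 + 4"
  proof (intro norm_sum_le2)
    show "norm (B\<^sup>2) \<le> 4" "norm (A\<^sup>2) \<le> 4"
      using power_mono[OF AB(1), of 2] power_mono[OF AB(2), of 2] by (auto simp: norm_power)
    show "norm (B * A) \<le> 4" using mult_mono[OF AB(2) AB(1)] by (simp add: norm_mult)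
  qed
  then have 1: "norm ((B - A) * (B\<^sup>2 + B * A + A\<^sup>2)) \<le> 24 * \<delta>"
    using mult_mono[OF AB(3), of "norm (B\<^sup>2 + B * A + A\<^sup>2)" 12] d by (simp add: norm_mult)
  have "norm ((B - A) * lwI p b + A * (lwI p b - lwI p a)) \<le> 2 * \<delta> + 2 * \<delta>"
    using mult_mono[OF AB(3) I(1)] mult_mono[OF AB(1) I(2)] d by (intro norm_sum_le2) (auto simp: norm_mult)
  then have 2: "norm (- 4 * ((B - A) * lwI p b + A * (lwI p b - lwI p a))) \<le> 16 * \<delta>" unfolding norm_mult by simp
  have 3: "norm (- 2 * (lwW p b - lwW p a)) \<le> 4 * \<delta>" "norm (2 * (lwV p b - lwV p a)) \<le> 2 * \<delta>"
    using lwW_lipschitz[OF ab] lwV_lipschitz[OF ab] unfolding norm_mult \<delta>_def by simp_all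
  show ?thesis unfolding eq \<delta>_def[symmetric]
    using norm_sum_le2[OF norm_sum_le2[OF 1 2] norm_sum_le2[OF 3]] by simp
qed

lemma lw4_bound: "0 \<le> t \<Longrightarrow> t \<le> 1 \<Longrightarrow> norm (lw4 p t) \<le> 46 * t"
  using lw4_lipschitz[of 0 t] by (simp add: lw4_def lw2_def lwW_def lwV_def lwI_def)

end

text \<open>Each square-root step divides the inner radius by \<open>\<rho>\<close>; after at most
  \<open>n\<close> steps it exceeds \<open>r\<close>, where a constant control serves with an error
  of at most 78(1 - d), and this is below \<open>\<eta>\<close> by the choice of \<open>r\<close>.
  By \<open>step_error\<close> the error rates then reproduce themselves: 2, 30 = 4*3 + 18 and 286 =
  4*31 + 16*3 + 114.\<close>

lemma loewner_chain:
  assumes eta: "0 < \<eta>" "\<eta> \<le> 1/100"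
  defines "r \<equiv> 1 - \<eta> / 100"
  defines "\<rho> \<equiv> 2 * sqrt r / (1 + r)"
  shows "disk_univalent g \<Longrightarrow> taylor_coeff g 1 = of_real d \<Longrightarrow> 0 < d \<Longrightarrow> \<rho> ^ n \<le> d \<Longrightarrow>
    \<exists>v. pc v \<and> norm (ncoeff g 2 - lw2 (\<lambda>t. cis (v t)) (1 - d)) \<le> \<eta> * (1 + 2 * (1 - d))
      \<and> norm (ncoeff g 3 - lw3 (\<lambda>t. cis (v t)) (1 - d)) \<le> \<eta> * (1 + 30 * (1 - d))
      \<and> norm (ncoeff g 4 - lw4 (\<lambda>t. cis (v t)) (1 - d)) \<le> \<eta> * (1 + 286 * (1 - d))"
proof (induction n arbitrary: g d)
  have r: "1/2 \<le> r" "0 < r" "r < 1" using eta by (auto simp: r_def)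
  define l where "l = 1 - \<rho>"
  have l: "0 < l" "l \<le> \<eta>"
  proof -
    have s: "0 < sqrt r" "sqrt r < 1" "r \<le> sqrt r" "(sqrt r)\<^sup>2 = r" using r real_le_rsqrt[of r r]
      by (auto simp: power2_eq_square mult_left_le)
    have eq: "l = (1 - sqrt r)\<^sup>2 / (1 + r)"
      using r s(4) by (simp add: l_def \<rho>_def power2_diff field_simps)
    show "0 < l" unfolding eq using r s by (intro divide_pos_pos) auto
    have "l \<le> (1 - sqrt r)\<^sup>2 / 1" unfolding eq using r by (intro divide_left_mono) auto
    also have "\<dots> \<le> (1 - sqrt r) * 1" using s unfolding power2_eq_square div_by_1 by (intro mult_left_mono) auto
    also have "\<dots> \<le> 1 - r" using s by simp
    also have "\<dots> \<le> \<eta>" using eta by (simp add: r_def)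
    finally show "l \<le> \<eta>" .
  qed
  have rho: "0 < \<rho>" "\<rho> < 1" "\<rho> = 1 - l" using l eta by (auto simp: l_def)
  have base: "\<exists>v. pc v \<and> norm (ncoeff g 2 - lw2 (\<lambda>t. cis (v t)) (1 - d)) \<le> \<eta> * (1 + 2 * (1 - d))
      \<and> norm (ncoeff g 3 - lw3 (\<lambda>t. cis (v t)) (1 - d)) \<le> \<eta> * (1 + 30 * (1 - d))
      \<and> norm (ncoeff g 4 - lw4 (\<lambda>t. cis (v t)) (1 - d)) \<le> \<eta> * (1 + 286 * (1 - d))"
    if g: "disk_univalent g" "taylor_coeff g 1 = of_real d" "0 < d" "r \<le> d" for g d
  proof -
    have d1: "d \<le> 1" using schwarz_pick_coeffs(2)[OF g(1,2,3), of 1] by simp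
    define \<epsilon> where "\<epsilon> = 1 - d"
    have e: "0 \<le> \<epsilon>" "\<epsilon> \<le> \<eta> / 100" using d1 g(4) by (auto simp: \<epsilon>_def r_def)
    have nc: "norm (ncoeff g (Suc k)) \<le> 32 * \<epsilon>" if k: "1 \<le> k" "k \<le> 3" for k
    proof -
      have "norm (taylor_coeff g (Suc k)) \<le> 2 ^ k * (1 - d\<^sup>2)" by (rule schwarz_pick_coeffs(1)[OF g(1,2,3) k(1)])
      also have "\<dots> \<le> 2 ^ 3 * (2 * \<epsilon>)"
      proof (intro mult_mono power_increasing k)
        have "1 - d\<^sup>2 = (1 + d) * \<epsilon>" by (simp add: \<epsilon>_def power2_eq_square algebra_simps)
        also have "\<dots> \<le> 2 * \<epsilon>" using d1 e by (intro mult_right_mono) auto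
        finally show "1 - d\<^sup>2 \<le> 2 * \<epsilon>" .
        show "0 \<le> 1 - d\<^sup>2" using d1 g(3) by (simp add: power_le_one)
      qed auto
      also have "\<dots> \<le> 32 * \<epsilon> * d" using r g(4) e mult_left_mono[of "1/2" d "32 * \<epsilon>"] by simp
      finally show ?thesis using g(3) unfolding ncoeff_def g(2) norm_divide by (simp add: divide_le_eq)
    qed
    let ?p = "\<lambda>t. cis 0"
    have pp: "pc ?p" "\<And>t. norm (?p t) = 1" by (auto intro: pc_const)
    have t: "0 \<le> 1 - d" "1 - d \<le> 1" using d1 g(3) by auto
    have "norm (ncoeff g 2 - lw2 ?p (1 - d)) \<le> 32 * \<epsilon> + 2 * \<epsilon>" "norm (ncoeff g 3 - lw3 ?p (1 - d)) \<le> 32 * \<epsilon> + 6 * \<epsilon>"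
      "norm (ncoeff g 4 - lw4 ?p (1 - d)) \<le> 32 * \<epsilon> + 46 * \<epsilon>"
      using norm_triangle_ineq4[of "ncoeff g 2" "lw2 ?p (1 - d)"] norm_triangle_ineq4[of "ncoeff g 3" "lw3 ?p (1 - d)"]
        norm_triangle_ineq4[of "ncoeff g 4" "lw4 ?p (1 - d)"] lw2_bound[OF pp t] lw3_bound[OF pp t] lw4_bound[OF pp t]
        nc[of 1] nc[of 2] nc[of 3] by (auto simp: \<epsilon>_def eval_nat_numeral)
    moreover have "\<eta> \<le> \<eta> * (1 + 2 * (1 - d))" "\<eta> \<le> \<eta> * (1 + 30 * (1 - d))" "\<eta> \<le> \<eta> * (1 + 286 * (1 - d))"
      using eta t by auto
    ultimately show ?thesis using e by (intro exI[of _ "\<lambda>t. 0"] conjI pc_const) linarith+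
  qed
  {
    case 0
    show ?case by (rule base) (use 0 r in auto)
  next
    case (Suc n)
    show ?case
    proof (cases "r \<le> d")
      case True then show ?thesis using base Suc.prems by blast
    next
      case False
      have dg: "deriv g 0 = of_real d" using Suc.prems(2) by (simp add: taylor_coeff_1[symmetric])
      then have "norm (deriv g 0) < r" using False Suc.prems(3) by simp
      then obtain a where a: "norm a = r" "a \<notin> g ` ball 0 1" using omitted_point[OF Suc.prems(1) r(2,3)] by blast
      obtain h k where h: "disk_univalent h" "norm k = 1"
        "\<And>z. norm z < 1 \<Longrightarrow> g z * (1 - of_real \<rho> * k * h z) = h z * (of_real \<rho> - k * h z)"
        using koebe_step[OF Suc.prems(1) a(2,1) r(2,3)] unfolding \<rho>_def by metis
      note gD = disk_univalentD[OF Suc.prems(1)] and hD = disk_univalentD[OF h(1)]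
      define d1 where "d1 = d / \<rho>"
      have th: "taylor_coeff h 1 = of_real d1"
      proof -
        have "of_real d = of_real \<rho> * taylor_coeff h 1"
          using koebe_step_coeffs(1)[OF gD(1,3) hD(1,3) h(3)] Suc.prems(2) by simp
        then show ?thesis using rho(1) by (simp add: d1_def nonzero_eq_divide_eq mult.commute del: One_nat_def)
      qed
      have d1: "0 < d1" "\<rho> ^ n \<le> d1" "d = \<rho> * d1" using Suc.prems rho(1) by (auto simp: d1_def field_simps)
      have d1_le: "d1 \<le> 1" using schwarz_pick_coeffs(2)[OF h(1) th d1(1), of 1] by simp
      obtain v where v: "pc v" "norm (ncoeff h 2 - lw2 (\<lambda>t. cis (v t)) (1 - d1)) \<le> \<eta> * (1 + 2 * (1 - d1))"
        "norm (ncoeff h 3 - lw3 (\<lambda>t. cis (v t)) (1 - d1)) \<le> \<eta> * (1 + 30 * (1 - d1))"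
        "norm (ncoeff h 4 - lw4 (\<lambda>t. cis (v t)) (1 - d1)) \<le> \<eta> * (1 + 286 * (1 - d1))"
        using Suc.IH[OF h(1) th d1(1,2)] by blast
      define t1 where "t1 = 1 - d1"
      define x where "x = l * d1"
      have t1: "0 \<le> t1" "t1 \<le> 1" "0 \<le> x" "1 - d = t1 + x" "t1 + x \<le> 1"
        using d1 d1_le l Suc.prems(3) rho by (auto simp: t1_def x_def algebra_simps)
      \<comment> \<open>The map \<open>h\<close> belongs to the time \<open>t1 = 1 - d1\<close>;
        passing from \<open>h\<close> back to \<open>g\<close> is the arc of length \<open>x\<close>
        with driving value \<open>- k\<close>.\<close>
      define v' where "v' t = (if t < t1 then v t else Arg (- k))" for t
      have pcv': "pc v'" unfolding v'_def [abs_def] by (intro pc_if v pc_const)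
      define p where "p t = cis (v' t)" for t
      have pp: "pc p" "\<And>t. norm (p t) = 1" unfolding p_def [abs_def] by (auto intro: pc_cis pcv')
      have pk: "p \<tau> = - k" if "t1 \<le> \<tau>" "\<tau> < t1 + x" for \<tau>
      proof -
        have "k \<noteq> 0" using h(2) by auto
        then show ?thesis using that h(2) cis_Arg[of "- k"] by (simp add: p_def v'_def sgn_eq)
      qed
      have A: "lw2 p t1 = lw2 (\<lambda>t. cis (v t)) t1" "lw3 p t1 = lw3 (\<lambda>t. cis (v t)) t1" "lw4 p t1 = lw4 (\<lambda>t. cis (v t)) t1"
        using lw_cong[of t1 p "\<lambda>t. cis (v t)"] t1 by (auto simp: p_def v'_def)
      note st = lw34_const_step[OF pp(1) t1(1,3,5) pk, simplified triv_forall_equality, OF TrueI TrueI]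
      have e2: "\<eta> * (1 + 2 * t1) \<le> 3 * \<eta>" and e3: "\<eta> * (1 + 30 * t1) \<le> 31 * \<eta>"
        using t1 eta mult_left_mono[of t1 1 \<eta>] by (auto simp: algebra_simps)
      have ee: "\<eta> * (1 + 2 * t1) \<le> 1" "\<eta> * (1 + 30 * t1) \<le> 1" using e2 e3 eta by linarith+
      have b: "norm (lw2 p t1) \<le> 2" "norm (lw3 p t1) \<le> 6" using lw2_bound[OF pp t1(1,2)] lw3_bound[OF pp t1(1,2)] t1 by auto
      have nk: "norm (- k) = 1" using h by simp
      have l2: "0 \<le> l" "l \<le> 1/2" using l eta by auto
      note er = step_error[OF nk d1(1) d1_le l2 b v(2,3,4)[folded t1_def, folded A] ee, folded x_def]
      have nz: "taylor_coeff h 1 \<noteq> 0" "\<rho> \<noteq> 0" using th d1 rho by auto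
      note nc = koebe_step_ncoeffs[OF gD(1,3) hD(1,3) h(3) nz, simplified triv_forall_equality, OF TrueI, unfolded th]
      have t1': "complex_of_real d1 = of_real (1 - t1)" by (simp add: t1_def)
      have xl: "x * l \<le> x * \<eta>" using l t1 by (intro mult_left_mono) auto
      have "norm (ncoeff g 2 - lw2 p (1 - d)) \<le> \<eta> * (1 + 2 * t1) + 2 * x * l"
        using er(1) unfolding t1(4) nc st t1'[symmetric] rho(3) .
      also have "\<dots> \<le> \<eta> * (1 + 2 * (1 - d))" using xl unfolding t1(4) by (simp add: algebra_simps)
      finally have r2: "norm (ncoeff g 2 - lw2 p (1 - d)) \<le> \<eta> * (1 + 2 * (1 - d))" .
      have "norm (ncoeff g 3 - lw3 p (1 - d)) \<le> \<eta> * (1 + 30 * t1) + 4 * x * (\<eta> * (1 + 2 * t1)) + 18 * x * l"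
        using er(2) unfolding t1(4) nc st t1'[symmetric] rho(3) .
      also have "\<dots> \<le> \<eta> * (1 + 30 * (1 - d))"
        using xl mult_left_mono[OF e2 t1(3)] unfolding t1(4) by (simp add: algebra_simps)
      finally have r3: "norm (ncoeff g 3 - lw3 p (1 - d)) \<le> \<eta> * (1 + 30 * (1 - d))" .
      have "norm (ncoeff g 4 - lw4 p (1 - d)) \<le> \<eta> * (1 + 286 * t1) + 4 * x * (\<eta> * (1 + 30 * t1)) + 16 * x * (\<eta> * (1 + 2 * t1)) + 114 * x * l"
        using er(3) unfolding t1(4) nc st t1'[symmetric] rho(3) .
      also have "\<dots> \<le> \<eta> * (1 + 286 * (1 - d))"
        using xl mult_left_mono[OF e2 t1(3)] mult_left_mono[OF e3 t1(3)] unfolding t1(4) by (simp add: algebra_simps)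
      finally have r4: "norm (ncoeff g 4 - lw4 p (1 - d)) \<le> \<eta> * (1 + 286 * (1 - d))" .
      show ?thesis using r2 r3 r4 pcv' unfolding p_def [abs_def] by blast
    qed
  }
qed

text \<open>Scaling by a small \<open>d\<close> gives a self-map of the disk. The chain approximates
  it at time \<open>1 - d\<close>, and the Lipschitz bounds cover the remaining time; in total 287 e
  + 46 d, which stays below 1000 e.\<close>

lemma loewner_approx_bounded:
  assumes f: "f holomorphic_on ball 0 1" "inj_on f (ball 0 1)" "f 0 = 0" "deriv f 0 = 1"
    and bd: "\<And>z. norm z < 1 \<Longrightarrow> norm (f z) < M" and \<eta>: "\<eta> > 0"
  obtains v where "pc v" "norm (taylor_coeff f 2 - lw2 (\<lambda>t. cis (v t)) 1) \<le> \<eta>"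
    "norm (taylor_coeff f 4 - lw4 (\<lambda>t. cis (v t)) 1) \<le> \<eta>"
proof -
  define e where "e = min (\<eta> / 1000) (1/100)"
  have e: "0 < e" "e \<le> 1/100" "1000 * e \<le> \<eta>" using \<eta> by (auto simp: e_def)
  define N where "N = max M (1 / e)"
  have N: "0 < N" "M \<le> N" "1 / N \<le> e"
  proof -
    have "1 / e \<le> N" "0 < 1 / e" using e by (auto simp: N_def)
    then show "0 < N" by linarith
    with \<open>1 / e \<le> N\<close> show "1 / N \<le> e" using e by (simp add: field_simps)
  qed (simp add: N_def)
  define d where "d = 1 / N"
  have d: "0 < d" "d \<le> e" using N by (auto simp: d_def)
  define g where "g z = of_real d * f z" for z
  have dnz: "complex_of_real d \<noteq> 0" using d by simp
  have gu: "disk_univalent g"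
    unfolding disk_univalent_def
  proof (intro conjI)
    show "g holomorphic_on ball 0 1" unfolding g_def by (intro holomorphic_intros f)
    show "inj_on g (ball 0 1)" using f(2) dnz by (auto simp: inj_on_def g_def)
    show "g 0 = 0" by (simp add: g_def f)
    show "g ` ball 0 1 \<subseteq> ball 0 1"
    proof (clarsimp simp: g_def norm_mult)
      fix z :: complex assume "norm z < 1"
      then have "norm (f z) < N" using bd N by fastforce
      then show "\<bar>d\<bar> * norm (f z) < 1" using N d by (simp add: d_def field_simps)
    qed
  qed
  have tg: "taylor_coeff g k = of_real d * taylor_coeff f k" for k
  proof -
    have "Abs_fps (taylor_coeff g) = fps_const (of_real d) * Abs_fps (taylor_coeff f)"
      by (rule fps_eq_of_eq_near_0[OF has_fps_taylor[OF disk_univalentD(1)[OF gu]] _ g_def])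
        (intro fps_expansion_intros has_fps_taylor f)
    then have "fps_nth (Abs_fps (taylor_coeff g)) k = fps_nth (fps_const (of_real d) * Abs_fps (taylor_coeff f)) k" by simp
    then show ?thesis by simp
  qed
  have f1: "taylor_coeff f 1 = 1" using f by (simp add: taylor_coeff_1[symmetric] flip: f(4))
  have g1: "taylor_coeff g 1 = of_real d" using tg[of 1] f1 by simp
  have nc: "ncoeff g k = taylor_coeff f k" for k
    unfolding ncoeff_def g1 tg[of k] using dnz by simp
  define r where "r = 1 - e / 100"
  define \<rho> where "\<rho> = 2 * sqrt r / (1 + r)"
  have rr: "0 < r" "r < 1" using e by (auto simp: r_def)
  have rho: "0 < \<rho>" "\<rho> < 1"
  proof -
    have s: "0 < sqrt r" "sqrt r < 1" "(sqrt r)\<^sup>2 = r" using rr by auto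
    show "0 < \<rho>" using s rr by (simp add: \<rho>_def)
    have "0 < (1 - sqrt r)\<^sup>2" using s by simp
    also have "(1 - sqrt r)\<^sup>2 = 1 + r - 2 * sqrt r" using s(3) by (simp add: power2_diff)
    finally show "\<rho> < 1" using rr by (simp add: \<rho>_def field_simps)
  qed
  obtain n where n: "\<rho> ^ n < d" using real_arch_pow_inv[OF d(1) rho(2)] by blast
  obtain v where v: "pc v" "norm (ncoeff g 2 - lw2 (\<lambda>t. cis (v t)) (1 - d)) \<le> e * (1 + 2 * (1 - d))"
    "norm (ncoeff g 4 - lw4 (\<lambda>t. cis (v t)) (1 - d)) \<le> e * (1 + 286 * (1 - d))"
    using loewner_chain[OF e(1,2) gu g1 d(1) less_imp_le[OF n[unfolded \<rho>_def r_def]]] by blast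
  let ?p = "\<lambda>t. cis (v t)"
  have p: "pc ?p" "\<And>t. norm (?p t) = 1" by (auto intro: pc_cis v)
  have d1: "0 \<le> 1 - d" "1 - d \<le> 1" using d e by auto
  have "norm (taylor_coeff f 2 - lw2 ?p 1) \<le> e * (1 + 2 * (1 - d)) + 2 * d"
    using norm_triangle_ineq4[of "taylor_coeff f 2 - lw2 ?p (1 - d)" "lw2 ?p 1 - lw2 ?p (1 - d)"] v(2)
      lw2_lipschitz[OF p d1(1,2) order_refl] by (simp add: nc)
  also have "\<dots> \<le> e * 3 + 2 * d" using e d by (intro add_right_mono mult_left_mono) auto
  also have "\<dots> \<le> \<eta>" using e d by linarith
  finally have 1: "norm (taylor_coeff f 2 - lw2 ?p 1) \<le> \<eta>" .
  have "norm (taylor_coeff f 4 - lw4 ?p 1) \<le> e * (1 + 286 * (1 - d)) + 46 * d"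
    using norm_triangle_ineq4[of "taylor_coeff f 4 - lw4 ?p (1 - d)" "lw4 ?p 1 - lw4 ?p (1 - d)"] v(3)
      lw4_lipschitz[OF p d1(1,2) order_refl] by (simp add: nc)
  also have "\<dots> \<le> e * 287 + 46 * d" using e d by (intro add_right_mono mult_left_mono) auto
  also have "\<dots> \<le> \<eta>" using e d by linarith
  finally have 2: "norm (taylor_coeff f 4 - lw4 ?p 1) \<le> \<eta>" .
  show ?thesis using that[OF v(1) 1 2] .
qed

lemma taylor_coeff_scale:
  assumes "f holomorphic_on ball 0 1" "norm s \<le> 1"
  shows "taylor_coeff (\<lambda>z. f (s * z)) k = s ^ k * taylor_coeff f k"
proof -
  have "(\<lambda>z. f (s * z)) = f \<circ> (\<lambda>z. s * z)" by (simp add: o_def)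
  have "(\<lambda>z. s * z) has_fps_expansion fps_const s * fps_X" by (intro fps_expansion_intros)
  then have "(f \<circ> (\<lambda>z. s * z)) has_fps_expansion fps_compose (Abs_fps (taylor_coeff f)) (fps_const s * fps_X)"
    by (intro has_fps_expansion_compose has_fps_taylor assms) auto
  moreover have "fps_compose (Abs_fps (taylor_coeff f)) (fps_const s * fps_X) = Abs_fps (\<lambda>n. s ^ n * taylor_coeff f n)"
    by (simp add: fps_compose_linear)
  ultimately have 1: "(\<lambda>z. f (s * z)) has_fps_expansion Abs_fps (\<lambda>n. s ^ n * taylor_coeff f n)" by (simp add: o_def)
  have "fps_expansion (\<lambda>z. f (s * z)) 0 = Abs_fps (\<lambda>n. s ^ n * taylor_coeff f n)"
    by (rule fps_expansion_eqI[OF 1])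
  then show ?thesis by (simp add: taylor_coeff_def[of "\<lambda>z. f (s * z)"])
qed

text \<open>The dilation \<open>f (s * z) / s\<close> is bounded, and its coefficients differ from
  those of \<open>f\<close> by powers of \<open>s\<close>, which tend to 1.\<close>

lemma loewner_approx:
  assumes f: "f \<in> univalent_class" and \<eta>: "\<eta> > 0"
  obtains v where "pc v" "norm (taylor_coeff f 2 - lw2 (\<lambda>t. cis (v t)) 1) \<le> \<eta>"
    "norm (taylor_coeff f 4 - lw4 (\<lambda>t. cis (v t)) 1) \<le> \<eta>"
proof -
  have f': "f holomorphic_on ball 0 1" "inj_on f (ball 0 1)" "f 0 = 0" "deriv f 0 = 1"
    using f by (auto simp: univalent_class_def)
  have lim: "((\<lambda>s. norm (complex_of_real s ^ j * a - a)) \<longlongrightarrow> norm (of_real 1 ^ j * a - a)) (at_left 1)" for j and a :: complex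
    by (intro tendsto_intros)
  have "eventually (\<lambda>s. norm (complex_of_real s ^ 1 * taylor_coeff f 2 - taylor_coeff f 2) < \<eta> / 2) (at_left 1)"
    by (rule order_tendstoD(2)[OF lim]) (use \<eta> in simp)
  moreover have "eventually (\<lambda>s. norm (complex_of_real s ^ 3 * taylor_coeff f 4 - taylor_coeff f 4) < \<eta> / 2) (at_left 1)"
    by (rule order_tendstoD(2)[OF lim]) (use \<eta> in simp)
  moreover have "eventually (\<lambda>s. s \<in> {0<..<1}) (at_left (1::real))"
    by (rule eventually_at_leftI[of 0]) auto
  ultimately have "eventually (\<lambda>s. norm (complex_of_real s ^ 1 * taylor_coeff f 2 - taylor_coeff f 2) < \<eta> / 2 \<and>
     norm (complex_of_real s ^ 3 * taylor_coeff f 4 - taylor_coeff f 4) < \<eta> / 2 \<and> s \<in> {0<..<1}) (at_left (1::real))"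
    by eventually_elim auto
  moreover have "at_left (1::real) \<noteq> bot" by simp
  ultimately have "\<exists>s. norm (complex_of_real s ^ 1 * taylor_coeff f 2 - taylor_coeff f 2) < \<eta> / 2 \<and>
     norm (complex_of_real s ^ 3 * taylor_coeff f 4 - taylor_coeff f 4) < \<eta> / 2 \<and> s \<in> {0<..<1}"
    by (rule eventually_happens'[rotated])
  then obtain s where s: "norm (complex_of_real s ^ 1 * taylor_coeff f 2 - taylor_coeff f 2) < \<eta> / 2"
    "norm (complex_of_real s ^ 3 * taylor_coeff f 4 - taylor_coeff f 4) < \<eta> / 2" "0 < s" "s < 1"
    by auto
  define S where "S = complex_of_real s"
  have S: "norm S < 1" "S \<noteq> 0" "norm S = s" using s by (auto simp: S_def)
  define F where "F z = f (S * z) / S" for z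
  have in_ball: "norm (S * z) < 1" if "norm z < 1" for z
    using that S mult_strict_mono[of "norm S" 1 "norm z" 1] by (simp add: norm_mult)
  have "(f \<circ> (\<lambda>z. S * z)) holomorphic_on ball 0 1"
    by (rule holomorphic_on_compose_gen[OF _ f'(1)]) (use in_ball in \<open>auto intro!: holomorphic_intros\<close>)
  then have fS: "(\<lambda>z. f (S * z)) holomorphic_on ball 0 1" by (simp add: o_def)
  have Fh: "F holomorphic_on ball 0 1" unfolding F_def [abs_def] by (intro holomorphic_on_divide holomorphic_on_const, rule fS) (use S in simp)
  have tF: "taylor_coeff F k = S ^ k * taylor_coeff f k / S" for k
  proof -
    have "Abs_fps (taylor_coeff F) = fps_const (inverse S) * Abs_fps (taylor_coeff (\<lambda>z. f (S * z)))"
    proof (rule fps_eq_of_eq_near_0[OF has_fps_taylor[OF Fh]])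
      show "(\<lambda>z. inverse S * f (S * z)) has_fps_expansion fps_const (inverse S) * Abs_fps (taylor_coeff (\<lambda>z. f (S * z)))"
        by (intro fps_expansion_intros has_fps_taylor fS)
    qed (simp add: F_def divide_inverse mult.commute)
    then have "fps_nth (Abs_fps (taylor_coeff F)) k = fps_nth (fps_const (inverse S) * Abs_fps (taylor_coeff (\<lambda>z. f (S * z)))) k" by simp
    then show ?thesis using taylor_coeff_scale[OF f'(1), of S k] S by (simp add: divide_inverse mult.commute)
  qed
  have Finj: "inj_on F (ball 0 1)"
  proof (rule inj_onI)
    fix z w assume zw: "z \<in> ball 0 1" "w \<in> ball 0 1" "F z = F w"
    then have "f (S * z) = f (S * w)" using S by (simp add: F_def)
    then have "S * z = S * w" using f'(2) in_ball zw by (auto dest: inj_onD)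
    then show "z = w" using S by simp
  qed
  have F0: "F 0 = 0" by (simp add: F_def f')
  have F1: "deriv F 0 = 1" using tF[of 1] S taylor_coeff_1[of f] taylor_coeff_1[of F] f' by simp
  have "compact (f ` cball 0 s)"
    by (intro compact_continuous_image continuous_on_subset[OF holomorphic_on_imp_continuous_on[OF f'(1)]]) (use s in auto)
  then obtain B where B: "\<And>x. x \<in> f ` cball 0 s \<Longrightarrow> norm x \<le> B" using compact_imp_bounded bounded_iff by metis
  have Fbd: "norm (F z) < B / s + 1" if "norm z < 1" for z
  proof -
    have "S * z \<in> cball 0 s" using that S s by (simp add: norm_mult mult_left_le)
    then have "norm (f (S * z)) \<le> B" using B by auto
    then have "norm (F z) \<le> B / s" using s S by (simp add: F_def norm_divide divide_right_mono)
    then show ?thesis by simp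
  qed
  obtain v where v: "pc v" "norm (taylor_coeff F 2 - lw2 (\<lambda>t. cis (v t)) 1) \<le> \<eta> / 2"
    "norm (taylor_coeff F 4 - lw4 (\<lambda>t. cis (v t)) 1) \<le> \<eta> / 2"
    using loewner_approx_bounded[OF Fh Finj F0 F1 Fbd, of "\<eta> / 2"] \<eta> by auto
  have t2: "taylor_coeff F 2 = of_real s ^ 1 * taylor_coeff f 2" and t4: "taylor_coeff F 4 = of_real s ^ 3 * taylor_coeff f 4"
    using S unfolding tF S_def by (auto simp: eval_nat_numeral)
  show ?thesis
  proof (rule that[OF v(1)])
    show "norm (taylor_coeff f 2 - lw2 (\<lambda>t. cis (v t)) 1) \<le> \<eta>"
      using norm_triangle_ineq4[of "taylor_coeff F 2 - lw2 (\<lambda>t. cis (v t)) 1" "taylor_coeff F 2 - taylor_coeff f 2"] v(2) s(1)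
      unfolding t2 by simp
    show "norm (taylor_coeff f 4 - lw4 (\<lambda>t. cis (v t)) 1) \<le> \<eta>"
      using norm_triangle_ineq4[of "taylor_coeff F 4 - lw4 (\<lambda>t. cis (v t)) 1" "taylor_coeff F 4 - taylor_coeff f 4"] v(3) s(2)
      unfolding t4 by simp
  qed
qed

section \<open>Slit maps of piecewise constant controls\<close>

text \<open>The solution \<open>w\<close> in the disk of \<open>K(w) = r K(\<zeta>)\<close>.\<close>
definition pick :: "real \<Rightarrow> complex \<Rightarrow> complex" where
  "pick r \<zeta> = (csqrt (1 + 4 * of_real r * koebe \<zeta>) - 1) / (csqrt (1 + 4 * of_real r * koebe \<zeta>) + 1)"

lemma norm_less_1_ne: "norm (z::complex) < 1 \<Longrightarrow> 1 - z \<noteq> 0"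
  by auto

lemma Re_cayley_pos: "norm (z::complex) < 1 \<Longrightarrow> 0 < Re ((1 + z) / (1 - z))"
proof -
  assume z: "norm z < 1"
  have "Re ((1 + z) / (1 - z)) = (1 - (norm z)\<^sup>2) / (norm (1 - z))\<^sup>2"
    unfolding cmod_power2 by (simp add: Re_divide power2_eq_square algebra_simps)
  moreover have "0 < 1 - (norm z)\<^sup>2" using z by (simp add: abs_square_less_1)
  moreover have "0 < (norm (1 - z))\<^sup>2" using norm_less_1_ne[OF z] by simp
  ultimately show ?thesis by simp
qed

lemma cayley_square: "norm z < 1 \<Longrightarrow> 1 + 4 * koebe z = ((1 + z) / (1 - z))\<^sup>2"
proof -
  assume "norm z < 1"
  then have "(1 - z)\<^sup>2 \<noteq> 0" using norm_less_1_ne by simp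
  then have "1 + 4 * koebe z = ((1 - z)\<^sup>2 + 4 * z) / (1 - z)\<^sup>2" by (simp add: koebe_def add_divide_distrib)
  also have "(1 - z)\<^sup>2 + 4 * z = (1 + z)\<^sup>2" by (simp add: power2_eq_square algebra_simps)
  finally show ?thesis by (simp add: power_divide)
qed

text \<open>By \<open>cayley_square\<close> the expression is a convex combination of 1 and the
  square of a number M in the right half-plane. A real value with \<open>r > 0\<close> forces M to
  be real, and then it is positive.\<close>

lemma pick_arg:
  assumes "norm z < 1" "0 \<le> r" "r \<le> 1"
  shows "1 + 4 * of_real r * koebe z \<notin> \<real>\<^sub>\<le>\<^sub>0"
proof
  define M where "M = (1 + z) / (1 - z)"
  assume a: "1 + 4 * of_real r * koebe z \<in> \<real>\<^sub>\<le>\<^sub>0"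
  have eq: "1 + 4 * of_real r * koebe z = of_real (1 - r) + of_real r * M\<^sup>2"
    unfolding M_def cayley_square[OF assms(1), symmetric] by (simp add: algebra_simps)
  have M: "0 < Re M" unfolding M_def by (rule Re_cayley_pos[OF assms(1)])
  have im: "r * (2 * Re M * Im M) = 0" and re: "(1 - r) + r * ((Re M)\<^sup>2 - (Im M)\<^sup>2) \<le> 0"
    using a unfolding eq complex_nonpos_Reals_iff by (auto simp: power2_eq_square)
  show False
  proof (cases "r = 0")
    case True then show False using re by simp
  next
    case False
    then have "Im M = 0" using im M by simp
    then have "(1 - r) + r * (Re M)\<^sup>2 \<le> 0" using re by simp
    moreover have "0 < r * (Re M)\<^sup>2" using False assms M by simp
    ultimately show False using assms by simp
  qed
qed

lemma csqrt_Re_pos: "w \<notin> \<real>\<^sub>\<le>\<^sub>0 \<Longrightarrow> 0 < Re (csqrt w)"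
  using csqrt_principal[of w] by (metis csqrt_eq_0 complex_nonpos_Reals_iff Re_csqrt csqrt_of_real_nonpos order_le_less power2_csqrt Im_power2 Re_power2 mult_zero_left mult_zero_right zero_eq_power2 diff_0 neg_le_0_iff_le zero_le_power2)

text \<open>The square root lies in the right half-plane and is the Cayley transform of
  \<open>pick r z\<close>; inverting that transform gives both claims.\<close>

lemma pick_props:
  assumes z: "norm z < 1" and r: "0 \<le> r" "r \<le> 1"
  shows "norm (pick r z) < 1" "koebe (pick r z) = of_real r * koebe z"
proof -
  define m where "m = csqrt (1 + 4 * of_real r * koebe z)"
  have m: "0 < Re m" unfolding m_def by (rule csqrt_Re_pos[OF pick_arg[OF assms]])
  have m1: "m + 1 \<noteq> 0" using m by (metis Re_complex_of_real add_less_same_cancel2 complex_Re_numeral less_numeral_extra(1) of_real_0 one_complex.sel(1) order_less_asym plus_complex.sel(1) add_pos_pos zero_complex.sel(1) order_less_irrefl)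
  have pk: "pick r z = (m - 1) / (m + 1)" by (simp add: pick_def m_def)
  have "(norm (m - 1))\<^sup>2 < (norm (m + 1))\<^sup>2" unfolding cmod_power2 using m by (simp add: power2_eq_square algebra_simps)
  then have "norm (m - 1) < norm (m + 1)" by (rule power2_less_imp_less) simp
  then show "norm (pick r z) < 1" using m1 unfolding pk by (simp add: norm_divide divide_less_eq)
  have "1 - pick r z = 2 / (m + 1)" using m1 unfolding pk by (simp add: field_simps)
  then have "koebe (pick r z) = ((m - 1) / (m + 1)) / (2 / (m + 1))\<^sup>2" unfolding koebe_def by (simp add: pk)
  also have "\<dots> = (m\<^sup>2 - 1) / 4" using m1 by (simp add: power_divide power2_eq_square divide_simps) (simp add: algebra_simps)
  also have "m\<^sup>2 = 1 + 4 * of_real r * koebe z" by (simp add: m_def)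
  finally show "koebe (pick r z) = of_real r * koebe z" by simp
qed

lemma koebe_inj:
  assumes "norm a < 1" "norm b < 1" "koebe a = koebe b"
  shows "a = b"
proof -
  have "a * (1 - b)\<^sup>2 = b * (1 - a)\<^sup>2"
    using assms norm_less_1_ne[of a] norm_less_1_ne[of b] by (simp add: koebe_def frac_eq_eq)
  then have "(a - b) * (1 - a * b) = 0" by (simp add: power2_eq_square algebra_simps)
  moreover have "norm (a * b) < 1" using assms mult_strict_mono[of "norm a" 1 "norm b" 1] by (simp add: norm_mult)
  then have "1 - a * b \<noteq> 0" by (rule norm_less_1_ne)
  ultimately show ?thesis by simp
qed

lemma continuous_koebe: "continuous_on (ball 0 1) koebe"
  unfolding koebe_def [abs_def] by (intro continuous_intros) auto

lemma holomorphic_koebe: "koebe holomorphic_on ball 0 1"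
  unfolding koebe_def [abs_def] by (intro holomorphic_intros) auto

lemma continuous_pick:
  assumes f: "continuous_on A f" "\<And>x. x \<in> A \<Longrightarrow> norm (f x) < 1" and r: "0 \<le> r" "r \<le> 1"
  shows "continuous_on A (\<lambda>x. pick r (f x))"
proof -
  have k: "continuous_on A (\<lambda>x. koebe (f x))"
    by (rule continuous_on_compose2[OF continuous_koebe f(1)]) (use f in auto)
  have c: "continuous_on A (\<lambda>x. csqrt (1 + 4 * of_real r * koebe (f x)))"
  proof (rule continuous_on_compose2[OF continuous_on_csqrt])
    show "continuous_on A (\<lambda>x. 1 + 4 * of_real r * koebe (f x))" by (intro continuous_intros k)
  qed (use pick_arg f r in auto)
  have "csqrt (1 + 4 * of_real r * koebe (f x)) + 1 \<noteq> 0" if "x \<in> A" for x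
    using csqrt_Re_pos[OF pick_arg[OF f(2)[OF that] r]] by (metis add_pos_pos less_irrefl one_complex.sel(1) plus_complex.sel(1) zero_complex.sel(1) zero_less_one)
  then show ?thesis unfolding pick_def by (intro continuous_intros c) auto
qed

lemma holomorphic_pick:
  assumes f: "f holomorphic_on ball 0 1" "\<And>x. x \<in> ball 0 1 \<Longrightarrow> norm (f x) < 1" and r: "0 \<le> r" "r \<le> 1"
  shows "(\<lambda>x. pick r (f x)) holomorphic_on ball 0 1"
proof -
  have "(koebe \<circ> f) holomorphic_on ball 0 1"
    by (rule holomorphic_on_compose_gen[OF f(1) holomorphic_koebe]) (use f in auto)
  then have k: "(\<lambda>x. koebe (f x)) holomorphic_on ball 0 1" by (simp add: o_def)
  have k2: "(\<lambda>x. 1 + 4 * of_real r * koebe (f x)) holomorphic_on ball 0 1" by (intro holomorphic_intros k)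
  have "(csqrt \<circ> (\<lambda>x. 1 + 4 * of_real r * koebe (f x))) holomorphic_on ball 0 1"
    by (rule holomorphic_on_compose_gen[OF k2 holomorphic_on_csqrt]) (use pick_arg f r in auto)
  then have c: "(\<lambda>x. csqrt (1 + 4 * of_real r * koebe (f x))) holomorphic_on ball 0 1" by (simp add: o_def)
  have "csqrt (1 + 4 * of_real r * koebe (f x)) + 1 \<noteq> 0" if "x \<in> ball 0 1" for x
    using csqrt_Re_pos[OF pick_arg[OF f(2)[OF that] r]] by (metis add_pos_pos less_irrefl one_complex.sel(1) plus_complex.sel(1) zero_complex.sel(1) zero_less_one)
  then show ?thesis unfolding pick_def by (intro holomorphic_intros c) auto
qed

text \<open>\<open>flow p N j\<close> has derivative \<open>1 - j/N\<close> at 0, which vanishes for \<open>j = N\<close>. There \<open>slit_map\<close> takes over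
  as the limit of the normalized maps.\<close>
primrec flow :: "(nat \<Rightarrow> complex) \<Rightarrow> nat \<Rightarrow> nat \<Rightarrow> complex \<Rightarrow> complex" where
  "flow p N 0 z = z"
| "flow p N (Suc j) z = cnj (p j) * pick (real (N - Suc j) / real (N - j)) (p j * flow p N j z)"

definition slit_map :: "(nat \<Rightarrow> complex) \<Rightarrow> nat \<Rightarrow> complex \<Rightarrow> complex" where
  "slit_map p N z = of_nat N * (cnj (p (N - 1)) * koebe (p (N - 1) * flow p N (N - 1) z))"

definition nflow :: "(nat \<Rightarrow> complex) \<Rightarrow> nat \<Rightarrow> nat \<Rightarrow> complex \<Rightarrow> complex" where
  "nflow p N j z = (if j < N then of_real (1 / (1 - real j / real N)) * flow p N j z else slit_map p N z)"

context
  fixes p :: "nat \<Rightarrow> complex" and N :: nat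
  assumes p: "\<And>j. norm (p j) = 1" and N: "0 < N"
begin

lemma p_cnj: "cnj (p j) * p j = 1" "p j * cnj (p j) = 1" "p j * (cnj (p j) * z) = z" "p j \<noteq> 0"
proof -
  show *: "p j * cnj (p j) = 1" using complex_norm_square[of "p j"] p[of j] by simp
  then show "cnj (p j) * p j = 1" by (simp add: mult.commute)
  show "p j * (cnj (p j) * z) = z" using * by (simp flip: mult.assoc)
  show "p j \<noteq> 0" using p[of j] by auto
qed

text \<open>For \<open>j \<ge> N\<close> the truncated differences make the quotient 0/0, which is
  0, so the bounds hold for every \<open>j\<close>.\<close>

lemma ratio: "0 \<le> real (N - Suc j) / real (N - j)" "real (N - Suc j) / real (N - j) \<le> 1"
  by (auto simp: divide_le_eq_1)

lemma flow_norm: "norm z < 1 \<Longrightarrow> norm (flow p N j z) < 1"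
proof (induction j)
  case (Suc j)
  then show ?case using pick_props(1)[OF _ ratio, of "p j * flow p N j z" j] by (simp add: norm_mult p)
qed simp

lemma flow_norm': "norm z < 1 \<Longrightarrow> norm (p k * flow p N j z) < 1"
  using flow_norm by (simp add: norm_mult p)

lemma flow_holomorphic: "flow p N j holomorphic_on ball 0 1"
proof (induction j)
  case 0 then show ?case by (simp add: holomorphic_on_ident[unfolded id_def] flow.simps(1)[abs_def])
next
  case (Suc j)
  have "(\<lambda>z. pick (real (N - Suc j) / real (N - j)) (p j * flow p N j z)) holomorphic_on ball 0 1"
    by (rule holomorphic_pick[OF _ _ ratio]) (use flow_norm' Suc in \<open>auto intro!: holomorphic_intros\<close>)
  then have "(\<lambda>z. cnj (p j) * pick (real (N - Suc j) / real (N - j)) (p j * flow p N j z)) holomorphic_on ball 0 1"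
    by (intro holomorphic_intros)
  then show ?case by (simp only: flow.simps(2)[abs_def])
qed

lemma flow_koebe: "norm z < 1 \<Longrightarrow> koebe (p j * flow p N (Suc j) z) = of_real (real (N - Suc j) / real (N - j)) * koebe (p j * flow p N j z)"
  using pick_props(2)[OF flow_norm' ratio, of z j j j] by (simp add: p_cnj)

lemma flow_0: "flow p N j 0 = 0"
  by (induction j) (simp_all add: pick_def koebe_def)

text \<open>Up to \<open>j < N\<close> all ratios are positive, so each step can be undone; the
  ratio that follows is 0 and collapses the map.\<close>

lemma flow_inj:
  assumes "j < N"
  shows "inj_on (flow p N j) (ball 0 1)"
  using assms
proof (induction j)
  case (Suc j)
  show ?case
  proof (rule inj_onI)
    fix z w assume zw: "z \<in> ball 0 1" "w \<in> ball 0 1" "flow p N (Suc j) z = flow p N (Suc j) w"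
    have "of_real (real (N - Suc j) / real (N - j)) * koebe (p j * flow p N j z) = of_real (real (N - Suc j) / real (N - j)) * koebe (p j * flow p N j w)"
      using flow_koebe[of z j] flow_koebe[of w j] zw by (simp only: mem_ball_0)
    moreover have nz: "complex_of_real (real (N - Suc j) / real (N - j)) \<noteq> 0"
      using Suc.prems unfolding of_real_eq_0_iff by simp
    ultimately have "koebe (p j * flow p N j z) = koebe (p j * flow p N j w)" by (metis mult_left_cancel)
    then have "p j * flow p N j z = p j * flow p N j w"
      by (rule koebe_inj[OF flow_norm' flow_norm', rotated 2]) (use zw in auto)
    then have "flow p N j z = flow p N j w" using p_cnj by simp
    then show "z = w" using Suc zw by (auto dest: inj_onD)
  qed
qed (auto simp: inj_on_def)

lemma slit_map_holomorphic: "slit_map p N holomorphic_on ball 0 1"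
proof -
  have "(koebe \<circ> (\<lambda>z. p (N - 1) * flow p N (N - 1) z)) holomorphic_on ball 0 1"
    by (rule holomorphic_on_compose_gen[OF _ holomorphic_koebe]) (use flow_norm' in \<open>auto intro!: holomorphic_intros flow_holomorphic\<close>)
  then have "(\<lambda>z. koebe (p (N - 1) * flow p N (N - 1) z)) holomorphic_on ball 0 1" by (simp add: o_def)
  then show ?thesis unfolding slit_map_def [abs_def] by (intro holomorphic_intros)
qed

lemma slit_map_inj: "inj_on (slit_map p N) (ball 0 1)"
proof (rule inj_onI)
  fix z w assume zw: "z \<in> ball 0 1" "w \<in> ball 0 1" "slit_map p N z = slit_map p N w"
  then have "koebe (p (N - 1) * flow p N (N - 1) z) = koebe (p (N - 1) * flow p N (N - 1) w)"
    using N p_cnj by (simp add: slit_map_def)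
  then have "p (N - 1) * flow p N (N - 1) z = p (N - 1) * flow p N (N - 1) w"
    by (rule koebe_inj[OF flow_norm' flow_norm', rotated 2]) (use zw in auto)
  then have "flow p N (N - 1) z = flow p N (N - 1) w" using p_cnj by simp
  then show "z = w" using flow_inj[of "N - 1"] N zw by (auto dest: inj_onD)
qed

lemma nflow_holomorphic: "nflow p N j holomorphic_on ball 0 1"
  using flow_holomorphic slit_map_holomorphic unfolding nflow_def [abs_def]
  by (cases "j < N") (auto intro!: holomorphic_intros)

lemma nflow_0: "nflow p N j 0 = 0"
  by (simp add: nflow_def slit_map_def flow_0 koebe_def)

text \<open>This is \<open>flow_koebe\<close> for the normalized maps, cleared of denominators. In
  this shape it includes the last step, where \<open>d' = 0\<close> and \<open>nflow\<close> is
  \<open>slit_map\<close>.\<close>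

lemma nflow_step:
  assumes "j < N" "norm z < 1"
  defines "d \<equiv> complex_of_real (1 - real j / real N)" and "d' \<equiv> complex_of_real (1 - real (Suc j) / real N)"
  shows "nflow p N (Suc j) z * (1 - p j * d * nflow p N j z)\<^sup>2 = nflow p N j z * (1 - p j * d' * nflow p N (Suc j) z)\<^sup>2"
proof -
  have d: "1 - real j / real N \<noteq> 0" using assms N by (simp add: field_simps)
  have dn: "d * nflow p N j z = flow p N j z" "d \<noteq> 0" using d assms(1) by (auto simp: nflow_def d_def simp flip: of_real_mult mult.assoc)
  define w where "w = p j * flow p N j z"
  have w: "norm w < 1" "1 - w \<noteq> 0" using flow_norm'[OF assms(2)] norm_less_1_ne by (auto simp: w_def)
  have wd: "p j * d * nflow p N j z = w" using dn by (simp add: w_def mult.assoc)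
  have n0: "nflow p N j z = cnj (p j) * w / d" using dn p_cnj by (simp add: w_def field_simps flip: mult.assoc)
  show ?thesis
  proof (cases "Suc j < N")
    case True
    have d1: "1 - real (Suc j) / real N \<noteq> 0" using True by (simp add: field_simps)
    have dn': "d' * nflow p N (Suc j) z = flow p N (Suc j) z" "d' \<noteq> 0"
      using d1 True by (auto simp: nflow_def d'_def simp flip: of_real_mult mult.assoc simp del: flow.simps of_nat_Suc)
    define w' where "w' = p j * flow p N (Suc j) z"
    have w': "norm w' < 1" "1 - w' \<noteq> 0" using flow_norm'[OF assms(2), of j "Suc j"] norm_less_1_ne by (auto simp: w'_def simp del: flow.simps)
    have wd': "p j * d' * nflow p N (Suc j) z = w'" using dn' by (simp add: w'_def mult.assoc del: flow.simps)
    have n1: "nflow p N (Suc j) z = cnj (p j) * w' / d'" using dn' p_cnj by (simp add: w'_def field_simps del: flow.simps flip: mult.assoc)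
    have "real (N - Suc j) / real (N - j) = (1 - real (Suc j) / real N) / (1 - real j / real N)"
      using True N by (simp add: of_nat_diff field_simps)
    then have "koebe w' = d' / d * koebe w"
      using flow_koebe[OF assms(2), of j] unfolding w_def w'_def d_def d'_def by (simp only: of_real_divide)
    then have "w' * (1 - w)\<^sup>2 * d = w * (1 - w')\<^sup>2 * d'"
      using w w' dn(2) by (simp add: koebe_def field_simps)
    then show ?thesis unfolding wd wd' unfolding n0 n1 using dn(2) dn'(2) by (simp add: field_simps)
  next
    case False
    then have j: "j = N - 1" "Suc j = N" using assms by auto
    then have d': "d' = 0" using N by (simp add: d'_def)
    have dN: "d = 1 / of_nat N" using j(2) N by (simp add: d_def field_simps) (metis of_nat_Suc add_diff_cancel_left' of_real_of_nat_eq diff_add_cancel)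
    have "nflow p N (Suc j) z = of_nat N * (cnj (p j) * koebe w)" using j by (simp add: nflow_def slit_map_def w_def)
    then show ?thesis unfolding wd d' unfolding n0 dN koebe_def using w N by simp
  qed
qed

end

text \<open>Comparing power series gives the increments of \<open>lw34_const_step\<close>, without
  error, for a step of length \<open>d - d'\<close>.\<close>

lemma pick_step_coeffs:
  assumes g: "g holomorphic_on ball 0 1" "g 0 = 0" and h: "h holomorphic_on ball 0 1" "h 0 = 0"
    and eq: "\<And>z. norm z < 1 \<Longrightarrow> h z * (1 - q * d * g z)\<^sup>2 = g z * (1 - q * d' * h z)\<^sup>2"
    and g1: "taylor_coeff g 1 = 1"
  defines "X \<equiv> d - d'"
  shows "taylor_coeff h 1 = 1"
    "taylor_coeff h 2 = taylor_coeff g 2 + 2 * q * X"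
    "taylor_coeff h 3 = taylor_coeff g 3 + 4 * q * X * taylor_coeff g 2 - 2 * q\<^sup>2 * d * X + 5 * q\<^sup>2 * X\<^sup>2"
    "taylor_coeff h 4 = taylor_coeff g 4 + (2 * q * (taylor_coeff g 2)\<^sup>2 + 4 * q * taylor_coeff g 3 - 6 * taylor_coeff g 2 * q\<^sup>2 * d + 2 * q ^ 3 * d\<^sup>2) * X
       + (15 * q\<^sup>2 * taylor_coeff g 2 * X\<^sup>2 - 12 * q ^ 3 * d * X\<^sup>2 + 14 * q ^ 3 * X ^ 3)"
proof -
  let ?G = "Abs_fps (taylor_coeff g)" and ?H = "Abs_fps (taylor_coeff h)"
  have z: "taylor_coeff g 0 = 0" "taylor_coeff h 0 = 0" using g h by (simp_all add: taylor_coeff_0)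
  have g1': "taylor_coeff g (Suc 0) = 1" using g1 by simp
  have "?H * (1 - fps_const (q * d) * ?G)\<^sup>2 = ?G * (1 - fps_const (q * d') * ?H)\<^sup>2"
  proof (rule fps_eq_of_eq_near_0[OF _ _ eq])
    show "(\<lambda>z. h z * (1 - q * d * g z)\<^sup>2) has_fps_expansion ?H * (1 - fps_const (q * d) * ?G)\<^sup>2"
      by (intro fps_expansion_intros has_fps_taylor g h)
    show "(\<lambda>z. g z * (1 - q * d' * h z)\<^sup>2) has_fps_expansion ?G * (1 - fps_const (q * d') * ?H)\<^sup>2"
      by (intro fps_expansion_intros has_fps_taylor g h)
  qed
  then have n: "fps_nth (?H * (1 - fps_const (q * d) * ?G)\<^sup>2) n = fps_nth (?G * (1 - fps_const (q * d') * ?H)\<^sup>2) n" for n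
    by simp
  note e = fps_mult_nth eval_nat_numeral power2_eq_square fps_numeral_nth
  from n[of 1] have h1: "taylor_coeff h (Suc 0) = 1" by (simp add: e z g1')
  then show "taylor_coeff h 1 = 1" by simp
  from n[of 2] have h2: "taylor_coeff h 2 = taylor_coeff g 2 + 2 * q * X"
    by (simp add: e z g1' h1 X_def algebra_simps)
  then show "taylor_coeff h 2 = taylor_coeff g 2 + 2 * q * X" .
  from n[of 3] have "taylor_coeff h 3 - 2 * q * d * (taylor_coeff h 2 + taylor_coeff g 2) + q\<^sup>2 * d\<^sup>2 =
      taylor_coeff g 3 - 2 * q * d' * (taylor_coeff h 2 + taylor_coeff g 2) + q\<^sup>2 * d'\<^sup>2"
    by (simp add: e z g1' h1 algebra_simps)
  then show h3: "taylor_coeff h 3 = taylor_coeff g 3 + 4 * q * X * taylor_coeff g 2 - 2 * q\<^sup>2 * d * X + 5 * q\<^sup>2 * X\<^sup>2"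
    unfolding h2 X_def by algebra
  from n[of 4] have "taylor_coeff h 4 - 2 * q * d * (taylor_coeff h 3 + taylor_coeff h 2 * taylor_coeff g 2 + taylor_coeff g 3) + q\<^sup>2 * d\<^sup>2 * (taylor_coeff h 2 + 2 * taylor_coeff g 2) =
      taylor_coeff g 4 - 2 * q * d' * (taylor_coeff h 3 + taylor_coeff h 2 * taylor_coeff g 2 + taylor_coeff g 3) + q\<^sup>2 * d'\<^sup>2 * (taylor_coeff g 2 + 2 * taylor_coeff h 2)"
    by (simp add: e z g1' h1 algebra_simps)
  then show "taylor_coeff h 4 = taylor_coeff g 4 + (2 * q * (taylor_coeff g 2)\<^sup>2 + 4 * q * taylor_coeff g 3 - 6 * taylor_coeff g 2 * q\<^sup>2 * d + 2 * q ^ 3 * d\<^sup>2) * X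
       + (15 * q\<^sup>2 * taylor_coeff g 2 * X\<^sup>2 - 12 * q ^ 3 * d * X\<^sup>2 + 14 * q ^ 3 * X ^ 3)"
    unfolding h3 h2 X_def by algebra
qed

lemma slit_map_coeffs:
  fixes v :: "real \<Rightarrow> real"
  assumes v: "pc v" and N: "0 < N"
    and step: "\<And>j t. j < N \<Longrightarrow> real j / real N \<le> t \<Longrightarrow> t < real (Suc j) / real N \<Longrightarrow> v t = c j"
  defines "p \<equiv> \<lambda>j. cis (c j)" and "P \<equiv> \<lambda>t. cis (v t)"
  shows "j \<le> N \<Longrightarrow> taylor_coeff (nflow p N j) 1 = 1 \<and> taylor_coeff (nflow p N j) 2 = lw2 P (real j / real N)
    \<and> taylor_coeff (nflow p N j) 3 = lw3 P (real j / real N) \<and> taylor_coeff (nflow p N j) 4 = lw4 P (real j / real N)"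
proof (induction j)
  case 0
  have "nflow p N 0 = (\<lambda>z. z)" using N by (simp add: nflow_def fun_eq_iff)
  moreover have "fps_expansion (\<lambda>z::complex. z) 0 = fps_X" by (rule fps_expansion_eqI) (rule has_fps_expansion_fps_X)
  ultimately show ?case
    by (simp add: taylor_coeff_def lw2_def lw3_def lw4_def lwI_def lwW_def lwV_def)
next
  case (Suc j)
  have np: "norm (p j) = 1" for j by (simp add: p_def)
  have j: "j < N" using Suc.prems by simp
  have IH: "taylor_coeff (nflow p N j) 1 = 1" "taylor_coeff (nflow p N j) 2 = lw2 P (real j / real N)"
    "taylor_coeff (nflow p N j) 3 = lw3 P (real j / real N)" "taylor_coeff (nflow p N j) 4 = lw4 P (real j / real N)"
    using Suc j by auto
  have tx: "0 \<le> real j / real N" "0 \<le> 1 / real N" "real j / real N + 1 / real N \<le> 1" "real (Suc j) / real N = real j / real N + 1 / real N"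
    using j N by (simp_all add: field_simps)
  have X: "complex_of_real (1 - real j / real N) - of_real (1 - real (Suc j) / real N) = of_real (1 / real N)"
    unfolding of_real_diff[symmetric] tx(4) by simp
  have const: "P \<tau> = p j" if "real j / real N \<le> \<tau>" "\<tau> < real j / real N + 1 / real N" for \<tau>
    using step[OF j that(1)] that(2) tx(4) by (simp add: P_def p_def)
  have pcP: "pc P" unfolding P_def by (rule pc_cis[OF v])
  note c = pick_step_coeffs[OF nflow_holomorphic[of p N j, OF np N] nflow_0[of p N j, OF np N]
      nflow_holomorphic[of p N "Suc j", OF np N] nflow_0[of p N "Suc j", OF np N]
      nflow_step[of p N j, OF np N j] IH(1), simplified triv_forall_equality, OF TrueI, unfolded X IH]
  note l = lw34_const_step[OF pcP tx(1-3) const, simplified triv_forall_equality, OF TrueI TrueI]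
  show ?case unfolding tx(4) l using c by blast
qed

lemma slit_map_taylor:
  fixes v :: "real \<Rightarrow> real"
  assumes "pc v" "0 < N"
    and "\<And>j t. j < N \<Longrightarrow> real j / real N \<le> t \<Longrightarrow> t < real (Suc j) / real N \<Longrightarrow> v t = c j"
  shows "slit_map (\<lambda>j. cis (c j)) N \<in> univalent_class"
    "taylor_coeff (slit_map (\<lambda>j. cis (c j)) N) 2 = lw2 (\<lambda>t. cis (v t)) 1"
    "taylor_coeff (slit_map (\<lambda>j. cis (c j)) N) 4 = lw4 (\<lambda>t. cis (v t)) 1"
proof -
  let ?p = "\<lambda>j. cis (c j)"
  have e: "nflow ?p N N = slit_map ?p N" by (simp add: nflow_def fun_eq_iff)
  have c: "taylor_coeff (nflow ?p N N) 1 = 1 \<and> taylor_coeff (nflow ?p N N) 2 = lw2 (\<lambda>t. cis (v t)) (real N / real N)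
    \<and> taylor_coeff (nflow ?p N N) 3 = lw3 (\<lambda>t. cis (v t)) (real N / real N) \<and> taylor_coeff (nflow ?p N N) 4 = lw4 (\<lambda>t. cis (v t)) (real N / real N)"
    by (rule slit_map_coeffs[OF assms(1,2)]) (use assms(3) in auto)
  have np: "norm (?p j) = 1" for j by simp
  show "taylor_coeff (slit_map ?p N) 2 = lw2 (\<lambda>t. cis (v t)) 1" "taylor_coeff (slit_map ?p N) 4 = lw4 (\<lambda>t. cis (v t)) 1"
    using c assms(2) by (auto simp: e)
  have "deriv (slit_map ?p N) 0 = 1" using c taylor_coeff_1[of "slit_map ?p N"] by (simp add: e)
  then show "slit_map ?p N \<in> univalent_class"
    unfolding univalent_class_def
    using slit_map_holomorphic[of ?p N, OF np assms(2)] slit_map_inj[of ?p N, OF np assms(2)] nflow_0[of ?p N N, OF np assms(2)]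
    by (simp add: e)
qed

lemma flow_continuous:
  assumes N: "0 < N"
  shows "continuous_on (UNIV \<times> ball 0 1) (\<lambda>x. flow (\<lambda>j. cis (fst x * c j)) N j (snd x))"
proof (induction j)
  case 0 then show ?case by (auto intro!: continuous_intros)
next
  case (Suc j)
  let ?g = "\<lambda>x. cis (fst x * c j) * flow (\<lambda>j. cis (fst x * c j)) N j (snd x)"
  have "continuous_on (UNIV \<times> ball 0 1) ?g" by (intro continuous_intros Suc)
  moreover have "norm (?g x) < 1" if "x \<in> UNIV \<times> ball 0 1" for x
    using that by (intro flow_norm'[OF _ N]) auto
  ultimately have "continuous_on (UNIV \<times> ball 0 1) (\<lambda>x. pick (real (N - Suc j) / real (N - j)) (?g x))"
    by (rule continuous_pick) (auto simp: divide_le_eq_1)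
  then show ?case by (auto intro!: continuous_intros simp: cis_cnj)
qed

lemma slit_map_continuous:
  assumes N: "0 < N"
  shows "continuous_on (UNIV \<times> ball 0 1) (\<lambda>x. slit_map (\<lambda>j. cis (fst x * c j)) N (snd x))"
proof -
  let ?g = "\<lambda>x. cis (fst x * c (N - 1)) * flow (\<lambda>j. cis (fst x * c j)) N (N - 1) (snd x)"
  have "continuous_on (UNIV \<times> ball 0 1) ?g" by (intro continuous_intros flow_continuous N)
  moreover have "norm (?g x) < 1" if "x \<in> UNIV \<times> ball 0 1" for x
    using that by (intro flow_norm'[OF _ N]) auto
  ultimately have "continuous_on (UNIV \<times> ball 0 1) (\<lambda>x. koebe (?g x))"
    by (intro continuous_on_compose2[OF continuous_koebe]) auto
  then show ?thesis unfolding slit_map_def by (auto intro!: continuous_intros simp: cis_cnj)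
qed

text \<open>For the constant direction 1 all Pick maps are conjugated by the same Koebe function,
  and the ratios telescope.\<close>

lemma slit_map_1:
  assumes N: "0 < N" and z: "norm z < 1"
  shows "slit_map (\<lambda>j. 1) N z = koebe z"
proof -
  have "j < N \<Longrightarrow> koebe (flow (\<lambda>j. 1) N j z) = of_real (real (N - j) / real N) * koebe z" for j
  proof (induction j)
    case 0 then show ?case using N by simp
  next
    case (Suc j)
    have "koebe (flow (\<lambda>j. 1) N (Suc j) z) = of_real (real (N - Suc j) / real (N - j)) * koebe (flow (\<lambda>j. 1) N j z)"
      using flow_koebe[of "\<lambda>j. 1" N z j] N z by simp
    also have "\<dots> = of_real (real (N - Suc j) / real (N - j) * (real (N - j) / real N)) * koebe z"
      using Suc by simp
    also have "real (N - Suc j) / real (N - j) * (real (N - j) / real N) = real (N - Suc j) / real N"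
      using Suc.prems by simp
    finally show ?case .
  qed
  from this[of "N - 1"] N show ?thesis by (simp add: slit_map_def)
qed

text \<open>The maps are jointly continuous in the scale of the control and in the point, hence
  uniformly so on a compact product; at scale 0 the map is \<open>koebe\<close>.\<close>

lemma slit_map_uniform_limit:
  assumes N: "0 < N" and C: "compact C" "C \<subseteq> ball 0 1"
  shows "uniform_limit C (\<lambda>n. slit_map (\<lambda>j. cis (inverse (real (Suc n)) * c j)) N) koebe sequentially"
proof -
  let ?F = "\<lambda>x. slit_map (\<lambda>j. cis (fst x * c j)) N (snd x)"
  have "continuous_on ({0..1} \<times> C) ?F" by (rule continuous_on_subset[OF slit_map_continuous[OF N]]) (use C in auto)
  then have uc: "uniformly_continuous_on ({0..1} \<times> C) ?F"
    by (rule compact_uniformly_continuous) (intro compact_Times compact_Icc C)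
  show ?thesis
  proof (rule uniform_limitI)
    fix e :: real assume "e > 0"
    then obtain d where d: "d > 0" "\<And>x x'. x \<in> {0..1} \<times> C \<Longrightarrow> x' \<in> {0..1} \<times> C \<Longrightarrow> dist x' x < d \<Longrightarrow> dist (?F x') (?F x) < e"
      using uc unfolding uniformly_continuous_on_def by meson
    have "eventually (\<lambda>n. inverse (real (Suc n)) < d) sequentially"
      by (rule order_tendstoD(2)[OF LIMSEQ_inverse_real_of_nat d(1)])
    then show "\<forall>\<^sub>F n in sequentially. \<forall>x\<in>C. dist (slit_map (\<lambda>j. cis (inverse (real (Suc n)) * c j)) N x) (koebe x) < e"
    proof eventually_elim
      case (elim n)
      show ?case
      proof
        fix z assume z: "z \<in> C"
        have "dist (?F (inverse (real (Suc n)), z)) (?F (0, z)) < e"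
          by (rule d(2)) (use z elim in \<open>auto simp: dist_Pair_Pair dist_real_def inverse_le_1_iff\<close>)
        moreover have "norm z < 1" using z C by auto
        ultimately show "dist (slit_map (\<lambda>j. cis (inverse (real (Suc n)) * c j)) N z) (koebe z) < e"
          using slit_map_1[OF N, of z] by simp
      qed
    qed
  qed
qed

lemma cos_defect_bounds: "0 \<le> 1 - cos y" "2 * (1 - cos y) \<le> y\<^sup>2" for y :: real
proof -
  have "1 - cos y = 2 * (sin (y / 2))\<^sup>2" using cos_double_sin[of "y / 2"] by simp
  moreover have "(sin (y / 2))\<^sup>2 \<le> (y / 2)\<^sup>2" by (rule abs_le_square_iff[THEN iffD1]) (rule abs_sin_x_le_abs_x)
  ultimately show "2 * (1 - cos y) \<le> y\<^sup>2" by (simp add: power_divide)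
qed simp

text \<open>For the control \<open>s / (n + 1)\<close> the defect \<open>c\<close> is of order n^-2,
  so the needle term is of order n^-4 and the error in \<open>lw4_estimate\<close> of order n^-3.
  After multiplication by (n + 1)^2 only the forms survive.\<close>

lemma scaled_control_limits:
  assumes s: "pc s"
  defines "v \<equiv> \<lambda>n t. inverse (real (Suc n)) * s t"
  shows "(\<lambda>n. (real (Suc n))\<^sup>2 * (2 - Re (lw2 (\<lambda>t. cis (v n t)) 1))) \<longlonglongrightarrow> qform2 s"
    "(\<lambda>n. (real (Suc n))\<^sup>2 * (4 - Re (lw4 (\<lambda>t. cis (v n t)) 1))) \<longlonglongrightarrow> qform4 s"
proof -
  obtain B where B: "\<And>t. 0 \<le> t \<Longrightarrow> t \<le> 1 \<Longrightarrow> \<bar>s t\<bar> \<le> B" "B > 0" using pcE[OF s] by (metis real_norm_def)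
  let ?m = "\<lambda>n. real (Suc n)"
  have pcv: "pc (v n)" for n unfolding v_def by (intro pc_intros s)
  then have ctrl: "control (v n)" for n by (simp add: control_def)
  note cdef = control.c_def[OF ctrl] and xdef = control.x_def[OF ctrl] and sdef = control.s_def[OF ctrl]
  define c where "c n = control.c (v n)" for n
  define x where "x n = control.x (v n)" for n
  define X where "X n = control.X (v n)" for n
  have pcc: "pc (c n)" and pcx: "pc (x n)" for n
    unfolding c_def x_def using control.pc_c[OF ctrl] control.pc_x[OF ctrl] by auto
  have p: "control.p (v n) = (\<lambda>t. cis (v n t))" for n by (simp add: control.p_def[OF ctrl] fun_eq_iff)
  have inv0: "(\<lambda>n. inverse (?m n)) \<longlonglongrightarrow> 0" by (rule LIMSEQ_inverse_real_of_nat)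
  have inv: "filterlim (\<lambda>n. inverse (?m n) * a) (at 0) sequentially" if "a \<noteq> 0" for a
    using tendsto_mult[OF inv0 tendsto_const[of a]] that by (auto simp: filterlim_at intro!: always_eventually)
  have vm: "(?m n)\<^sup>2 * (v n t)\<^sup>2 = (s t)\<^sup>2" for n t by (simp add: v_def power_mult_distrib power_inverse del: of_nat_Suc)
  have c_le: "2 * ((?m n)\<^sup>2 * c n t) \<le> (s t)\<^sup>2" for n t
    using mult_left_mono[OF cos_defect_bounds(2)[of "v n t"], of "(?m n)\<^sup>2"] vm[of n t]
    by (simp add: c_def cdef right_diff_distrib mult.left_commute del: of_nat_Suc)
  have c_ge: "0 \<le> c n t" for n t by (simp add: c_def cdef)
  have sB: "(s t)\<^sup>2 \<le> B\<^sup>2" if "0 \<le> t" "t \<le> 1" for t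
    using B(1)[OF that] B(2) by (simp add: abs_le_square_iff[symmetric])
  have lim_c: "(\<lambda>n. 2 * ((?m n)\<^sup>2 * c n t)) \<longlonglongrightarrow> (s t)\<^sup>2" for t
  proof (cases "s t = 0")
    case True
    have "c n t = 0" for n unfolding c_def cdef by (simp add: v_def True)
    then show ?thesis using True by simp
  next
    case False
    have "((\<lambda>y::real. 2 * (1 - cos y) / y\<^sup>2) \<longlongrightarrow> 1) (at 0)" by real_asymp
    from filterlim_compose[OF this inv[OF False]]
    have "(\<lambda>n. 2 * (1 - cos (v n t)) / (v n t)\<^sup>2 * (s t)\<^sup>2) \<longlonglongrightarrow> 1 * (s t)\<^sup>2"
      unfolding v_def by (intro tendsto_intros)
    moreover have "2 * (1 - cos (v n t)) / (v n t)\<^sup>2 * (s t)\<^sup>2 = 2 * ((?m n)\<^sup>2 * c n t)" for n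
    proof -
      have "v n t \<noteq> 0" using False by (simp add: v_def)
      then show ?thesis unfolding vm[symmetric, of t n] by (simp add: c_def cdef del: of_nat_Suc)
    qed
    ultimately show ?thesis by simp
  qed
  have lim_x: "(\<lambda>n. ?m n * x n t) \<longlonglongrightarrow> s t" for t
  proof (cases "s t = 0")
    case True
    have "x n t = 0" for n unfolding x_def xdef by (simp add: v_def True)
    then show ?thesis using True by simp
  next
    case False
    have "((\<lambda>y::real. sin y * cos y / y) \<longlongrightarrow> 1) (at 0)" by real_asymp
    from filterlim_compose[OF this inv[OF False]]
    have "(\<lambda>n. sin (v n t) * cos (v n t) / (v n t) * s t) \<longlonglongrightarrow> 1 * s t"
      unfolding v_def by (intro tendsto_intros)
    moreover have "sin (v n t) * cos (v n t) / (v n t) * s t = ?m n * x n t" for n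
    proof -
      have "v n t * ?m n = s t" "v n t \<noteq> 0" using False by (simp_all add: v_def del: of_nat_Suc)
      then show ?thesis unfolding x_def xdef by (simp add: field_simps del: of_nat_Suc flip: \<open>v n t * ?m n = s t\<close>)
    qed
    ultimately show ?thesis by simp
  qed
  have x_le: "\<bar>?m n * x n t\<bar> \<le> B" if "0 \<le> t" "t \<le> 1" for n t
  proof -
    have "\<bar>sin (v n t)\<bar> * \<bar>cos (v n t)\<bar> \<le> \<bar>v n t\<bar> * 1"
      by (intro mult_mono abs_sin_x_le_abs_x) auto
    then have "?m n * \<bar>x n t\<bar> \<le> ?m n * \<bar>v n t\<bar>"
      by (intro mult_left_mono) (auto simp: x_def xdef abs_mult)
    also have "\<dots> = \<bar>s t\<bar>" by (simp add: v_def abs_mult del: of_nat_Suc)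
    finally show ?thesis using B(1)[OF that] by (simp add: abs_mult del: of_nat_Suc)
  qed
  have X_eq: "(?m n)\<^sup>2 * X n = J (\<lambda>t. 2 * ((?m n)\<^sup>2 * c n t))" for n
    by (simp add: X_def control.X_def[OF ctrl] c_def del: of_nat_Suc)
  have lim_X: "(\<lambda>n. (?m n)\<^sup>2 * X n) \<longlonglongrightarrow> qform2 s"
    unfolding X_eq qform2_def
  proof (rule integral_tendsto_pc[where F = "{}" and B = "B\<^sup>2"])
    show "pc (\<lambda>t. 2 * ((?m n)\<^sup>2 * c n t))" for n by (intro pc_intros pcc)
    show "\<bar>2 * ((?m n)\<^sup>2 * c n t)\<bar> \<le> B\<^sup>2" if "0 \<le> t" "t \<le> 1" for n t
      using order_trans[OF c_le[of n t] sB[OF that]] c_ge[of n t] by simp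
  qed (auto intro!: pc_intros s lim_c simp del: of_nat_Suc)
  then show "(\<lambda>n. (?m n)\<^sup>2 * (2 - Re (lw2 (\<lambda>t. cis (v n t)) 1))) \<longlonglongrightarrow> qform2 s"
    using control.Re_lw2_1[OF ctrl] by (simp add: p X_def)
  have pcmx: "pc (\<lambda>t. ?m n * x n t)" for n by (intro pc_intros pcx)
  have lim_b: "(\<lambda>n. bform \<nu> (\<lambda>t. ?m n * x n t) (\<lambda>t. ?m n * x n t)) \<longlonglongrightarrow> bform \<nu> s s" for \<nu>
    by (rule bform_tendsto[where F = "{}" and B = B]) (use x_le lim_x pcmx s B in auto)
  \<comment> \<open>Writing \<open>qform4\<close> as a difference of forms makes
    \<open>bform_tendsto\<close> applicable.\<close>
  have q4: "qform4 f = bform 1 f f - bform 0 f f" if "pc f" for f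
    using bform_eq_qform[OF that] by simp
  have lim_q: "(\<lambda>n. (?m n)\<^sup>2 * qform4 (x n)) \<longlonglongrightarrow> qform4 s"
    unfolding qform_scale(2)[symmetric] q4[OF pcmx] q4[OF s] by (intro tendsto_intros lim_b)
  \<comment> \<open>The bracket multiplying \<open>c^2\<close> in the needle term is bounded by 10 *
    2^2 + 10 + 16 = 66.\<close>
  define D where "D = 66 * (B\<^sup>2)\<^sup>2"
  have needle: "\<bar>(?m n)\<^sup>2 * J (control.needle (v n))\<bar> \<le> D * inverse (?m n)" for n
  proof -
    have "\<bar>control.needle (v n) t\<bar> \<le> D * (inverse (?m n) ^ 4)" if t: "0 \<le> t" "t \<le> 1" for t
    proof -
      have nd: "control.needle (v n) t = (c n t)\<^sup>2 * (wt t * (2 - c n t)\<^sup>2 + (10 - (1 - t)\<^sup>2 * (16 - 8 * c n t)))"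
        unfolding control.needle_def[OF ctrl] control.x_eq[OF ctrl] power_mult_distrib control.s_sq[OF ctrl] c_def
        by (simp add: power2_eq_square algebra_simps)
      have c2: "c n t \<le> 2" using control.c_bounds[OF ctrl] by (simp add: c_def)
      have "(2 - c n t)\<^sup>2 \<le> 2\<^sup>2" using c2 c_ge[of n t] by (intro power_mono) auto
      then have a: "wt t * (2 - c n t)\<^sup>2 \<le> 10 * 2\<^sup>2" "0 \<le> wt t * (2 - c n t)\<^sup>2"
        using wt_le_10[OF t] wt_ge_1[of t] by (intro mult_mono mult_nonneg_nonneg; simp)+
      have b: "(1 - t)\<^sup>2 * (16 - 8 * c n t) \<le> 1 * 16" "0 \<le> (1 - t)\<^sup>2 * (16 - 8 * c n t)"
        using t c2 c_ge[of n t] by (intro mult_mono mult_nonneg_nonneg; simp add: power_le_one)+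
      have "\<bar>wt t * (2 - c n t)\<^sup>2 + (10 - (1 - t)\<^sup>2 * (16 - 8 * c n t))\<bar> \<le> 66" using a b by auto
      then have "\<bar>control.needle (v n) t\<bar> \<le> (c n t)\<^sup>2 * 66"
        unfolding nd abs_mult by (intro mult_mono) auto
      also have "(c n t)\<^sup>2 \<le> (B\<^sup>2 * (inverse (?m n))\<^sup>2)\<^sup>2"
      proof (intro power_mono c_ge)
        have "(?m n)\<^sup>2 * c n t \<le> B\<^sup>2" using c_le[of n t] sB[OF t] c_ge[of n t] by (smt (verit) mult_nonneg_nonneg zero_le_power2)
        then show "c n t \<le> B\<^sup>2 * (inverse (?m n))\<^sup>2" by (simp add: power_inverse field_simps del: of_nat_Suc)
      qed
      finally show ?thesis by (simp add: D_def power_mult_distrib mult_ac flip: power_mult)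
    qed
    then have "norm (J (control.needle (v n))) \<le> J (\<lambda>t. D * (inverse (?m n) ^ 4))"
      by (intro J_norm_bound control.pc_needle[OF ctrl] pc_const) auto
    then have 1: "\<bar>J (control.needle (v n))\<bar> \<le> D * (inverse (?m n) ^ 4)" by simp
    have "\<bar>(?m n)\<^sup>2 * J (control.needle (v n))\<bar> = (?m n)\<^sup>2 * \<bar>J (control.needle (v n))\<bar>" by (simp add: abs_mult del: of_nat_Suc)
    also have "\<dots> \<le> (?m n)\<^sup>2 * (D * (inverse (?m n) ^ 4))" using 1 by (intro mult_left_mono) auto
    also have "\<dots> = D * (inverse (?m n))\<^sup>2" by (simp add: power_inverse eval_nat_numeral field_simps del: of_nat_Suc)
    also have "\<dots> \<le> D * inverse (?m n)"
      by (intro mult_left_mono) (auto simp: D_def power2_eq_square mult_left_le inverse_le_1_iff)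
    finally show ?thesis .
  qed
  have lim_needle: "(\<lambda>n. (?m n)\<^sup>2 * J (control.needle (v n))) \<longlonglongrightarrow> 0"
    by (rule Lim_null_comparison[where g = "\<lambda>n. D * inverse (?m n)"])
      (use needle tendsto_mult[OF tendsto_const[of D] inv0] in \<open>auto intro!: always_eventually simp del: of_nat_Suc\<close>)
  define R where "R n = 4 - Re (lw4 (\<lambda>t. cis (v n t)) 1) - (qform4 (x n) + J (control.needle (v n)))" for n
  have R: "\<bar>(?m n)\<^sup>2 * R n\<bar> \<le> 104 * B ^ 3 * inverse (?m n)" for n
  proof -
    have "(?m n)\<^sup>2 * X n \<le> B\<^sup>2"
      unfolding X_eq by (rule J_le_const) (use order_trans[OF c_le sB] in \<open>auto intro!: pc_intros pcc\<close>)
    then have "X n \<le> (B * inverse (?m n))\<^sup>2" by (simp add: power_mult_distrib power_inverse field_simps del: of_nat_Suc)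
    then have "sqrt (X n) \<le> B * inverse (?m n)" using B(2) by (intro real_le_lsqrt) auto
    then have "sqrt (X n) ^ 3 \<le> (B * inverse (?m n)) ^ 3"
      using control.X_bounds[OF ctrl] by (intro power_mono) (auto simp: X_def)
    then have "\<bar>R n\<bar> \<le> 104 * (B * inverse (?m n)) ^ 3"
      using control.lw4_estimate[OF ctrl, of n] unfolding R_def x_def X_def p by linarith
    then have "(?m n)\<^sup>2 * \<bar>R n\<bar> \<le> (?m n)\<^sup>2 * (104 * (B * inverse (?m n)) ^ 3)" by (intro mult_left_mono) auto
    also have "\<dots> = 104 * B ^ 3 * inverse (?m n)" by (simp add: power_mult_distrib eval_nat_numeral field_simps del: of_nat_Suc)
    finally show ?thesis by (simp add: abs_mult del: of_nat_Suc)
  qed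
  have lim_R: "(\<lambda>n. (?m n)\<^sup>2 * R n) \<longlonglongrightarrow> 0"
    by (rule Lim_null_comparison[where g = "\<lambda>n. 104 * B ^ 3 * inverse (?m n)"])
      (use R tendsto_mult[OF tendsto_const[of "104 * B ^ 3"] inv0] in \<open>auto intro!: always_eventually simp del: of_nat_Suc\<close>)
  have "(\<lambda>n. (?m n)\<^sup>2 * qform4 (x n) + (?m n)\<^sup>2 * J (control.needle (v n)) + (?m n)\<^sup>2 * R n) \<longlonglongrightarrow> qform4 s + 0 + 0"
    by (intro tendsto_intros lim_q lim_needle lim_R)
  moreover have "(?m n)\<^sup>2 * qform4 (x n) + (?m n)\<^sup>2 * J (control.needle (v n)) + (?m n)\<^sup>2 * R n = (?m n)\<^sup>2 * (4 - Re (lw4 (\<lambda>t. cis (v n t)) 1))" for n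
    by (simp only: R_def algebra_simps)
  ultimately show "(\<lambda>n. (?m n)\<^sup>2 * (4 - Re (lw4 (\<lambda>t. cis (v n t)) 1))) \<longlonglongrightarrow> qform4 s" by simp
qed

section \<open>The Bombieri number\<close>

lemma taylor_coeff_koebe_2: "taylor_coeff koebe 2 = 2"
proof -
  let ?K = "Abs_fps (taylor_coeff koebe)"
  have "?K * (1 - fps_X)\<^sup>2 = fps_X"
  proof (rule fps_eq_of_eq_near_0)
    show "(\<lambda>z. koebe z * (1 - z)\<^sup>2) has_fps_expansion ?K * (1 - fps_X)\<^sup>2"
      by (intro fps_expansion_intros has_fps_taylor holomorphic_koebe)
    show "(\<lambda>z::complex. z) has_fps_expansion fps_X" by (rule has_fps_expansion_fps_X)
    show "koebe z * (1 - z)\<^sup>2 = z" if "norm z < 1" for z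
      using norm_less_1_ne[OF that] by (simp add: koebe_def)
  qed
  then have n: "fps_nth (?K * (1 - fps_X)\<^sup>2) n = fps_nth fps_X n" for n by simp
  note e = fps_mult_nth eval_nat_numeral power2_eq_square fps_numeral_nth
  have z: "taylor_coeff koebe 0 = 0" by (simp add: taylor_coeff_0 koebe_def)
  from n[of 1] have k1: "taylor_coeff koebe (Suc 0) = 1" by (simp add: e z)
  from n[of 2] show ?thesis by (simp add: e z k1)
qed

text \<open>Cauchy's inequality on the circle of radius 1/2 gives 4 * d/8 = d/2. Closeness of the
  second coefficient is enough, since \<open>coeff_inequalities\<close> controls the fourth one by
  it.\<close>

lemma eventually_taylor_coeff_2:
  assumes "d > 0"
  shows "eventually (\<lambda>f. f \<in> univalent_class \<longrightarrow> norm (taylor_coeff f 2 - 2) < d) (locally_uniformly_at koebe)"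
proof -
  have ball: "cball (0::complex) (1/2) \<subseteq> ball 0 1" by auto
  let ?V = "{f. \<forall>x\<in>cball 0 (1/2). dist (f x) (koebe x) < d / 8}"
  have "locally_uniformly_at koebe \<le> uniformly_on (cball 0 (1/2)) koebe"
    unfolding locally_uniformly_at_def by (rule INF_lower) (use ball in auto)
  also have "\<dots> \<le> principal ?V"
    unfolding uniformly_on_def by (rule INF_lower) (use assms in simp)
  finally have "eventually (\<lambda>f. f \<in> ?V) (locally_uniformly_at koebe)"
    by (simp add: le_principal)
  then show ?thesis
  proof (rule eventually_mono, intro impI)
    fix f assume f: "f \<in> ?V" and fu: "f \<in> univalent_class"
    have fh: "f holomorphic_on ball 0 1" using fu by (simp add: univalent_class_def)
    let ?g = "\<lambda>z. f z - koebe z"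
    have gh: "?g holomorphic_on ball 0 1" by (intro holomorphic_intros fh holomorphic_koebe)
    have "norm ((deriv ^^ 2) ?g 0) \<le> fact 2 * (d / 8) / (1/2) ^ 2"
    proof (rule Cauchy_inequality)
      show "?g holomorphic_on ball 0 (1/2)" by (rule holomorphic_on_subset[OF gh]) auto
      show "continuous_on (cball 0 (1/2)) ?g"
        by (rule holomorphic_on_imp_continuous_on[OF holomorphic_on_subset[OF gh ball]])
      show "norm (f x - koebe x) \<le> d / 8" if "norm (0 - x) = 1/2" for x
        proof -
        have "x \<in> cball 0 (1/2)" using that by simp
        then have "dist (f x) (koebe x) < d / 8" using f by blast
        then show ?thesis by (simp add: dist_norm)
      qed
    qed auto
    then have "norm (taylor_coeff ?g 2) \<le> d / 2"
      by (simp add: taylor_coeff_def fps_expansion_def norm_divide field_simps power2_eq_square)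
    moreover have "taylor_coeff ?g 2 = taylor_coeff f 2 - 2"
    proof -
      have "Abs_fps (taylor_coeff ?g) = Abs_fps (taylor_coeff f) - Abs_fps (taylor_coeff koebe)"
        by (rule fps_eq_of_eq_near_0[OF has_fps_taylor[OF gh] _ refl])
          (intro fps_expansion_intros has_fps_taylor fh holomorphic_koebe)
      then have "fps_nth (Abs_fps (taylor_coeff ?g)) 2 = fps_nth (Abs_fps (taylor_coeff f) - Abs_fps (taylor_coeff koebe)) 2" by simp
      then show ?thesis by (simp add: taylor_coeff_koebe_2)
    qed
    ultimately show "norm (taylor_coeff f 2 - 2) < d" using assms by simp
  qed
qed

text \<open>The inequalities hold for every control and are closed conditions on the two
  coefficients, so they pass to the limit of the approximating controls.\<close>

lemma coeff_inequalities:
  assumes f: "f \<in> univalent_class" and \<nu>: "- 1 / 10 < \<nu>" "\<nu> < 0"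
    and nonneg: "\<And>s. pc s \<Longrightarrow> 0 \<le> bform \<nu> s s"
  defines "X \<equiv> 2 - Re (taylor_coeff f 2)" and "Y \<equiv> 4 - Re (taylor_coeff f 4)"
  shows "0 \<le> X" "- \<nu> * Y \<le> X * (1 + 11 * sqrt X)" "X / 40 - 104 * sqrt X ^ 3 \<le> Y"
proof -
  have "\<forall>n. \<exists>v. pc v \<and> norm (taylor_coeff f 2 - lw2 (\<lambda>t. cis (v t)) 1) \<le> inverse (real (Suc n))
      \<and> norm (taylor_coeff f 4 - lw4 (\<lambda>t. cis (v t)) 1) \<le> inverse (real (Suc n))"
  proof
    fix n show "\<exists>v. pc v \<and> norm (taylor_coeff f 2 - lw2 (\<lambda>t. cis (v t)) 1) \<le> inverse (real (Suc n))
      \<and> norm (taylor_coeff f 4 - lw4 (\<lambda>t. cis (v t)) 1) \<le> inverse (real (Suc n))"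
      using loewner_approx[OF f, of "inverse (real (Suc n))"] by (metis inverse_positive_iff_positive of_nat_0_less_iff zero_less_Suc)
  qed
  then obtain v where v: "\<And>n. pc (v n)" "\<And>n. norm (taylor_coeff f 2 - lw2 (\<lambda>t. cis (v n t)) 1) \<le> inverse (real (Suc n))"
      "\<And>n. norm (taylor_coeff f 4 - lw4 (\<lambda>t. cis (v n t)) 1) \<le> inverse (real (Suc n))"
    by metis
  have ctrl: "control (v n)" for n using v(1) by (simp add: control_def)
  have p: "control.p (v n) = (\<lambda>t. cis (v n t))" for n by (simp add: control.p_def[OF ctrl] fun_eq_iff)
  define x where "x n = control.X (v n)" for n
  define y where "y n = 4 - Re (lw4 (\<lambda>t. cis (v n t)) 1)" for n
  have x_eq: "x n = 2 - Re (lw2 (\<lambda>t. cis (v n t)) 1)" for n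
    using control.Re_lw2_1[OF ctrl, of n] by (simp add: x_def p)
  have "(\<lambda>n. X - x n) \<longlonglongrightarrow> 0"
  proof (rule Lim_null_comparison[OF _ LIMSEQ_inverse_real_of_nat], rule always_eventually, rule allI)
    show "norm (X - x n) \<le> inverse (real (Suc n))" for n
      using v(2)[of n] abs_Re_le_cmod[of "taylor_coeff f 2 - lw2 (\<lambda>t. cis (v n t)) 1"] by (simp add: X_def x_eq)
  qed
  from tendsto_diff[OF tendsto_const[of X] this] have xl: "x \<longlonglongrightarrow> X" by simp
  have "(\<lambda>n. Y - y n) \<longlonglongrightarrow> 0"
  proof (rule Lim_null_comparison[OF _ LIMSEQ_inverse_real_of_nat], rule always_eventually, rule allI)
    show "norm (Y - y n) \<le> inverse (real (Suc n))" for n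
      using v(3)[of n] abs_Re_le_cmod[of "taylor_coeff f 4 - lw4 (\<lambda>t. cis (v n t)) 1"] by (simp add: Y_def y_def)
  qed
  from tendsto_diff[OF tendsto_const[of Y] this] have yl: "y \<longlonglongrightarrow> Y" by simp
  show "0 \<le> X" by (rule LIMSEQ_le_const[OF xl]) (use control.X_bounds[OF ctrl] in \<open>auto simp: x_def\<close>)
  have "(\<lambda>n. - \<nu> * y n) \<longlonglongrightarrow> - \<nu> * Y" "(\<lambda>n. x n * (1 + 11 * sqrt (x n))) \<longlonglongrightarrow> X * (1 + 11 * sqrt X)"
    by (intro tendsto_intros xl yl)+
  then show "- \<nu> * Y \<le> X * (1 + 11 * sqrt X)"
  proof (rule LIMSEQ_le, intro exI allI impI)
    show "- \<nu> * y n \<le> x n * (1 + 11 * sqrt (x n))" for n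
      using control.lower_bound_by_form[OF ctrl \<nu> nonneg[OF control.pc_x[OF ctrl]], of n] by (simp add: x_def y_def p)
  qed
  have "(\<lambda>n. x n / 40 - 104 * sqrt (x n) ^ 3) \<longlonglongrightarrow> X / 40 - 104 * sqrt X ^ 3"
    by (intro tendsto_intros xl) simp
  from this yl show "X / 40 - 104 * sqrt X ^ 3 \<le> Y"
  proof (rule LIMSEQ_le, intro exI allI impI)
    show "x n / 40 - 104 * sqrt (x n) ^ 3 \<le> y n" for n
      using control.coercive_estimate[OF ctrl, of n] by (simp add: x_def y_def p)
  qed
qed

text \<open>Near \<open>koebe\<close> the factor \<open>1 + 11 * sqrt X\<close> is as close to 1 as
  desired, and the denominator is positive, so the second inequality of
  \<open>coeff_inequalities\<close> may be divided by it.\<close>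

lemma bombieri_ge:
  assumes \<nu>: "- 1 / 10 < \<nu>" "\<nu> < 0" and nonneg: "\<And>s. pc s \<Longrightarrow> 0 \<le> bform \<nu> s s"
  shows "ereal (- \<nu>) \<le> bombieri_number 4 2"
  unfolding bombieri_number_def le_Liminf_iff
proof (intro allI impI)
  fix y assume y: "y < ereal (- \<nu>)"
  \<comment> \<open>The intermediate bound \<open>\<sigma>\<close> is taken positive, since
    \<open>d\<close> involves the quotient \<open>- \<nu> / \<sigma>\<close>.\<close>
  have "max y 0 < ereal (- \<nu>)" using y \<nu> by (simp add: zero_ereal_def)
  then obtain \<sigma> where s: "max y 0 < ereal \<sigma>" "ereal \<sigma> < ereal (- \<nu>)" using ereal_dense2 by blast
  then have s': "y < ereal \<sigma>" "0 < \<sigma>" "\<sigma> < - \<nu>" by (auto simp: zero_ereal_def)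
  \<comment> \<open>As 8320 = 80 * 104, the error \<open>104 * sqrt X ^ 3\<close> is at most
    \<open>X / 80\<close>; the denominator is then nonnegative and, being nonzero, positive. The
    second bound gives \<open>\<sigma> * (1 + 11 * d) \<le> - \<nu>\<close>.\<close>
  define d where "d = min (1 / 8320) ((- \<nu> / \<sigma> - 1) / 11)"
  have "1 < - \<nu> / \<sigma>" using s' by (subst less_divide_eq) simp
  then have d: "0 < d" "d \<le> 1 / 8320" "d \<le> (- \<nu> / \<sigma> - 1) / 11"
    unfolding d_def by (simp, intro min.cobounded1, intro min.cobounded2)
  have d2: "\<sigma> * (1 + 11 * d) \<le> - \<nu>"
  proof -
    have "1 + 11 * d \<le> - \<nu> / \<sigma>" using d(3) by simp
    then show ?thesis using s'(2) by (simp add: field_simps)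
  qed
  have key: "y < ereal ((2 - Re (taylor_coeff f 2)) / (4 - Re (taylor_coeff f 4)))"
    if f: "f \<in> univalent_class" "norm (taylor_coeff f 2 - 2) < d\<^sup>2" "4 - Re (taylor_coeff f 4) \<noteq> 0" for f
  proof -
    define X where "X = 2 - Re (taylor_coeff f 2)"
    define Y where "Y = 4 - Re (taylor_coeff f 4)"
    note c = coeff_inequalities[OF f(1) \<nu> nonneg, folded X_def Y_def]
    have "X < d\<^sup>2" using f(2) abs_Re_le_cmod[of "taylor_coeff f 2 - 2"] by (simp add: X_def)
    then have sx: "0 \<le> sqrt X" "sqrt X \<le> d" using d c(1) by (auto intro!: real_le_lsqrt)
    have "sqrt X ^ 3 = X * sqrt X" using c(1) by (simp add: power3_eq_cube)
    also have "\<dots> \<le> X * (1 / 8320)" using sx d c(1) by (intro mult_left_mono) auto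
    finally have "0 \<le> X / 40 - 104 * sqrt X ^ 3" using c(1) by simp
    then have Y: "0 < Y" using c(3) f(3) by (simp add: Y_def)
    have "\<sigma> * (1 + 11 * sqrt X) * Y \<le> - \<nu> * Y"
    proof (rule mult_right_mono)
      have "\<sigma> * (1 + 11 * sqrt X) \<le> \<sigma> * (1 + 11 * d)" using sx s' by (intro mult_left_mono) auto
      then show "\<sigma> * (1 + 11 * sqrt X) \<le> - \<nu>" using d2 by linarith
    qed (use Y in simp)
    also have "\<dots> \<le> X * (1 + 11 * sqrt X)" by (rule c(2))
    finally have "(\<sigma> * Y) * (1 + 11 * sqrt X) \<le> X * (1 + 11 * sqrt X)" by (simp add: mult_ac)
    then have "\<sigma> * Y \<le> X" using sx by (simp add: mult_le_cancel_right)
    then have "\<sigma> \<le> X / Y" using Y by (simp add: field_simps)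
    then have "ereal \<sigma> \<le> ereal (X / Y)" by simp
    then show ?thesis using s'(1) unfolding X_def Y_def by (rule less_le_trans[rotated])
  qed
  have "eventually (\<lambda>f. f \<in> univalent_class \<longrightarrow> norm (taylor_coeff f 2 - 2) < d\<^sup>2) (locally_uniformly_at koebe)"
    by (rule eventually_taylor_coeff_2) (use d in simp)
  then have "eventually (\<lambda>f. f \<in> {f \<in> univalent_class. real 4 - Re (taylor_coeff f 4) \<noteq> 0} \<longrightarrow>
      y < ereal ((real 2 - Re (taylor_coeff f 2)) / (real 4 - Re (taylor_coeff f 4)))) (locally_uniformly_at koebe)"
    by eventually_elim (use key in auto)
  then show "\<forall>\<^sub>F f in inf (locally_uniformly_at koebe) (principal {f \<in> univalent_class. real 4 - Re (taylor_coeff f 4) \<noteq> 0}).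
      y < ereal ((real 2 - Re (taylor_coeff f 2)) / (real 4 - Re (taylor_coeff f 4)))"
    by (simp only: eventually_inf_principal)
qed

text \<open>The slit maps with control \<open>s / (n + 1)\<close> tend to \<open>koebe\<close>, and
  their quotients tend to \<open>qform2 s / qform4 s\<close>. Their denominators are eventually
  positive because \<open>qform4 s\<close> is, so they run inside the filter of the limit
  inferior.\<close>

lemma bombieri_le:
  assumes w: "pc w" and N: "N > 0" and lt: "qform2 (sample w N) < \<sigma> * qform4 (sample w N)" and \<sigma>: "0 < \<sigma>"
  shows "bombieri_number 4 2 \<le> ereal \<sigma>"
proof (rule ccontr)
  assume neg: "\<not> ?thesis"
  define s where "s = sample w N"
  have pcs: "pc s" unfolding s_def by (rule pc_sample[OF w N])
  have q4: "0 < qform4 s"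
  proof -
    have "0 < \<sigma> * qform4 s" using lt qform2_nonneg[OF pcs] by (simp add: s_def)
    then show ?thesis using \<sigma> by (simp add: zero_less_mult_iff)
  qed
  define c where "c j = w (real j / real N)" for j :: nat
  have step: "s t = c j" if "j < N" "real j / real N \<le> t" "t < real (Suc j) / real N" for j t
  proof -
    have "\<lfloor>real N * t\<rfloor> = int j"
      by (rule floor_unique) (use that N in \<open>auto simp: field_simps\<close>)
    then show ?thesis by (simp add: s_def sample_def c_def)
  qed
  define f where "f n = slit_map (\<lambda>j. cis (inverse (real (Suc n)) * c j)) N" for n
  have fv: "f n \<in> univalent_class" "taylor_coeff (f n) 2 = lw2 (\<lambda>t. cis (inverse (real (Suc n)) * s t)) 1"
    "taylor_coeff (f n) 4 = lw4 (\<lambda>t. cis (inverse (real (Suc n)) * s t)) 1" for n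
    unfolding f_def
    by (rule slit_map_taylor[where v = "\<lambda>t. inverse (real (Suc n)) * s t"]; (intro pc_intros pcs | rule N | simp add: step))+
  note lim = scaled_control_limits[OF pcs, folded fv(2,3)]
  let ?X = "\<lambda>n. 2 - Re (taylor_coeff (f n) 2)" and ?Y = "\<lambda>n. 4 - Re (taylor_coeff (f n) 4)"
  have Ypos: "eventually (\<lambda>n. 0 < (real (Suc n))\<^sup>2 * ?Y n) sequentially"
    by (rule order_tendstoD(1)[OF lim(2) q4])
  have "(\<lambda>n. ((real (Suc n))\<^sup>2 * ?X n) / ((real (Suc n))\<^sup>2 * ?Y n)) \<longlonglongrightarrow> qform2 s / qform4 s"
    by (intro tendsto_divide lim) (use q4 in simp)
  moreover have "((real (Suc n))\<^sup>2 * ?X n) / ((real (Suc n))\<^sup>2 * ?Y n) = ?X n / ?Y n" for n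
    by (rule mult_divide_mult_cancel_left) simp
  ultimately have lim_q: "(\<lambda>n. ?X n / ?Y n) \<longlonglongrightarrow> qform2 s / qform4 s" by (simp only:)
  have "qform2 s / qform4 s < \<sigma>" using lt q4 by (simp add: s_def field_simps)
  then have small: "eventually (\<lambda>n. ?X n / ?Y n < \<sigma>) sequentially" by (rule order_tendstoD(2)[OF lim_q])
  let ?A = "{f \<in> univalent_class. real 4 - Re (taylor_coeff f 4) \<noteq> 0}"
  have "filterlim f (inf (locally_uniformly_at koebe) (principal ?A)) sequentially"
    unfolding filterlim_inf filterlim_principal
  proof
    show "filterlim f (locally_uniformly_at koebe) sequentially"
      unfolding locally_uniformly_at_def filterlim_INF
      using slit_map_uniform_limit[OF N] by (auto simp: f_def [abs_def])
    show "\<forall>\<^sub>F n in sequentially. f n \<in> ?A"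
      using Ypos by eventually_elim (use fv(1) in auto)
  qed
  moreover have "eventually (\<lambda>f. ereal \<sigma> < ereal ((real 2 - Re (taylor_coeff f 2)) / (real 4 - Re (taylor_coeff f 4))))
      (inf (locally_uniformly_at koebe) (principal ?A))"
    using neg unfolding bombieri_number_def not_le by (rule less_LiminfD)
  ultimately have "eventually (\<lambda>n. ereal \<sigma> < ereal ((real 2 - Re (taylor_coeff (f n) 2)) / (real 4 - Re (taylor_coeff (f n) 4)))) sequentially"
    by (rule eventually_compose_filterlim[rotated])
  with small have "eventually (\<lambda>n. False) sequentially" by eventually_elim auto
  then show False by simp
qed

theorem theorem9:
  fixes y :: "real \<Rightarrow> nat \<Rightarrow> real \<Rightarrow> real"
  assumes y: "\<And>\<nu>. \<lbrakk>- 1 / 10 < \<nu>; \<nu> < 0\<rbrakk> \<Longrightarrow> cauchy_solution \<nu> (y \<nu>)"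
  defines "roots \<equiv>
    {\<nu>. - 1 / 10 < \<nu> \<and> \<nu> < 0 \<and>
        (y \<nu> 1 1 + \<nu> * y \<nu> 3 1 = 0 \<or>
         (y \<nu> 1 1 + \<nu> * y \<nu> 3 1) * (y \<nu> 7 1 + \<nu> * y \<nu> 9 1)
           - (y \<nu> 13 1 + \<nu> * y \<nu> 15 1)\<^sup>2 = 0)}"
  shows "\<exists>\<nu>s. \<nu>s \<in> roots \<and> (\<forall>\<nu>\<in>roots. \<nu> \<le> \<nu>s) \<and> bombieri_number 4 2 = ereal (- \<nu>s)"
proof (rule extremal_root[OF y])
  fix \<nu>s assume s: "- 1 / 10 < \<nu>s" "\<nu>s < 0"
      "y \<nu>s 1 1 + \<nu>s * y \<nu>s 3 1 = 0 \<or> (y \<nu>s 1 1 + \<nu>s * y \<nu>s 3 1) * (y \<nu>s 7 1 + \<nu>s * y \<nu>s 9 1) - (y \<nu>s 13 1 + \<nu>s * y \<nu>s 15 1)\<^sup>2 = 0"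
    and nonroot: "\<And>\<nu>. \<nu>s < \<nu> \<Longrightarrow> \<nu> < 0 \<Longrightarrow> y \<nu> 1 1 + \<nu> * y \<nu> 3 1 \<noteq> 0 \<and>
      (y \<nu> 1 1 + \<nu> * y \<nu> 3 1) * (y \<nu> 7 1 + \<nu> * y \<nu> 9 1) - (y \<nu> 13 1 + \<nu> * y \<nu> 15 1)\<^sup>2 \<noteq> 0"
    and nonneg: "\<And>s. pc s \<Longrightarrow> 0 \<le> bform \<nu>s s s"
    and near: "\<And>e. e > 0 \<Longrightarrow> \<exists>s N. pc s \<and> N > 0 \<and> qform2 (sample s N) < (- \<nu>s + e) * qform4 (sample s N)"
  have "bombieri_number 4 2 \<le> ereal (- \<nu>s + e)" if "e > 0" for e
  proof -
    from near[OF that] obtain w N where "pc w" "N > 0" "qform2 (sample w N) < (- \<nu>s + e) * qform4 (sample w N)" by blast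
    then show ?thesis by (rule bombieri_le) (use s(2) that in simp)
  qed
  then have "bombieri_number 4 2 \<le> ereal (- \<nu>s) + ereal e" if "e > 0" for e
    using that by simp
  then have "bombieri_number 4 2 \<le> ereal (- \<nu>s)" by (rule ereal_le_epsilon2)
  moreover have "ereal (- \<nu>s) \<le> bombieri_number 4 2" by (rule bombieri_ge[OF s(1,2) nonneg])
  ultimately have "bombieri_number 4 2 = ereal (- \<nu>s)" by (rule antisym)
  moreover have "\<nu> \<le> \<nu>s" if "\<nu> \<in> roots" for \<nu>
    using nonroot[of \<nu>] that unfolding roots_def by fastforce
  ultimately show ?thesis using s unfolding roots_def by blast
qed

end
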